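(* Let $G=(V,E)$ be a finite simple $C_4$-free graph. The algorithm $\mathrm{EnumIM}(G)$ described in the context enumerates all induced matchings of $G$ in constant amortized time per solution after $O(|V|+|E|)$ preprocessing time; that is, its total running time is $O(|V|+|E|+N)$, where $N$ is the number of induced matchings of $G$.
   Context: Graphs are finite, undirected, without loops or parallel edges. A graph is $C_4$-free if it contains no cycle of length four as a subgraph. An induced matching of $G$ is a set $M\subseteq E$ of edges such that for any two distinct $e,e'\in M$, $e$ and $e'$ share no endpoint and no edge of $G$ joins an endpoint of $e$ to an endpoint of $e'$ (the distance between edges is the minimum distance between their endpoints). For a graph $H$, a vertex $v$ and integers $k,\ell$, let $D_v(k,\ell)=\{\{x,y\}\in E(H): \mathrm{dist}_H(x,v)=k,\ \mathrm{dist}_H(y,v)=\ell\}$ and $D_v(k)=D_v(k,k)\cup D_v(k,k+1)$; for an edge $e$ incident to $v$, $\mathrm{Sect}_e(2)=\{f\in D_v(2): \mathrm{dist}_H(v,f)=2,\ \mathrm{dist}_H(e,f)=1\}$. The algorithm $\mathrm{EnumIM}(G)$ calls $\mathrm{Rec}(\emptyset,G)$, where $\mathrm{Rec}(M,H)$ is: if $H$ has no edges, output $M$ and return; otherwise choose a vertex $v$ of maximum degree in $H$; call $\mathrm{Rec}(M,H\setminus\{v\})$; then let $H'$ be obtained from $H$ by deleting the closed neighbourhood $N_H[v]$; for each edge $e$ of $H$ incident to $v$, call $\mathrm{Rec}(M\cup\{e\},H'\setminus \mathrm{Sect}_e(2))$; then return. The vertices are maintained in doubly linked lists bucketed by current degree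 so that a maximum-degree vertex can be found and degrees updated in constant time. *)

theory Defs
  imports Main "HOL-Library.Extended_Nat" "HOL-Library.Monad_Syntax"
begin

section \<open>Graphs, distances and induced matchings\<close>

record 'a graph =
  verts :: "'a set"
  edges :: "'a set set"

definition simple_graph :: "'a graph \<Rightarrow> bool" where
  "simple_graph G \<longleftrightarrow> finite (verts G) \<and>
     (\<forall>e\<in>edges G. \<exists>u v. u \<in> verts G \<and> v \<in> verts G \<and> u \<noteq> v \<and> e = {u, v})"

definition C4_free :: "'a graph \<Rightarrow> bool" where
  "C4_free G \<longleftrightarrow> \<not> (\<exists>a b c d. distinct [a, b, c, d] \<and>
     {a, b} \<in> edges G \<and> {b, c} \<in> edges G \<and> {c, d} \<in> edges G \<and> {d, a} \<in> edges G)"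

definition induced_matching :: "'a graph \<Rightarrow> 'a set set \<Rightarrow> bool" where
  "induced_matching G M \<longleftrightarrow> M \<subseteq> edges G \<and>
     (\<forall>e\<in>M. \<forall>e'\<in>M. e \<noteq> e' \<longrightarrow>
        e \<inter> e' = {} \<and> \<not> (\<exists>x\<in>e. \<exists>y\<in>e'. {x, y} \<in> edges G))"

definition adj_rel :: "'a graph \<Rightarrow> ('a \<times> 'a) set" where
  "adj_rel H = {(x, y). {x, y} \<in> edges H}"

text \<open>The distance is the length of a shortest walk, and \<open>\<infinity>\<close> if there is none.\<close>

definition dist :: "'a graph \<Rightarrow> 'a \<Rightarrow> 'a \<Rightarrow> enat" where
  "dist H x y = (INF n\<in>{n. (x, y) \<in> adj_rel H ^^ n}. enat n)"

definition dist_vertex_edge :: "'a graph \<Rightarrow> 'a \<Rightarrow> 'a set \<Rightarrow> enat" where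
  "dist_vertex_edge H v f = (INF x\<in>f. dist H v x)"

definition dist_edge_edge :: "'a graph \<Rightarrow> 'a set \<Rightarrow> 'a set \<Rightarrow> enat" where
  "dist_edge_edge H e f = (INF x\<in>e. INF y\<in>f. dist H x y)"

definition D2 :: "'a graph \<Rightarrow> 'a \<Rightarrow> nat \<Rightarrow> nat \<Rightarrow> 'a set set" where
  "D2 H v k l = {{x, y} | x y. {x, y} \<in> edges H \<and> dist H x v = enat k \<and> dist H y v = enat l}"

definition D :: "'a graph \<Rightarrow> 'a \<Rightarrow> nat \<Rightarrow> 'a set set" where
  "D H v k = D2 H v k k \<union> D2 H v k (k + 1)"

text \<open>\<open>Sect H v e\<close> is the set $\mathrm{Sect}_e(2)$ for an edge \<open>e\<close> of \<open>H\<close> incident to \<open>v\<close>.\<close>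

definition Sect :: "'a graph \<Rightarrow> 'a \<Rightarrow> 'a set \<Rightarrow> 'a set set" where
  "Sect H v e = {f \<in> D H v 2. dist_vertex_edge H v f = 2 \<and> dist_edge_edge H e f = 1}"

definition incident_edges :: "'a graph \<Rightarrow> 'a \<Rightarrow> 'a set set" where
  "incident_edges H v = {e \<in> edges H. v \<in> e}"

definition degree :: "'a graph \<Rightarrow> 'a \<Rightarrow> nat" where
  "degree H v = card (incident_edges H v)"

definition max_degree_vertex :: "'a graph \<Rightarrow> 'a \<Rightarrow> bool" where
  "max_degree_vertex H v \<longleftrightarrow> v \<in> verts H \<and> (\<forall>u\<in>verts H. degree H u \<le> degree H v)"

definition closed_nbhd :: "'a graph \<Rightarrow> 'a \<Rightarrow> 'a set" where
  "closed_nbhd H v = insert v {u \<in> verts H. {u, v} \<in> edges H}"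

definition del_verts :: "'a graph \<Rightarrow> 'a set \<Rightarrow> 'a graph" where
  "del_verts H X = \<lparr>verts = verts H - X, edges = {e \<in> edges H. e \<inter> X = {}}\<rparr>"

definition del_edges :: "'a graph \<Rightarrow> 'a set set \<Rightarrow> 'a graph" where
  "del_edges H F = \<lparr>verts = verts H, edges = edges H - F\<rparr>"


section \<open>The recursive algorithm\<close>

text \<open>\<open>Rec M H outs\<close>: some execution of the call \<open>Rec(M, H)\<close> outputs the sequence \<open>outs\<close>.
  It is a relation because the choice of the maximum-degree vertex and the order in which the
  incident edges are treated are left open.\<close>

inductive Rec :: "'a set set \<Rightarrow> 'a graph \<Rightarrow> 'a set set list \<Rightarrow> bool" where
  no_edges: "edges H = {} \<Longrightarrow> Rec M H [M]"
| branch: "\<lbrakk> edges H \<noteq> {}; max_degree_vertex H v;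
             Rec M (del_verts H {v}) out0;
             H' = del_verts H (closed_nbhd H v);
             distinct es; set es = incident_edges H v;
             \<And>e. e \<in> set es \<Longrightarrow> Rec (insert e M) (del_edges H' (Sect H v e)) (outs e) \<rbrakk>
           \<Longrightarrow> Rec M H (out0 @ concat (map outs es))"


section \<open>A pointer machine with running time\<close>

text \<open>Memory cells linked into circular doubly linked lists. \<open>Adj u\<close> is the list header of the
  adjacency list of \<open>u\<close>, whose entries are the cells \<open>Arc u w\<close>; \<open>Bkt d\<close> is the header of the list
  of the vertices (cells \<open>Vtx u\<close>) of current degree \<open>d\<close>; \<open>Top\<close> is the header of the list of the
  degrees \<open>d\<close> (cells \<open>Deg d\<close>) with a nonempty bucket, in decreasing order.\<close>

datatype 'a cell = Adj 'a | Arc 'a (target: 'a) | Bkt nat | Vtx (vtx: 'a) | Top | Deg (dg: nat)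

record 'a mem =
  nxt :: "'a cell \<Rightarrow> 'a cell"
  prv :: "'a cell \<Rightarrow> 'a cell"
  deg :: "'a \<Rightarrow> nat"
  cur :: "'a set list"       \<comment> \<open>the current matching \<open>M\<close>, kept as a stack of edges\<close>
  out :: "'a set set list"   \<comment> \<open>the solutions output so far\<close>
  cost :: nat                \<comment> \<open>the number of elementary steps made so far\<close>

text \<open>The result \<open>None\<close> stands for nontermination.\<close>

type_synonym ('a, 'r) prog = "'a mem \<Rightarrow> ('r \<times> 'a mem) option"

definition ret :: "'r \<Rightarrow> ('a, 'r) prog" where
  "ret r = (\<lambda>s. Some (r, s))"

definition bind_prog :: "('a, 'r) prog \<Rightarrow> ('r \<Rightarrow> ('a, 'q) prog) \<Rightarrow> ('a, 'q) prog" where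
  "bind_prog m k = (\<lambda>s. Option.bind (m s) (\<lambda>p. k (fst p) (snd p)))"

adhoc_overloading Monad_Syntax.bind \<rightleftharpoons> bind_prog

text \<open>All access to the memory goes through \<open>step\<close>, which charges one unit of time. Computations
  on a bounded number of local values between two accesses are absorbed in this unit.\<close>

definition step :: "('a mem \<Rightarrow> 'r \<times> 'a mem) \<Rightarrow> ('a, 'r) prog" where
  "step f = (\<lambda>s. case f s of (r, s') \<Rightarrow> Some (r, s'\<lparr>cost := cost s' + 1\<rparr>))"

definition tick :: "('a, unit) prog" where
  "tick = step (\<lambda>s. ((), s))"

definition get_nxt :: "'a cell \<Rightarrow> ('a, 'a cell) prog" where
  "get_nxt c = step (\<lambda>s. (nxt s c, s))"

definition get_prv :: "'a cell \<Rightarrow> ('a, 'a cell) prog" where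
  "get_prv c = step (\<lambda>s. (prv s c, s))"

definition get_deg :: "'a \<Rightarrow> ('a, nat) prog" where
  "get_deg u = step (\<lambda>s. (deg s u, s))"

definition set_nxt :: "'a cell \<Rightarrow> 'a cell \<Rightarrow> ('a, unit) prog" where
  "set_nxt c c' = step (\<lambda>s. ((), s\<lparr>nxt := (nxt s)(c := c')\<rparr>))"

definition set_prv :: "'a cell \<Rightarrow> 'a cell \<Rightarrow> ('a, unit) prog" where
  "set_prv c c' = step (\<lambda>s. ((), s\<lparr>prv := (prv s)(c := c')\<rparr>))"

definition set_deg :: "'a \<Rightarrow> nat \<Rightarrow> ('a, unit) prog" where
  "set_deg u d = step (\<lambda>s. ((), s\<lparr>deg := (deg s)(u := d)\<rparr>))"

definition push_edge :: "'a set \<Rightarrow> ('a, unit) prog" where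
  "push_edge e = step (\<lambda>s. ((), s\<lparr>cur := e # cur s\<rparr>))"

definition pop_edge :: "('a, unit) prog" where
  "pop_edge = step (\<lambda>s. ((), s\<lparr>cur := tl (cur s)\<rparr>))"

text \<open>A solution is reported in one step: it is the current content of the stack, which is not
  copied (equivalently, the output consists of the successive changes of the stack).\<close>

definition emit :: "('a, unit) prog" where
  "emit = step (\<lambda>s. ((), s\<lparr>out := out s @ [set (cur s)]\<rparr>))"

text \<open>Loops over local lists; each iteration and the final test for the end are charged.
  A loop over \<open>rev xs\<close> traverses \<open>xs\<close> backwards, so \<open>rev\<close> itself is not charged.\<close>

primrec for_each :: "'b list \<Rightarrow> ('b \<Rightarrow> ('a, unit) prog) \<Rightarrow> ('a, unit) prog" where
  "for_each [] f = tick"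
| "for_each (x # xs) f = do { tick; f x; for_each xs f }"

primrec map_each :: "'b list \<Rightarrow> ('b \<Rightarrow> ('a, 'c) prog) \<Rightarrow> ('a, 'c list) prog" where
  "map_each [] f = do { tick; ret [] }"
| "map_each (x # xs) f = do { tick; y \<leftarrow> f x; ys \<leftarrow> map_each xs f; ret (y # ys) }"

lemma bind_prog_mono [partial_function_mono]:
  assumes "\<And>s. mono_option (\<lambda>f. m f s)" and "\<And>r s. mono_option (\<lambda>f. k f r s)"
  shows "mono_option (\<lambda>f. bind_prog (m f) (k f) s)"
  unfolding bind_prog_def by (intro partial_function_mono assms)

lemma for_each_mono [partial_function_mono]:
  assumes "\<And>x s. mono_option (\<lambda>f. B f x s)"
  shows "mono_option (\<lambda>f. for_each xs (B f) s)"
proof (induction xs arbitrary: s)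
  case Nil
  show ?case by (simp add: option.const_mono)
next
  case (Cons x xs)
  show ?case
    by (simp, intro bind_prog_mono option.const_mono assms Cons.IH)
qed


lemma if_mono [partial_function_mono]:
  assumes "mono_option (\<lambda>f. A f s)" and "mono_option (\<lambda>f. B f s)"
  shows "mono_option (\<lambda>f. (if P then A f else B f) s)"
  using assms by (cases P) simp_all

lemma case_option_mono [partial_function_mono]:
  assumes "mono_option (\<lambda>f. A f s)" and "\<And>x. mono_option (\<lambda>f. B f x s)"
  shows "mono_option (\<lambda>f. (case r of None \<Rightarrow> A f | Some x \<Rightarrow> B f x) s)"
  using assms by (cases r) simp_all

lemma case_prod_mono [partial_function_mono]:
  assumes "\<And>x y. mono_option (\<lambda>f. B f x y s)"
  shows "mono_option (\<lambda>f. (case p of (x, y) \<Rightarrow> B f x y) s)"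
  using assms by (cases p) simp_all

section \<open>Doubly linked lists and degree buckets\<close>

definition make_empty :: "'a cell \<Rightarrow> ('a, unit) prog" where
  "make_empty h = do { set_nxt h h; set_prv h h }"

definition is_empty :: "'a cell \<Rightarrow> ('a, bool) prog" where
  "is_empty h = do { c \<leftarrow> get_nxt h; ret (c = h) }"

definition unlink :: "'a cell \<Rightarrow> ('a, unit) prog" where
  "unlink c = do { p \<leftarrow> get_prv c; n \<leftarrow> get_nxt c; set_nxt p n; set_prv n p }"

definition insert_after :: "'a cell \<Rightarrow> 'a cell \<Rightarrow> ('a, unit) prog" where
  "insert_after p c = do {
     n \<leftarrow> get_nxt p;
     set_nxt p c; set_prv c p;
     set_nxt c n; set_prv n c }"

partial_function (option) collect :: "'a cell \<Rightarrow> 'a cell \<Rightarrow> 'a mem \<Rightarrow> ('a list \<times> 'a mem) option" where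
  "collect h c s =
     (if c = h then ret []
      else do { c' \<leftarrow> get_nxt c; ws \<leftarrow> collect h c'; ret (target c # ws) }) s"

definition neighbours :: "'a \<Rightarrow> ('a, 'a list) prog" where
  "neighbours u = do { c \<leftarrow> get_nxt (Adj u); collect (Adj u) c }"

definition decr_degree :: "'a \<Rightarrow> ('a, unit) prog" where
  "decr_degree u = do {
     d \<leftarrow> get_deg u;
     b \<leftarrow> is_empty (Bkt (d - 1));
     (if b then insert_after (Deg d) (Deg (d - 1)) else ret ());
     unlink (Vtx u);
     insert_after (Bkt (d - 1)) (Vtx u);
     b \<leftarrow> is_empty (Bkt d);
     (if b then unlink (Deg d) else ret ());
     set_deg u (d - 1) }"

definition incr_degree :: "'a \<Rightarrow> ('a, unit) prog" where
  "incr_degree u = do {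
     d \<leftarrow> get_deg u;
     b \<leftarrow> is_empty (Bkt (d + 1));
     (if b then do { p \<leftarrow> get_prv (Deg d); insert_after p (Deg (d + 1)) } else ret ());
     unlink (Vtx u);
     insert_after (Bkt (d + 1)) (Vtx u);
     b \<leftarrow> is_empty (Bkt d);
     (if b then unlink (Deg d) else ret ());
     set_deg u (d + 1) }"

definition delete_edge :: "'a \<Rightarrow> 'a \<Rightarrow> ('a, unit) prog" where
  "delete_edge u w = do {
     unlink (Arc u w); unlink (Arc w u);
     decr_degree u; decr_degree w }"

definition insert_edge :: "'a \<Rightarrow> 'a \<Rightarrow> ('a, unit) prog" where
  "insert_edge u w = do {
     insert_after (Adj u) (Arc u w); insert_after (Adj w) (Arc w u);
     incr_degree u; incr_degree w }"

text \<open>Deletion and insertion of a vertex of degree \<open>0\<close>.\<close>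

definition delete_isolated :: "'a \<Rightarrow> ('a, unit) prog" where
  "delete_isolated u = do {
     unlink (Vtx u);
     b \<leftarrow> is_empty (Bkt 0);
     (if b then unlink (Deg 0) else ret ()) }"

definition insert_isolated :: "'a \<Rightarrow> ('a, unit) prog" where
  "insert_isolated u = do {
     b \<leftarrow> is_empty (Bkt 0);
     (if b then do { p \<leftarrow> get_prv Top; insert_after p (Deg 0) } else ret ());
     insert_after (Bkt 0) (Vtx u) }"

text \<open>The deletions return the former neighbours of the vertex, from which they are undone.\<close>

definition delete_incident :: "'a \<Rightarrow> ('a, 'a \<times> 'a list) prog" where
  "delete_incident u = do {
     ws \<leftarrow> neighbours u;
     for_each ws (\<lambda>w. delete_edge u w);
     ret (u, ws) }"

definition undo_delete_incident :: "'a \<times> 'a list \<Rightarrow> ('a, unit) prog" where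
  "undo_delete_incident l = for_each (snd l) (\<lambda>w. insert_edge (fst l) w)"

definition delete_vertex :: "'a \<Rightarrow> ('a, 'a \<times> 'a list) prog" where
  "delete_vertex u = do {
     l \<leftarrow> delete_incident u;
     delete_isolated u;
     ret l }"

definition undo_delete_vertex :: "'a \<times> 'a list \<Rightarrow> ('a, unit) prog" where
  "undo_delete_vertex l = do {
     insert_isolated (fst l);
     undo_delete_incident l }"

text \<open>A vertex of maximum degree, or \<open>None\<close> if there are no edges.\<close>

definition max_vertex :: "('a, 'a option) prog" where
  "max_vertex = do {
     c \<leftarrow> get_nxt Top;
     (if c = Top \<or> c = Deg 0 then ret None
      else do { w \<leftarrow> get_nxt (Bkt (dg c)); ret (Some (vtx w)) }) }"


section \<open>The implementation of the algorithm\<close>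

text \<open>One graph is modified in place, and every modification is undone before returning.
  After the vertices of \<open>N[v]\<close> have been deleted, \<open>logs\<close> contains for every neighbour \<open>u\<close> of \<open>v\<close>
  the list of its neighbours \<open>x\<close> at the time of its deletion, which comprises all those at
  distance \<open>2\<close> from \<open>v\<close>. The remaining edges at these \<open>x\<close> are the edges of $\mathrm{Sect}_e(2)$
  for \<open>e = {v, u}\<close>.\<close>

partial_function (option) rec_impl :: "'a mem \<Rightarrow> (unit \<times> 'a mem) option" where
  "rec_impl s = (do {
     r \<leftarrow> max_vertex;
     (case r of
        None \<Rightarrow> emit
      | Some v \<Rightarrow> do {
          l \<leftarrow> delete_vertex v;
          rec_impl;
          logs \<leftarrow> map_each (snd l) delete_vertex;
          for_each logs (\<lambda>(u, xs). do {
            push_edge {v, u};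
            sect \<leftarrow> map_each xs delete_incident;
            rec_impl;
            for_each (rev sect) undo_delete_incident;
            pop_edge });
          for_each (rev logs) undo_delete_vertex;
          undo_delete_vertex l }) }) s"

text \<open>The input is a list of the vertices and a list of the edges, each edge occurring once and
  in one of its two orientations.\<close>

definition represents :: "'a list \<Rightarrow> ('a \<times> 'a) list \<Rightarrow> 'a graph \<Rightarrow> bool" where
  "represents vs es G \<longleftrightarrow> distinct vs \<and> set vs = verts G \<and>
     distinct (map (\<lambda>(u, w). {u, w}) es) \<and> set (map (\<lambda>(u, w). {u, w}) es) = edges G"

definition preprocess :: "'a list \<Rightarrow> ('a \<times> 'a) list \<Rightarrow> ('a, unit) prog" where
  "preprocess vs es = do {
     make_empty Top;
     for_each [0..<length vs] (\<lambda>d. make_empty (Bkt d));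
     for_each vs (\<lambda>u. do { make_empty (Adj u); set_deg u 0; insert_isolated u });
     for_each es (\<lambda>(u, w). insert_edge u w) }"

definition EnumIM :: "'a list \<Rightarrow> ('a \<times> 'a) list \<Rightarrow> ('a, unit) prog" where
  "EnumIM vs es = do { preprocess vs es; rec_impl }"

text \<open>The initial memory: the cells have arbitrary contents.\<close>

definition start_mem ::
    "('a cell \<Rightarrow> 'a cell) \<Rightarrow> ('a cell \<Rightarrow> 'a cell) \<Rightarrow> ('a \<Rightarrow> nat) \<Rightarrow> 'a mem" where
  "start_mem nx pv dgr = \<lparr>nxt = nx, prv = pv, deg = dgr, cur = [], out = [], cost = 0\<rparr>"

end

theory Submission
  imports Defs
begin

text \<open>The running time is bounded by a potential argument. Let \<open>N\<close> be the number of induced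
  matchings of \<open>H\<close>, let \<open>P\<^sub>k\<close> be the number of those with at most \<open>k\<close> edges, and let \<open>R\<close> be
  the sum over all edges of the smaller degree of the two endpoints. By induction, a call
  on \<open>H\<close> takes time at most \<open>a N + K R - 9 K (P\<^sub>0 + P\<^sub>1 + P\<^sub>2)\<close>. Branching on a vertex \<open>v\<close> of maximum
  degree costs time proportional to the number of edges at distance at most \<open>2\<close> from \<open>v\<close>. The edges at
  the neighbours of \<open>v\<close> are paid by the decrease of \<open>R\<close>, which the deletion of \<open>v\<close> lowers by
  at least the sum of the degrees of the neighbours. Since \<open>P\<^sub>k\<close> of \<open>H\<close> is \<open>P\<^sub>k\<close> of \<open>H - v\<close> plus the sum of
  \<open>P\<^sub>k\<^sub>-\<^sub>1\<close> over the other children, the third term yields a surplus of \<open>9 K\<close> times the sum of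
  \<open>P\<^sub>2\<close> over these children. It pays for the remaining edges, because without 4-cycles an edge
  is deleted by \<open>Sect\<close> in at most two of the children, and for the terms \<open>R\<close> of the children,
  because \<open>R \<le> 4 P\<^sub>2\<close> for the same reason. The last inequality also gives the total
  bound \<open>a N\<close>.\<close>

section \<open>Graphs\<close>

text \<open>Charging a call to its own children fails: apart from the deletion of \<open>v\<close>
  it has one child per edge at \<open>v\<close>, while there may be far more edges within distance
  2, and only deeper descendants are numerous enough. The bound is therefore strengthened by a
  subtracted term whose recurrence telescopes. Its factor 9 is 1 + 4 + 4: the surplus pays once for
  the degree \<open>d\<close> of \<open>v\<close>, four times for the degrees at distance 2 and four
  times for the terms \<open>R\<close> of the children. That all but two children keep an edge helps
  only for \<open>d \<ge> 3\<close>; for \<open>d \<le> 2\<close> all degrees are at most 2 and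
  direct estimates suffice. On the machine side, undoing a deletion restores the graph but not the
  order inside the linked lists. The invariant thus records lists as sets, apart from the order of
  the listed degrees, and the output is compared with the relation \<open>Rec\<close>, which leaves
  the order of the branches open.\<close>

definition nbrs :: "'a graph \<Rightarrow> 'a \<Rightarrow> 'a set" where
  "nbrs H v = {u. {v, u} \<in> edges H}"

definition IM :: "'a graph \<Rightarrow> 'a set set set" where
  "IM H = {M. induced_matching H M}"

definition child :: "'a graph \<Rightarrow> 'a \<Rightarrow> 'a set \<Rightarrow> 'a graph" where
  "child H v e = del_edges (del_verts H (closed_nbhd H v)) (Sect H v e)"

lemma simple_edgeD:
  assumes "simple_graph H" "{u, w} \<in> edges H"
  shows "u \<noteq> w" "u \<in> verts H" "w \<in> verts H"
  using assms unfolding simple_graph_def by (auto simp: doubleton_eq_iff dest!: bspec)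

lemma simple_edgeE:
  assumes "simple_graph H" "e \<in> edges H"
  obtains u w where "e = {u, w}" "u \<noteq> w" "u \<in> verts H" "w \<in> verts H" "{u, w} \<in> edges H"
proof -
  from assms obtain u w where "u \<in> verts H" "w \<in> verts H" "u \<noteq> w" "e = {u, w}"
    unfolding simple_graph_def by (auto dest!: bspec[of _ _ e])
  with assms(2) show thesis by (auto intro!: that[of u w])
qed

lemma simple_finite_verts: "simple_graph H \<Longrightarrow> finite (verts H)"
  by (simp add: simple_graph_def)

lemma simple_finite_edges: "simple_graph H \<Longrightarrow> finite (edges H)"
  by (rule finite_subset[of _ "Pow (verts H)"]) (auto simp: simple_finite_verts elim: simple_edgeE)

lemma simple_finite_edge: "simple_graph H \<Longrightarrow> e \<in> edges H \<Longrightarrow> finite e"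
  by (auto elim: simple_edgeE)

lemma simple_del_verts: "simple_graph H \<Longrightarrow> simple_graph (del_verts H X)"
  unfolding simple_graph_def del_verts_def by fastforce

lemma simple_del_edges: "simple_graph H \<Longrightarrow> simple_graph (del_edges H F)"
  unfolding simple_graph_def del_edges_def by auto

lemma simple_child: "simple_graph H \<Longrightarrow> simple_graph (child H v e)"
  by (simp add: child_def simple_del_edges simple_del_verts)

lemma C4_free_mono: "C4_free H \<Longrightarrow> edges H' \<subseteq> edges H \<Longrightarrow> C4_free H'"
  unfolding C4_free_def by (meson subsetD)

lemma edges_child_subset: "edges (child H v e) \<subseteq> edges H"
  by (auto simp: child_def del_edges_def del_verts_def)

lemma nbrs_subset: "simple_graph H \<Longrightarrow> nbrs H v \<subseteq> verts H - {v}"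
  by (auto simp: nbrs_def dest: simple_edgeD)

lemma finite_nbrs: "simple_graph H \<Longrightarrow> finite (nbrs H v)"
  by (meson nbrs_subset finite_subset finite_Diff simple_finite_verts)

lemma incident_edges_eq: "simple_graph H \<Longrightarrow> incident_edges H v = (\<lambda>u. {v, u}) ` nbrs H v"
proof (intro subset_antisym subsetI)
  fix e assume "simple_graph H" "e \<in> incident_edges H v"
  then obtain u w where "e = {u, w}" "{u, w} \<in> edges H" "v = u \<or> v = w"
    by (auto simp: incident_edges_def elim: simple_edgeE)
  then show "e \<in> (\<lambda>u. {v, u}) ` nbrs H v"
    by (auto simp: nbrs_def insert_commute)
qed (auto simp: incident_edges_def nbrs_def)

lemma inj_on_edge: "inj_on (\<lambda>u. {v, u}) A"
  by (auto simp: inj_on_def doubleton_eq_iff)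

lemma degree_eq_card_nbrs: "simple_graph H \<Longrightarrow> degree H v = card (nbrs H v)"
  by (simp add: degree_def incident_edges_eq card_image inj_on_edge)

lemma degree_mono:
  "simple_graph H \<Longrightarrow> edges H' \<subseteq> edges H \<Longrightarrow> degree H' v \<le> degree H v"
  unfolding degree_def incident_edges_def
  by (rule card_mono) (auto simp: simple_finite_edges)

lemma closed_nbhd_eq: "simple_graph H \<Longrightarrow> closed_nbhd H v = insert v (nbrs H v)"
  by (auto simp: closed_nbhd_def nbrs_def insert_commute dest: simple_edgeD)

text \<open>Handshake count of incidences: an edge has at most two points in \<open>X\<close>. It is
  applied to sets of selected endpoints, not to the whole vertex set.\<close>

lemma sum_degree_le:
  assumes "simple_graph H" "finite X"
  shows "(\<Sum>x\<in>X. degree H x) \<le> 2 * card (edges H)"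
proof -
  have "(\<Sum>x\<in>X. degree H x) = (\<Sum>x\<in>X. \<Sum>e | e \<in> edges H \<and> x \<in> e. 1)"
    by (simp add: degree_def incident_edges_def)
  also have "\<dots> = (\<Sum>e\<in>edges H. \<Sum>x | x \<in> X \<and> x \<in> e. 1)"
    by (rule sum.swap_restrict) (simp_all add: assms simple_finite_edges)
  also have "\<dots> \<le> (\<Sum>e\<in>edges H. 2)"
  proof (rule sum_mono)
    fix e assume "e \<in> edges H"
    with assms(1) obtain u w where "e = {u, w}" by (auto elim: simple_edgeE)
    then have "card {x. x \<in> X \<and> x \<in> e} \<le> card {u, w}" by (intro card_mono) auto
    also have "\<dots> \<le> 2" by (simp add: card_insert_if)
    finally show "(\<Sum>x | x \<in> X \<and> x \<in> e. 1) \<le> (2::nat)" by simp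
  qed
  finally show ?thesis by simp
qed

section \<open>Distances\<close>

text \<open>The empty infimum is infinity, so a finite distance is attained by a walk. Distances
  thereby reduce to powers of \<open>adj_rel\<close>.\<close>

lemma dist_eq_enat_iff:
  "dist H x y = enat k \<longleftrightarrow> (x, y) \<in> adj_rel H ^^ k \<and> (\<forall>j<k. (x, y) \<notin> adj_rel H ^^ j)"
proof -
  let ?N = "{n. (x, y) \<in> adj_rel H ^^ n}"
  show ?thesis
  proof (cases "?N = {}")
    case True
    then show ?thesis by (auto simp: dist_def top_enat_def)
  next
    case False
    define m where "m = (LEAST n. n \<in> ?N)"
    have m: "m \<in> ?N" "\<And>j. j \<in> ?N \<Longrightarrow> m \<le> j"
      using False unfolding m_def by (auto intro: LeastI Least_le)
    have "dist H x y = enat m"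
      unfolding dist_def by (rule antisym) (auto intro!: INF_lower INF_greatest m)
    moreover have "m = k \<longleftrightarrow> k \<in> ?N \<and> (\<forall>j<k. j \<notin> ?N)"
      using m by (metis leD linorder_neqE_nat)
    ultimately show ?thesis by simp
  qed
qed

lemma dist_sym: "dist H x y = dist H y x"
proof -
  have "(y, x) \<in> adj_rel H ^^ n" if "(x, y) \<in> adj_rel H ^^ n" for x y n
    using that
  proof (induction n arbitrary: y)
    case (Suc n)
    then obtain z where "(z, x) \<in> adj_rel H ^^ n" "(y, z) \<in> adj_rel H"
      by (auto simp: adj_rel_def insert_commute)
    then show ?case by (rule relpow_Suc_I2[rotated])
  qed simp
  then have "{n. (x, y) \<in> adj_rel H ^^ n} = {n. (y, x) \<in> adj_rel H ^^ n}" by blast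
  then show ?thesis by (simp add: dist_def)
qed

lemma dist_0_iff: "dist H x y = 0 \<longleftrightarrow> x = y"
  using dist_eq_enat_iff[of H x y 0] by (simp add: zero_enat_def)

lemma dist_1_iff: "dist H x y = 1 \<longleftrightarrow> {x, y} \<in> edges H \<and> x \<noteq> y"
  using dist_eq_enat_iff[of H x y 1] by (auto simp: one_enat_def adj_rel_def)

lemma dist_ge_1: "x \<noteq> y \<Longrightarrow> 1 \<le> dist H x y"
  by (metis dist_0_iff ileI1 one_eSuc i0_lb order_le_less)

lemma dist_ge_2: "x \<noteq> y \<Longrightarrow> {x, y} \<notin> edges H \<Longrightarrow> 2 \<le> dist H x y"
  using dist_ge_1[of x y H] dist_1_iff[of H x y]
  by (cases "dist H x y") (auto simp: one_enat_def numeral_eq_enat)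

lemma dist_le: "(x, y) \<in> adj_rel H ^^ k \<Longrightarrow> dist H x y \<le> enat k"
  unfolding dist_def by (rule INF_lower) simp

text \<open>Outside \<open>N[v]\<close> the distance conditions collapse to adjacency with
  \<open>u\<close>. A neighbour \<open>x\<close> of \<open>u\<close> on \<open>f\<close> has
  distance 2 from \<open>v\<close>, and the other endpoint then has distance 2 or 3, the two cases
  of \<open>D\<close>. Conversely, distance 1 between \<open>{v, u}\<close> and \<open>f\<close>
  must be realised at \<open>u\<close>, because \<open>f\<close> contains no neighbour of
  \<open>v\<close>.\<close>

lemma Sect_iff:
  assumes H: "simple_graph H" and e: "{v, u} \<in> edges H"
    and f: "f \<in> edges H" "f \<inter> closed_nbhd H v = {}"
  shows "f \<in> Sect H v {v, u} \<longleftrightarrow> (\<exists>x\<in>f. {u, x} \<in> edges H)"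
proof
  assume "f \<in> Sect H v {v, u}"
  then have "dist_edge_edge H {v, u} f = 1" by (simp add: Sect_def)
  moreover obtain x y where fxy: "f = {x, y}" using f H by (auto elim: simple_edgeE)
  ultimately have "dist H v x = 1 \<or> dist H v y = 1 \<or> dist H u x = 1 \<or> dist H u y = 1"
    unfolding dist_edge_edge_def fxy INF_insert ccINF_insert image_insert image_empty Inf_insert Inf_empty inf_top_right
    by (auto simp: inf_min min_def split: if_splits)
  then obtain a z where "a \<in> {v, u}" "z \<in> f" "dist H a z = 1"
    using fxy by blast
  moreover have "{v, z} \<notin> edges H" if "z \<in> f" for z
    using f that H by (auto simp: closed_nbhd_eq nbrs_def)
  ultimately show "\<exists>x\<in>f. {u, x} \<in> edges H" by (auto simp: dist_1_iff)
next
  assume "\<exists>x\<in>f. {u, x} \<in> edges H"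
  then obtain x y where x: "{u, x} \<in> edges H" and fxy: "f = {x, y}"
    using f H by (auto elim!: simple_edgeE simp: insert_commute)
  \<comment> \<open>Here \<open>y \<noteq> u\<close> because \<open>u\<close> lies in
    \<open>N[v]\<close>; it keeps \<open>dist H u y\<close> from being 0, so that the minimum over
    the endpoints is exactly 1.\<close>
  have nv: "v \<noteq> x" "v \<noteq> y" "{v, x} \<notin> edges H" "{v, y} \<notin> edges H" "y \<noteq> u"
    using f fxy H e by (auto simp: closed_nbhd_eq nbrs_def)
  have ux: "u \<noteq> x" using simple_edgeD[OF H x] by simp
  have 2: "(v, x) \<in> adj_rel H ^^ 2" using e x by (auto simp: adj_rel_def numeral_2_eq_2)
  have 3: "(v, y) \<in> adj_rel H ^^ 3"
    using relpow_Suc_I[of v x 2 "adj_rel H" y] 2 f fxy by (auto simp: adj_rel_def eval_nat_numeral)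
  have dx: "dist H v x = 2"
    using dist_le[OF 2] dist_ge_2[of v x H] nv by (simp add: numeral_eq_enat)
  have dy: "dist H v y = 2 \<or> dist H v y = 3"
    using dist_le[OF 3] dist_ge_2[of v y H] nv
    by (cases "dist H v y") (auto simp: numeral_eq_enat)
  have "dist H x v = enat 2 \<and> (dist H y v = enat 2 \<or> dist H y v = enat (2 + 1))"
    using dx dy by (simp add: dist_sym[of H _ v] numeral_eq_enat)
  then have "f \<in> D H v 2"
    using f(1) fxy unfolding D_def D2_def by blast
  moreover have "dist_vertex_edge H v f = 2"
    using dx dy by (auto simp: dist_vertex_edge_def fxy inf_min)
  moreover have "dist H u x = 1" using x ux by (simp add: dist_1_iff)
  then have "dist_edge_edge H {v, u} f = 1"
    using dx dy dist_ge_1[of u y H] nv by (auto simp: dist_edge_edge_def fxy inf_min min_def)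
  ultimately show "f \<in> Sect H v {v, u}" by (simp add: Sect_def)
qed

text \<open>From here on the children are handled through adjacency alone and distances do not occur
  again.\<close>

lemma edges_child:
  assumes "simple_graph H" "{v, u} \<in> edges H"
  shows "edges (child H v {v, u})
    = {f \<in> edges H. f \<inter> closed_nbhd H v = {} \<and> f \<inter> nbrs H u = {}}"
proof -
  have "f \<in> Sect H v {v, u} \<longleftrightarrow> f \<inter> nbrs H u \<noteq> {}"
    if "f \<in> edges H" "f \<inter> closed_nbhd H v = {}" for f
    using Sect_iff[OF assms that] by (auto simp: nbrs_def)
  then show ?thesis by (auto simp: child_def del_edges_def del_verts_def)
qed

section \<open>Branching on a vertex\<close>

lemma IM_iff:
  "M \<in> IM H \<longleftrightarrow> M \<subseteq> edges H \<and>
     (\<forall>f\<in>M. \<forall>g\<in>M. f \<noteq> g \<longrightarrow> (\<forall>x\<in>f. \<forall>y\<in>g. x \<noteq> y \<and> {x, y} \<notin> edges H))"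
proof -
  have "f \<inter> g = {} \<and> \<not> (\<exists>x\<in>f. \<exists>y\<in>g. {x, y} \<in> edges H) \<longleftrightarrow>
    (\<forall>x\<in>f. \<forall>y\<in>g. x \<noteq> y \<and> {x, y} \<notin> edges H)" for f g
    by blast
  then show ?thesis by (simp add: IM_def induced_matching_def)
qed

lemma IM_edge: "M \<in> IM H \<Longrightarrow> f \<in> M \<Longrightarrow> f \<in> edges H"
  by (auto simp: IM_iff)

lemma IM_apart:
  "M \<in> IM H \<Longrightarrow> f \<in> M \<Longrightarrow> g \<in> M \<Longrightarrow> f \<noteq> g \<Longrightarrow> x \<in> f \<Longrightarrow> y \<in> g \<Longrightarrow> x \<noteq> y \<and> {x, y} \<notin> edges H"
  by (simp add: IM_iff)

lemma IM_I:
  assumes "\<And>f. f \<in> M \<Longrightarrow> f \<in> edges H"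
    and "\<And>f g x y. f \<in> M \<Longrightarrow> g \<in> M \<Longrightarrow> f \<noteq> g \<Longrightarrow> x \<in> f \<Longrightarrow> y \<in> g \<Longrightarrow> x \<noteq> y \<and> {x, y} \<notin> edges H"
  shows "M \<in> IM H"
  using assms by (simp add: IM_iff subset_iff)

lemma edges_del_vert: "edges (del_verts H {v}) = {e \<in> edges H. v \<notin> e}"
  by (auto simp: del_verts_def)

lemma IM_del_vert: "IM (del_verts H {v}) = {M \<in> IM H. \<forall>e\<in>M. v \<notin> e}"
proof (intro set_eqI iffI)
  fix M assume M: "M \<in> IM (del_verts H {v})"
  have nv: "v \<notin> e" "e \<in> edges H" if "e \<in> M" for e
    using IM_edge[OF M that] by (auto simp: edges_del_vert)
  have "M \<in> IM H"
  proof (rule IM_I)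
    fix f g x y assume a: "f \<in> M" "g \<in> M" "f \<noteq> g" "x \<in> f" "y \<in> g"
    then have "v \<noteq> x" "v \<noteq> y" using nv by auto
    then show "x \<noteq> y \<and> {x, y} \<notin> edges H"
      using IM_apart[OF M a] by (simp add: edges_del_vert)
  qed (rule nv)
  with nv show "M \<in> {M \<in> IM H. \<forall>e\<in>M. v \<notin> e}" by simp
next
  fix M assume M: "M \<in> {M \<in> IM H. \<forall>e\<in>M. v \<notin> e}"
  show "M \<in> IM (del_verts H {v})"
  proof (rule IM_I)
    fix f g x y assume a: "f \<in> M" "g \<in> M" "f \<noteq> g" "x \<in> f" "y \<in> g"
    then show "x \<noteq> y \<and> {x, y} \<notin> edges (del_verts H {v})"
      using IM_apart[of M H f g x y] M by (simp add: edges_del_vert)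
  qed (use M in \<open>auto simp: edges_del_vert intro: IM_edge\<close>)
qed

text \<open>The edges of the child are those compatible with \<open>{v, u}\<close>. An edge of
  \<open>H\<close> joining endpoints of two such edges avoids the same vertices, hence survives in
  the child; so being induced means the same in the child and in \<open>H\<close>.\<close>

lemma IM_insert_iff:
  assumes H: "simple_graph H" and e: "{v, u} \<in> edges H" and M: "{v, u} \<notin> M"
  shows "insert {v, u} M \<in> IM H \<longleftrightarrow> M \<in> IM (child H v {v, u})"
proof
  assume ins: "insert {v, u} M \<in> IM H"
  show "M \<in> IM (child H v {v, u})"
  proof (rule IM_I)
    fix f assume f: "f \<in> M"
    have "z \<noteq> v \<and> {v, z} \<notin> edges H \<and> {u, z} \<notin> edges H" if "z \<in> f" for z
      using IM_apart[OF ins, of "{v, u}" f v z] IM_apart[OF ins, of "{v, u}" f u z] f M that by auto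
    then show "f \<in> edges (child H v {v, u})"
      using IM_edge[OF ins, of f] f by (auto simp: edges_child[OF H e] closed_nbhd_eq[OF H] nbrs_def)
  next
    fix f g x y assume "f \<in> M" "g \<in> M" "f \<noteq> g" "x \<in> f" "y \<in> g"
    then show "x \<noteq> y \<and> {x, y} \<notin> edges (child H v {v, u})"
      using IM_apart[OF ins, of f g x y] by (simp add: edges_child[OF H e])
  qed
next
  assume M': "M \<in> IM (child H v {v, u})"
  have sub: "f \<in> edges H" "f \<inter> closed_nbhd H v = {}" "f \<inter> nbrs H u = {}" if "f \<in> M" for f
    using IM_edge[OF M' that] by (simp_all add: edges_child[OF H e])
  have nb: "closed_nbhd H v = insert v (nbrs H v)" "u \<in> nbrs H v"
    using H e by (auto simp: closed_nbhd_eq nbrs_def)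
  have vu: "z \<noteq> x \<and> {z, x} \<notin> edges H" "x \<noteq> z \<and> {x, z} \<notin> edges H"
    if "z \<in> {v, u}" "x \<in> f" "f \<in> M" for f x z
    using sub(2,3)[OF that(3)] nb that by (auto simp: nbrs_def disjoint_iff insert_commute)
  show "insert {v, u} M \<in> IM H"
  proof (rule IM_I)
    fix f assume "f \<in> insert {v, u} M" then show "f \<in> edges H" using sub e by auto
  next
    fix f g x y
    assume a: "f \<in> insert {v, u} M" "g \<in> insert {v, u} M" "f \<noteq> g" "x \<in> f" "y \<in> g"
    show "x \<noteq> y \<and> {x, y} \<notin> edges H"
    proof (cases "f \<in> M \<and> g \<in> M")
      case True
      then show ?thesis
        using IM_apart[OF M' _ _ a(3-5)] sub(2,3)[of f] sub(2,3)[of g] a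
        by (auto simp: edges_child[OF H e])
    next
      case False
      then have "f = {v, u} \<and> g \<in> M \<or> g = {v, u} \<and> f \<in> M" using a by auto
      then show ?thesis using vu(1)[of x y g] vu(2)[of y x f] a by auto
    qed
  qed
qed

lemma IM_child_avoids:
  assumes "simple_graph H" "M \<in> IM (child H v e)" "f \<in> M"
  shows "v \<notin> f"
  using assms unfolding IM_def induced_matching_def child_def del_edges_def del_verts_def
  by (auto simp: closed_nbhd_eq)

text \<open>Either \<open>M\<close> leaves \<open>v\<close> uncovered, or it contains an edge
  \<open>e\<close> at \<open>v\<close>, and then \<open>M - {e}\<close> is an induced matching of
  the child by \<open>IM_insert_iff\<close>. That the pieces do not overlap follows later from
  \<open>IM_child_avoids\<close>.\<close>

lemma IM_branch:
  assumes H: "simple_graph H"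
  shows "IM H = IM (del_verts H {v}) \<union> (\<Union>e\<in>incident_edges H v. insert e ` IM (child H v e))"
proof (intro subset_antisym subsetI)
  fix M assume M: "M \<in> IM H"
  show "M \<in> IM (del_verts H {v}) \<union> (\<Union>e\<in>incident_edges H v. insert e ` IM (child H v e))"
  proof (cases "\<forall>e\<in>M. v \<notin> e")
    case True
    then show ?thesis using M by (simp add: IM_del_vert)
  next
    case False
    then obtain e where e: "e \<in> M" "e \<in> incident_edges H v"
      using M by (auto simp: IM_def induced_matching_def incident_edges_def)
    then obtain u where u: "e = {v, u}" "{v, u} \<in> edges H"
      using incident_edges_eq[OF H] by (auto simp: nbrs_def)
    have "M - {e} \<in> IM (child H v e)"
      using IM_insert_iff[OF H u(2), of "M - {e}"] M e u by (simp add: insert_absorb)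
    then show ?thesis using e by (auto intro!: bexI[of _ e] image_eqI[of _ _ "M - {e}"])
  qed
next
  fix M assume "M \<in> IM (del_verts H {v}) \<union> (\<Union>e\<in>incident_edges H v. insert e ` IM (child H v e))"
  then consider "M \<in> IM (del_verts H {v})"
    | e M' where "e \<in> incident_edges H v" "M = insert e M'" "M' \<in> IM (child H v e)" by blast
  then show "M \<in> IM H"
  proof cases
    case 1
    then show ?thesis by (simp add: IM_del_vert)
  next
    case 2
    then obtain u where u: "e = {v, u}" "{v, u} \<in> edges H"
      using incident_edges_eq[OF H] by (auto simp: nbrs_def)
    then show ?thesis
      using IM_insert_iff[OF H u(2), of M'] IM_child_avoids[OF H 2(3)] 2 by auto
  qed
qed

section \<open>Counting induced matchings by size, and correctness of the enumeration\<close>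

lemma finite_IM: "simple_graph H \<Longrightarrow> finite (IM H)"
  by (rule finite_subset[of _ "Pow (edges H)"])
     (auto simp: IM_def induced_matching_def simple_finite_edges)

lemma finite_IM_member: "simple_graph H \<Longrightarrow> M \<in> IM H \<Longrightarrow> finite M"
  by (rule finite_subset[OF _ simple_finite_edges]) (auto dest: IM_edge)

text \<open>The predicate on the size lets one recurrence yield both the total number, with
  \<open>Q\<close> constantly true, and the truncated counts \<open>small_IM\<close>.\<close>

definition count_IM :: "(nat \<Rightarrow> bool) \<Rightarrow> 'a graph \<Rightarrow> nat" where
  "count_IM Q H = card {M \<in> IM H. Q (card M)}"

text \<open>\<open>Q\<close> is shifted by \<open>Suc\<close> because the branch on
  \<open>{v, u}\<close> adds one edge. Since \<open>{v, u}\<close> is the only edge at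
  \<open>v\<close> in the resulting matching, the images are disjoint and the insertion is
  injective.\<close>

lemma count_IM_branch:
  fixes H :: "'a graph"
  assumes H: "simple_graph H"
  shows "count_IM Q H = count_IM Q (del_verts H {v})
    + (\<Sum>u\<in>nbrs H v. count_IM (\<lambda>k. Q (Suc k)) (child H v {v, u}))"
proof -
  let ?A = "\<lambda>u. insert {v, u} ` {M \<in> IM (child H v {v, u}). Q (Suc (card M))}"
  have av: "v \<notin> f" if "M \<in> IM (child H v {v, u})" "f \<in> M" for u M f
    using IM_child_avoids[OF H that] .
  have fin: "finite (IM (child H v e))" for e by (simp add: H finite_IM simple_child)
  have ce: "card (insert {v, u} M) = Suc (card M)" if "M \<in> IM (child H v {v, u})" for u M
    using av[OF that] finite_IM_member[OF simple_child[OF H] that] by (auto simp: card_insert_if)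
  have split: "{M \<in> IM H. Q (card M)}
    = {M \<in> IM (del_verts H {v}). Q (card M)} \<union> (\<Union>u\<in>nbrs H v. ?A u)"
    unfolding IM_branch[OF H, of v] incident_edges_eq[OF H] using ce
    by (auto 4 4 simp: image_iff)
  have "count_IM Q H = count_IM Q (del_verts H {v}) + card (\<Union>u\<in>nbrs H v. ?A u)"
    unfolding count_IM_def split
    by (rule card_Un_disjoint)
       (auto simp: H finite_nbrs fin finite_IM simple_del_verts IM_del_vert)
  also have "card (\<Union>u\<in>nbrs H v. ?A u) = (\<Sum>u\<in>nbrs H v. card (?A u))"
  proof (rule card_UN_disjoint)
    show "\<forall>u\<in>nbrs H v. \<forall>w\<in>nbrs H v. u \<noteq> w \<longrightarrow> ?A u \<inter> ?A w = {}"
    proof (intro ballI impI)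
      fix u w :: 'a assume "u \<noteq> w"
      then have "{v, u} \<noteq> {v, w}" by (auto simp: doubleton_eq_iff)
      then show "?A u \<inter> ?A w = {}" by (blast dest: av)
    qed
  qed (auto simp: H finite_nbrs fin)
  also have "\<dots> = (\<Sum>u\<in>nbrs H v. count_IM (\<lambda>k. Q (Suc k)) (child H v {v, u}))"
    unfolding count_IM_def
    by (intro sum.cong refl card_image) (auto simp: inj_on_def dest: av)
  finally show ?thesis .
qed

text \<open>\<open>M\<close> consists of edges that have left the current graph. This invariant
  makes the trace of an output on \<open>incident_edges H v\<close> equal to \<open>{e}\<close> in
  the branch of \<open>e\<close> and empty in the branch deleting \<open>v\<close>; the trace
  separates the branches and gives distinctness.\<close>

lemma Rec_correct:
  assumes "Rec M H outs" "simple_graph H" "M \<inter> edges H = {}"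
  shows "distinct outs \<and> set outs = (\<union>) M ` IM H"
  using assms
proof (induction rule: Rec.induct)
  case (no_edges H M)
  then show ?case by (auto simp: IM_def induced_matching_def)
next
  case (branch H v M out0 H' es outs)
  note H = \<open>simple_graph H\<close>
  have ch: "del_edges H' (Sect H v e) = child H v e" for e
    by (simp add: child_def branch.hyps)
  have o0: "distinct out0" "set out0 = (\<union>) M ` IM (del_verts H {v})"
    using branch.IH(1)[OF simple_del_verts[OF H]] branch.prems by (auto simp: edges_del_vert)
  have oe: "distinct (outs e)" "set (outs e) = (\<union>) (insert e M) ` IM (child H v e)"
    if "e \<in> incident_edges H v" for e
  proof -
    have "v \<in> e" using that by (simp add: incident_edges_def)
    then have "insert e M \<inter> edges (child H v e) = {}"
      using branch.prems edges_child_subset[of H v e]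
      by (auto simp: child_def del_edges_def del_verts_def closed_nbhd_def)
    then have "distinct (outs e) \<and> set (outs e) = (\<union>) (insert e M) ` IM (child H v e)"
      using branch.IH(2)[of e] that branch.hyps ch simple_child[OF H] by auto
    then show "distinct (outs e)" "set (outs e) = (\<union>) (insert e M) ` IM (child H v e)" by auto
  qed
  have "(\<union>) M ` (\<Union>e\<in>incident_edges H v. insert e ` IM (child H v e))
    = (\<Union>e\<in>incident_edges H v. set (outs e))"
    by (simp add: image_UN oe(2) image_image)
  then have "set (out0 @ concat (map outs es)) = (\<union>) M ` IM H"
    unfolding IM_branch[OF H, of v] using o0 branch.hyps by (simp add: image_Un)
  moreover have vM: "e \<notin> M" if "e \<in> incident_edges H v" for e
    using that branch.prems by (auto simp: incident_edges_def)
  have mem: "set (outs e) \<subseteq> {X. X \<inter> incident_edges H v = {e}}" if ei: "e \<in> incident_edges H v" for e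
  proof
    fix X assume "X \<in> set (outs e)"
    then obtain N where N: "N \<in> IM (child H v e)" "X = insert e M \<union> N"
      using oe(2)[OF ei] by auto
    have "N \<inter> incident_edges H v = {}"
      using IM_child_avoids[OF H N(1)] by (auto simp: incident_edges_def)
    then show "X \<in> {X. X \<inter> incident_edges H v = {e}}" using N ei vM by auto
  qed
  have mem0: "set out0 \<subseteq> {X. X \<inter> incident_edges H v = {}}"
    using o0(2) vM by (auto simp: IM_del_vert incident_edges_def)
  have "distinct (concat (map outs es))"
  proof -
    have "distinct (concat (map outs es))" if "set es \<subseteq> incident_edges H v" "distinct es" for es
      using that
    proof (induction es)
      case (Cons e es)
      have "set (outs e) \<inter> set (outs f) = {}" if "f \<in> set es" for f
      proof -
        have "f \<noteq> e" "f \<in> incident_edges H v" "e \<in> incident_edges H v" using that Cons.prems by auto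
        then show ?thesis using mem[of e] mem[of f] by auto
      qed
      then show ?case using Cons oe by auto
    qed simp
    then show ?thesis using branch.hyps by simp
  qed
  then have "distinct (out0 @ concat (map outs es))"
  proof -
    have "X \<notin> set (outs e)" if "X \<in> set out0" "e \<in> set es" for X e
      using subsetD[OF mem0 that(1)] mem[of e] that(2) branch.hyps by auto
    then show ?thesis using o0 \<open>distinct (concat (map outs es))\<close> by auto
  qed
  ultimately show ?case by blast
qed

section \<open>The potential\<close>

text \<open>The minimum serves two purposes: an edge \<open>{v, u}\<close> at a vertex
  \<open>v\<close> of maximum degree contributes exactly \<open>degree H u\<close>, and for an upper
  bound each edge may be charged to whichever endpoint is convenient.\<close>

definition min_degree_sum :: "'a graph \<Rightarrow> nat" where
  "min_degree_sum H = (\<Sum>e\<in>edges H. Min (degree H ` e))"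

abbreviation small_IM :: "nat \<Rightarrow> 'a graph \<Rightarrow> nat" where
  "small_IM k H \<equiv> count_IM (\<lambda>j. j \<le> k) H"

lemma count_IM_mono: "simple_graph H \<Longrightarrow> (\<And>j. Q j \<Longrightarrow> Q' j) \<Longrightarrow> count_IM Q H \<le> count_IM Q' H"
  unfolding count_IM_def by (rule card_mono) (auto simp: finite_IM)

lemma empty_IM: "{} \<in> IM H"
  by (simp add: IM_iff)

lemma small_IM_0: "simple_graph H \<Longrightarrow> small_IM 0 H = 1"
proof -
  assume H: "simple_graph H"
  then have "{M \<in> IM H. card M \<le> 0} = {{}}"
    using finite_IM_member[OF H] empty_IM[of H] by auto
  then show ?thesis by (simp add: count_IM_def)
qed

lemma small_IM_1: "simple_graph H \<Longrightarrow> Suc (card (edges H)) \<le> small_IM (Suc 0) H"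
proof -
  assume H: "simple_graph H"
  have "card (insert {} ((\<lambda>e. {e}) ` edges H)) \<le> small_IM (Suc 0) H"
    unfolding count_IM_def
    by (rule card_mono[OF finite_subset[OF _ finite_IM[OF H]]]) (auto simp: IM_iff)
  moreover have "card (insert {} ((\<lambda>e. {e}) ` edges H)) = Suc (card (edges H))"
    by (subst card_insert_disjoint) (auto simp: H simple_finite_edges card_image)
  ultimately show ?thesis by simp
qed

lemma small_IM_branch:
  "simple_graph H \<Longrightarrow> small_IM (Suc k) H
    = small_IM (Suc k) (del_verts H {v}) + (\<Sum>u\<in>nbrs H v. small_IM k (child H v {v, u}))"
  using count_IM_branch[of H "\<lambda>j. j \<le> Suc k" v] by simp

lemma card_edges_del_vert:
  assumes "simple_graph H"
  shows "card (edges H) = card (edges (del_verts H {v})) + card (nbrs H v)"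
proof -
  have "edges H = edges (del_verts H {v}) \<union> incident_edges H v"
    by (auto simp: edges_del_vert incident_edges_def)
  moreover have "edges (del_verts H {v}) \<inter> incident_edges H v = {}"
    by (auto simp: edges_del_vert incident_edges_def)
  moreover have "finite (edges H)" using assms by (rule simple_finite_edges)
  ultimately have "card (edges H) = card (edges (del_verts H {v})) + card (incident_edges H v)"
    by (metis card_Un_disjoint finite_Un)
  then show ?thesis using degree_eq_card_nbrs[OF assms, of v] by (simp add: degree_def)
qed

text \<open>One unfolding of the recurrence at \<open>v\<close> is enough. The deletion branch
  supplies the single edges avoiding \<open>v\<close>; the child of \<open>{v, u}\<close> supplies
  this edge itself and its pairs with the edges of the child. Pairs avoiding \<open>v\<close> are
  dropped.\<close>

lemma small_IM_2:
  assumes H: "simple_graph H"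
  shows "card (edges H) + (\<Sum>u\<in>nbrs H v. card (edges (child H v {v, u}))) \<le> small_IM 2 H"
proof -
  have "small_IM 2 H = small_IM 2 (del_verts H {v}) + (\<Sum>u\<in>nbrs H v. small_IM (Suc 0) (child H v {v, u}))"
    using small_IM_branch[OF H, of "Suc 0" v] by (simp add: numeral_2_eq_2)
  moreover have "small_IM (Suc 0) (del_verts H {v}) \<le> small_IM 2 (del_verts H {v})"
    by (rule count_IM_mono) (simp_all add: H simple_del_verts)
  moreover have "Suc (card (edges (del_verts H {v}))) \<le> small_IM (Suc 0) (del_verts H {v})"
    by (rule small_IM_1) (simp add: H simple_del_verts)
  moreover have "(\<Sum>u\<in>nbrs H v. Suc (card (edges (child H v {v, u}))))
    \<le> (\<Sum>u\<in>nbrs H v. small_IM (Suc 0) (child H v {v, u}))"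
    by (intro sum_mono small_IM_1 simple_child H)
  ultimately show ?thesis
    using card_edges_del_vert[OF H, of v] by (simp add: sum_Suc)
qed

section \<open>Estimates from the absence of 4-cycles\<close>

text \<open>Otherwise \<open>v\<close>, \<open>u\<close>, \<open>x\<close>, \<open>w\<close> would
  be a 4-cycle. Apart from its inheritance by subgraphs, this is the only way in which
  \<open>C4_free\<close> enters.\<close>

lemma C4_free_common_nbr:
  assumes "simple_graph H" "C4_free H"
    and "u \<in> nbrs H v" "w \<in> nbrs H v" "x \<in> nbrs H u" "x \<in> nbrs H w" "x \<noteq> v"
  shows "u = w"
proof (rule ccontr)
  assume "u \<noteq> w"
  have e: "{v, u} \<in> edges H" "{u, x} \<in> edges H" "{x, w} \<in> edges H" "{w, v} \<in> edges H"
    using assms by (simp_all add: nbrs_def insert_commute)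
  have "distinct [v, u, x, w]"
    using \<open>u \<noteq> w\<close> assms(7) e[THEN simple_edgeD(1)[OF assms(1)]] by auto
  with e assms(2) show False unfolding C4_free_def by blast
qed

abbreviation far :: "'a graph \<Rightarrow> 'a \<Rightarrow> 'a graph" where
  "far H v \<equiv> del_verts H (closed_nbhd H v)"

lemma edges_far: "edges (far H v) = {f \<in> edges H. f \<inter> closed_nbhd H v = {}}"
  by (simp add: del_verts_def)

text \<open>By \<open>C4_free_common_nbr\<close>, each endpoint of an edge lies in at most one of the sets
  \<open>nbrs H u\<close>, so that all but two of the children keep this edge.\<close>

lemma sum_card_child:
  assumes H: "simple_graph H" and C: "C4_free H"
  shows "(card (nbrs H v) - 2) * card (edges (far H v))
    \<le> (\<Sum>u\<in>nbrs H v. card (edges (child H v {v, u})))"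
proof -
  let ?E = "edges (far H v)" and ?N = "nbrs H v"
  have fin: "finite ?E" "finite ?N" by (simp_all add: H simple_del_verts simple_finite_edges finite_nbrs)
  have "(card ?N - 2) * card ?E = (\<Sum>f\<in>?E. card ?N - 2)" by simp
  also have "\<dots> \<le> (\<Sum>f\<in>?E. card {u \<in> ?N. f \<inter> nbrs H u = {}})"
  proof (rule sum_mono)
    fix f assume f: "f \<in> ?E"
    then obtain x y where fxy: "f = {x, y}" using H by (auto simp: edges_far elim: simple_edgeE)
    let ?B = "\<lambda>x. {u \<in> ?N. x \<in> nbrs H u}"
    have B: "card (?B x) \<le> Suc 0" if "x \<in> f" for x
    proof (subst card_le_Suc0_iff_eq)
      have "x \<noteq> v" using f that by (auto simp: del_verts_def closed_nbhd_def)
      then show "\<forall>a\<in>?B x. \<forall>b\<in>?B x. a = b" using C4_free_common_nbr[OF H C] by blast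
    qed (simp add: fin)
    have "card (?B x \<union> ?B y) \<le> 2"
      using card_Un_le[of "?B x" "?B y"] B[of x] B[of y] fxy by simp
    moreover have "{u \<in> ?N. f \<inter> nbrs H u = {}} = ?N - (?B x \<union> ?B y)" using fxy by auto
    ultimately show "card ?N - 2 \<le> card {u \<in> ?N. f \<inter> nbrs H u = {}}"
      using diff_card_le_card_Diff[of "?B x \<union> ?B y" ?N] fin by simp
  qed
  also have "\<dots> = (\<Sum>f\<in>?E. \<Sum>u | u \<in> ?N \<and> f \<inter> nbrs H u = {}. 1)" by simp
  also have "\<dots> = (\<Sum>u\<in>?N. \<Sum>f | f \<in> ?E \<and> f \<inter> nbrs H u = {}. 1)"
    by (rule sum.swap_restrict) (simp_all add: fin)
  also have "\<dots> = (\<Sum>u\<in>?N. card (edges (child H v {v, u})))"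
  proof (rule sum.cong[OF refl])
    fix u assume "u \<in> ?N"
    then have "{v, u} \<in> edges H" by (simp add: nbrs_def)
    then show "(\<Sum>f | f \<in> ?E \<and> f \<inter> nbrs H u = {}. 1) = card (edges (child H v {v, u}))"
      by (simp add: edges_child[OF H] edges_far conj_assoc)
  qed
  finally show ?thesis .
qed

lemma Min_degree_le: "simple_graph H \<Longrightarrow> e \<in> edges H \<Longrightarrow> x \<in> e \<Longrightarrow> Min (degree H ` e) \<le> degree H x"
  by (simp add: simple_finite_edge)

lemma degree_le_max:
  assumes "simple_graph H" "max_degree_vertex H v"
  shows "degree H x \<le> degree H v"
proof (cases "x \<in> verts H")
  case False
  then have "nbrs H x = {}" using assms(1) by (auto simp: nbrs_def dest: simple_edgeD)
  then show ?thesis using degree_eq_card_nbrs[OF assms(1), of x] by simp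
qed (use assms in \<open>simp add: max_degree_vertex_def\<close>)

lemma ex_max_degree_vertex:
  assumes H: "simple_graph H" and "edges H \<noteq> {}"
  obtains v where "max_degree_vertex H v"
proof -
  obtain x where "x \<in> verts H" using assms by (auto elim: simple_edgeE)
  then have "\<exists>v. v \<in> verts H \<and> (\<forall>u. u \<in> verts H \<longrightarrow> degree H u \<le> degree H v)"
    by (rule ex_has_greatest_nat[where b = "Suc (card (edges H))"])
       (auto simp: degree_def incident_edges_def H simple_finite_edges less_Suc_eq_le intro!: card_mono)
  then obtain v where "v \<in> verts H" "\<And>u. u \<in> verts H \<Longrightarrow> degree H u \<le> degree H v" by blast
  then show thesis by (intro that[of v]) (simp add: max_degree_vertex_def)
qed

text \<open>With \<open>m\<close> edges in \<open>H\<close>, let \<open>v\<close> have maximum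
  degree \<open>d \<ge> 3\<close>. Edges at \<open>v\<close> are charged to their other endpoint,
  edges at a neighbour \<open>u\<close> of \<open>v\<close> to the endpoint other than
  \<open>u\<close>; both charges are injective, so each group contributes at most
  \<open>2 * m\<close> by the handshake count. Every remaining edge contributes at most
  \<open>d \<le> 3 * (d - 2)\<close>, which the edges of the children cover by
  \<open>sum_card_child\<close>. The sum is at most \<open>4 * m\<close> plus three times the number
  of edges of the children.\<close>

lemma min_degree_sum_le:
  assumes H: "simple_graph H" and C: "C4_free H"
  shows "min_degree_sum H \<le> 4 * small_IM 2 H"
proof (cases "edges H = {}")
  case False
  then obtain v where v: "max_degree_vertex H v" using H by (blast elim: ex_max_degree_vertex)
  let ?N = "nbrs H v" and ?m = "card (edges H)" and ?min = "\<lambda>e. Min (degree H ` e)"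
  let ?m' = "card (edges (far H v))"
  have fin: "finite (edges H)" using H by (rule simple_finite_edges)
  have deg_le: "?min e \<le> degree H v" if "e \<in> edges H" for e
  proof -
    obtain x where "x \<in> e" by (rule simple_edgeE[OF H \<open>e \<in> edges H\<close>]) blast
    then show ?thesis using Min_degree_le[OF H that] degree_le_max[OF H v] le_trans by blast
  qed
  have le_small: "?m + (\<Sum>u\<in>?N. card (edges (child H v {v, u}))) \<le> small_IM 2 H"
    by (rule small_IM_2[OF H])
  show ?thesis
  proof (cases "degree H v \<le> 2")
    case True
    have "min_degree_sum H \<le> (\<Sum>e\<in>edges H. 2)"
      unfolding min_degree_sum_def by (rule sum_mono) (use deg_le True le_trans in blast)
    then show ?thesis using le_small by simp
  next
    case False
    let ?I = "incident_edges H v"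
    let ?T = "{e \<in> edges H. v \<notin> e \<and> e \<inter> ?N \<noteq> {}}"
    have T: "\<exists>x. x \<noteq> v \<and> (\<exists>u\<in>?N. e = {u, x} \<and> x \<in> nbrs H u)" if "e \<in> ?T" for e
    proof -
      have "e \<in> edges H" using that by simp
      then obtain a b where ab: "e = {a, b}" "{a, b} \<in> edges H" by (rule simple_edgeE[OF H]) blast
      then have "b \<in> nbrs H a" "a \<in> nbrs H b" "e = {b, a}" by (auto simp: nbrs_def insert_commute)
      moreover have "a \<in> ?N \<or> b \<in> ?N" "a \<noteq> v" "b \<noteq> v" using that ab by auto
      ultimately show ?thesis using ab(1) by blast
    qed
    \<comment> \<open>\<open>g e\<close> is the end of \<open>e\<close> that is charged. It may
      itself be a neighbour of \<open>v\<close>, when \<open>e\<close> closes a triangle with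
      \<open>v\<close>.\<close>
    define g where "g e = (SOME x. x \<noteq> v \<and> (\<exists>u\<in>?N. e = {u, x} \<and> x \<in> nbrs H u))" for e
    have g: "g e \<noteq> v \<and> (\<exists>u\<in>?N. e = {u, g e} \<and> g e \<in> nbrs H u)" if "e \<in> ?T" for e
      unfolding g_def using T[OF that] by (rule someI_ex)
    \<comment> \<open>Two edges with the same charged end \<open>x\<close> would give two neighbours
      of \<open>v\<close> with the common neighbour \<open>x \<noteq> v\<close>.\<close>
    have inj: "inj_on g ?T"
    proof (rule inj_onI)
      fix e f assume e: "e \<in> ?T" and f: "f \<in> ?T" and eq: "g e = g f"
      obtain u w where "u \<in> ?N" "e = {u, g e}" "g e \<in> nbrs H u"
        "w \<in> ?N" "f = {w, g f}" "g f \<in> nbrs H w" using g[OF e] g[OF f] by auto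
      then show "e = f" using C4_free_common_nbr[OF H C, of u v w "g e"] g[OF e] eq by auto
    qed
    have "edges H = ?I \<union> ?T \<union> edges (far H v)"
      unfolding edges_far incident_edges_def unfolding closed_nbhd_eq[OF H] by auto
    then have "min_degree_sum H = sum ?min (?I \<union> ?T \<union> edges (far H v))"
      by (simp add: min_degree_sum_def)
    also have "\<dots> = sum ?min ?I + sum ?min ?T + sum ?min (edges (far H v))"
    proof -
      have "finite ?I" "finite ?T" "finite (edges (far H v))"
        using fin by (simp_all add: incident_edges_def edges_far)
      moreover have "?I \<inter> ?T = {}" "(?I \<union> ?T) \<inter> edges (far H v) = {}"
        unfolding edges_far incident_edges_def unfolding closed_nbhd_eq[OF H] by auto
      ultimately show ?thesis by (simp add: sum.union_disjoint)
    qed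
    also have "sum ?min ?I \<le> 2 * ?m"
    proof -
      have "sum ?min ?I = (\<Sum>u\<in>?N. ?min {v, u})"
        unfolding incident_edges_eq[OF H] by (rule sum.reindex_cong[OF inj_on_edge refl refl])
      also have "\<dots> \<le> (\<Sum>u\<in>?N. degree H u)"
        by (rule sum_mono) (auto simp: nbrs_def)
      also have "\<dots> \<le> 2 * ?m" by (rule sum_degree_le[OF H finite_nbrs[OF H]])
      finally show ?thesis .
    qed
    also have "sum ?min ?T \<le> 2 * ?m"
    proof -
      have "sum ?min ?T \<le> (\<Sum>e\<in>?T. degree H (g e))"
      proof (rule sum_mono)
        fix e assume e: "e \<in> ?T"
        then have "g e \<in> e" using g[OF e] by auto
        then show "?min e \<le> degree H (g e)" using e by (intro Min_degree_le[OF H]) auto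
      qed
      also have "\<dots> = (\<Sum>x\<in>g ` ?T. degree H x)" by (simp add: sum.reindex[OF inj])
      also have "\<dots> \<le> 2 * ?m" by (rule sum_degree_le[OF H]) (simp add: fin)
      finally show ?thesis .
    qed
    also have "sum ?min (edges (far H v)) \<le> degree H v * ?m'"
    proof -
      have "sum ?min (edges (far H v)) \<le> (\<Sum>e\<in>edges (far H v). degree H v)"
        by (rule sum_mono) (use deg_le in \<open>simp add: edges_far\<close>)
      then show ?thesis by (simp add: mult.commute)
    qed
    \<comment> \<open>This is where \<open>d \<ge> 3\<close> enters; there is equality for
      \<open>d = 3\<close>.\<close>
    also have "degree H v * ?m' \<le> 3 * ((card ?N - 2) * ?m')"
      using False unfolding mult.assoc[symmetric]
      by (intro mult_le_mono1) (simp add: degree_eq_card_nbrs[OF H])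
    also have "\<dots> \<le> 3 * (\<Sum>u\<in>?N. card (edges (child H v {v, u})))"
      by (intro mult_le_mono2 sum_card_child H C)
    finally show ?thesis using le_small by simp
  qed
qed (simp add: min_degree_sum_def)

text \<open>By maximality of \<open>degree H v\<close>, the terms lost with the edges
  \<open>{v, u}\<close> are exactly the degrees of the neighbours; the remaining terms can only
  decrease.\<close>

lemma min_degree_sum_del_vert:
  assumes H: "simple_graph H" and v: "max_degree_vertex H v"
  shows "min_degree_sum (del_verts H {v}) + (\<Sum>u\<in>nbrs H v. degree H u) \<le> min_degree_sum H"
proof -
  let ?min = "\<lambda>e. Min (degree H ` e)" and ?E = "edges (del_verts H {v})"
  have "edges H = ?E \<union> incident_edges H v" and dj: "?E \<inter> incident_edges H v = {}"
    by (auto simp: edges_del_vert incident_edges_def)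
  then have "min_degree_sum H = sum ?min ?E + sum ?min (incident_edges H v)"
    using simple_finite_edges[OF H] unfolding min_degree_sum_def
    by (metis finite_Un sum.union_disjoint)
  moreover have "sum ?min (incident_edges H v) = (\<Sum>u\<in>nbrs H v. ?min {v, u})"
    unfolding incident_edges_eq[OF H] by (rule sum.reindex_cong[OF inj_on_edge refl refl])
  moreover have "?min {v, u} = degree H u" for u
    using degree_le_max[OF H v, of u] by simp
  moreover have "min_degree_sum (del_verts H {v}) \<le> sum ?min ?E"
    unfolding min_degree_sum_def
  proof (rule sum_mono)
    fix e assume e: "e \<in> ?E"
    then have "e \<in> edges H" by (simp add: edges_del_vert)
    then obtain x y where exy: "e = {x, y}" by (rule simple_edgeE[OF H]) blast
    have dm: "degree (del_verts H {v}) z \<le> degree H z" for z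
      by (rule degree_mono[OF H]) (auto simp: edges_del_vert)
    show "Min (degree (del_verts H {v}) ` e) \<le> ?min e"
      using min.mono[OF dm[of x] dm[of y]] by (simp add: exy del: min.bounded_iff)
  qed
  ultimately show ?thesis by simp
qed

text \<open>For \<open>d \<ge> 3\<close> the neighbourhoods of the vertices \<open>u\<close> are
  disjoint outside \<open>N[v]\<close>, so the sum is at most twice the number of edges of
  \<open>far H v\<close>, which \<open>sum_card_child\<close> bounds. The factor 4 comes from
  \<open>d \<le> 2\<close>: each \<open>u\<close> has at most two neighbours of degree at most 2,
  and every child has at least the empty matching.\<close>

lemma second_level_degrees:
  assumes H: "simple_graph H" and C: "C4_free H" and v: "max_degree_vertex H v"
  shows "(\<Sum>u\<in>nbrs H v. \<Sum>x\<in>nbrs H u. degree (far H v) x)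
    \<le> 4 * (\<Sum>u\<in>nbrs H v. small_IM 2 (child H v {v, u}))"
proof (cases "degree H v \<le> 2")
  case True
  have "(\<Sum>x\<in>nbrs H u. degree (far H v) x) \<le> 4 * small_IM 2 (child H v {v, u})" for u
  proof -
    have "(\<Sum>x\<in>nbrs H u. degree (far H v) x) \<le> (\<Sum>x\<in>nbrs H u. 2)"
    proof (rule sum_mono)
      fix x
      have "degree (far H v) x \<le> degree H x" by (rule degree_mono[OF H]) (auto simp: edges_far)
      then show "degree (far H v) x \<le> 2" using degree_le_max[OF H v, of x] True by simp
    qed
    also have "\<dots> \<le> 4"
      using degree_le_max[OF H v, of u] True by (simp add: degree_eq_card_nbrs[OF H])
    also have "4 \<le> 4 * small_IM 2 (child H v {v, u})"
      using small_IM_0[OF simple_child[OF H]] count_IM_mono[OF simple_child[OF H], of "\<lambda>j. j \<le> 0" "\<lambda>j. j \<le> 2" v "{v, u}"]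
      by simp
    finally show ?thesis .
  qed
  then show ?thesis by (simp add: sum_distrib_left sum_mono)
next
  case False
  let ?X = "\<lambda>u. nbrs H u - closed_nbhd H v" and ?N = "nbrs H v"
  have fX: "finite (?X u)" for u by (simp add: H finite_nbrs)
  \<comment> \<open>The vertices of \<open>N[v]\<close> are isolated in \<open>far H v\<close>, so
    the inner sums may be restricted to the disjoint sets \<open>?X u\<close>.\<close>
  have "degree (far H v) x = 0" if "x \<in> closed_nbhd H v" for x
  proof -
    have "incident_edges (far H v) x = {}"
      using that by (auto simp: incident_edges_def edges_far)
    then show ?thesis by (simp add: degree_def)
  qed
  then have "(\<Sum>u\<in>?N. \<Sum>x\<in>nbrs H u. degree (far H v) x) = (\<Sum>u\<in>?N. \<Sum>x\<in>?X u. degree (far H v) x)"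
    by (intro sum.cong refl sum.mono_neutral_right) (auto simp: H finite_nbrs)
  also have "\<dots> = (\<Sum>x\<in>(\<Union>u\<in>?N. ?X u). degree (far H v) x)"
  proof (rule sum.UNION_disjoint[symmetric])
    show "\<forall>u\<in>?N. \<forall>w\<in>?N. u \<noteq> w \<longrightarrow> ?X u \<inter> ?X w = {}"
      using C4_free_common_nbr[OF H C] by (fastforce simp: closed_nbhd_eq[OF H])
  qed (auto simp: H finite_nbrs)
  also have "\<dots> \<le> 2 * card (edges (far H v))"
    by (rule sum_degree_le) (auto simp: H finite_nbrs simple_del_verts)
  also have "\<dots> \<le> 2 * ((card ?N - 2) * card (edges (far H v)))"
  proof -
    have "1 \<le> card ?N - 2" using False by (simp add: degree_eq_card_nbrs[OF H])
    from mult_le_mono1[OF this] show ?thesis by simp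
  qed
  also have "\<dots> \<le> 2 * (\<Sum>u\<in>?N. card (edges (child H v {v, u})))"
    by (intro mult_le_mono2 sum_card_child H C)
  also have "\<dots> \<le> 4 * (\<Sum>u\<in>?N. small_IM 2 (child H v {v, u}))"
  proof -
    have "card (edges H') \<le> small_IM 2 H'" if "simple_graph H'" for H' :: "'a graph"
      using small_IM_2[OF that] by (rule add_leD1)
    then have "(\<Sum>u\<in>?N. card (edges (child H v {v, u}))) \<le> (\<Sum>u\<in>?N. small_IM 2 (child H v {v, u}))"
      by (intro sum_mono) (simp add: H simple_child)
    then show ?thesis by simp
  qed
  finally show ?thesis .
qed

section \<open>The potential inequality for one branching\<close>

text \<open>Kept apart from \<open>budget\<close> because it enters the bound with a negative sign:
  it is always written on the smaller side, so that no truncated subtraction occurs.\<close>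

definition credit :: "'a graph \<Rightarrow> nat" where
  "credit H = small_IM 0 H + small_IM 1 H + small_IM 2 H"

definition budget :: "nat \<Rightarrow> nat \<Rightarrow> 'a graph \<Rightarrow> nat" where
  "budget a K H = a * card (IM H) + K * min_degree_sum H"

text \<open>The number of induced matchings is exactly additive over the branches, so the terms with
  \<open>a\<close> cancel. What remains is an inequality between degree sums and credits, multiplied
  by \<open>K\<close>.\<close>

lemma budget_branch:
  assumes H: "simple_graph H" and C: "C4_free H" and v: "max_degree_vertex H v"
  shows "K * (degree H v + (\<Sum>u\<in>nbrs H v. degree H u)
        + (\<Sum>u\<in>nbrs H v. \<Sum>x\<in>nbrs H u. degree (far H v) x))
      + budget a K (del_verts H {v}) + (\<Sum>u\<in>nbrs H v. budget a K (child H v {v, u}))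
      + 9 * K * credit H
    \<le> budget a K H + 9 * K * credit (del_verts H {v})
      + (\<Sum>u\<in>nbrs H v. 9 * K * credit (child H v {v, u}))"
proof -
  let ?N = "nbrs H v" and ?c = "\<lambda>u. child H v {v, u}"
  define s0 s1 s2 where "s0 = (\<Sum>u\<in>?N. small_IM 0 (?c u))"
    and "s1 = (\<Sum>u\<in>?N. small_IM 1 (?c u))" and "s2 = (\<Sum>u\<in>?N. small_IM 2 (?c u))"
  define S1 S2 where "S1 = (\<Sum>u\<in>?N. degree H u)"
    and "S2 = (\<Sum>u\<in>?N. \<Sum>x\<in>nbrs H u. degree (far H v) x)"
  have credit_sum: "(\<Sum>u\<in>?N. credit (?c u)) = s0 + s1 + s2"
    by (simp add: credit_def sum.distrib s0_def s1_def s2_def)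
  \<comment> \<open>\<open>small_IM 0\<close> is 1 on both sides and cancels. The recurrence lowers
    the index by one, so only \<open>s0\<close> and \<open>s1\<close> appear, whereas the children
    together hold \<open>s0 + s1 + s2\<close>; the difference is the surplus
    \<open>s2\<close>.\<close>
  have credit_eq: "credit H = credit (del_verts H {v}) + s0 + s1"
    using small_IM_branch[OF H, of 0 v] small_IM_branch[OF H, of 1 v]
      small_IM_0[OF H] small_IM_0[OF simple_del_verts[OF H], of "{v}"]
    by (simp add: credit_def s0_def s1_def numeral_2_eq_2)
  have IM: "card (IM H) = card (IM (del_verts H {v})) + (\<Sum>u\<in>?N. card (IM (?c u)))"
    using count_IM_branch[OF H, of "\<lambda>_. True" v] by (simp add: count_IM_def)
  have d: "degree H v \<le> s2"
  proof -
    have "(\<Sum>u\<in>?N. 1) \<le> s2" unfolding s2_def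
    proof (rule sum_mono)
      fix u show "1 \<le> small_IM 2 (?c u)"
        using small_IM_0[OF simple_child[OF H]] count_IM_mono[OF simple_child[OF H], of "\<lambda>j. j \<le> 0" "\<lambda>j. j \<le> 2" v "{v, u}"]
        by simp
    qed
    then show ?thesis by (simp add: degree_eq_card_nbrs[OF H])
  qed
  have S2: "S2 \<le> 4 * s2" unfolding S2_def s2_def by (rule second_level_degrees[OF H C v])
  have md: "(\<Sum>u\<in>?N. min_degree_sum (?c u)) \<le> 4 * s2"
    unfolding s2_def sum_distrib_left
    by (intro sum_mono min_degree_sum_le simple_child H C4_free_mono[OF C] edges_child_subset)
  have R: "min_degree_sum (del_verts H {v}) + S1 \<le> min_degree_sum H"
    unfolding S1_def by (rule min_degree_sum_del_vert[OF H v])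
  \<comment> \<open>\<open>S1\<close> is paid by the drop in \<open>min_degree_sum\<close>. The
    surplus \<open>9 * s2\<close> pays \<open>degree H v\<close> once, and four times each for
    \<open>S2\<close> and for the sums of the children.\<close>
  have "degree H v + S1 + S2 + min_degree_sum (del_verts H {v})
      + (\<Sum>u\<in>?N. min_degree_sum (?c u)) + 9 * credit H
    \<le> min_degree_sum H + 9 * credit (del_verts H {v}) + 9 * (s0 + s1 + s2)"
    using d S2 md R credit_eq by simp
  then have "K * (degree H v + S1 + S2 + min_degree_sum (del_verts H {v})
      + (\<Sum>u\<in>?N. min_degree_sum (?c u)) + 9 * credit H)
    \<le> K * (min_degree_sum H + 9 * credit (del_verts H {v}) + 9 * (s0 + s1 + s2))"
    by (rule mult_le_mono2)
  then show ?thesis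
    unfolding budget_def S1_def[symmetric] S2_def[symmetric] IM sum.distrib
      sum_distrib_left[symmetric] credit_sum
    by (simp add: algebra_simps)
qed

lemma credit_empty: "simple_graph H \<Longrightarrow> edges H = {} \<Longrightarrow> credit H = 3 \<and> card (IM H) = 1"
proof -
  assume "edges H = {}"
  then have "IM H = {{}}" by (auto simp: IM_iff)
  then show ?thesis by (simp add: credit_def count_IM_def Collect_conv_if)
qed

section \<open>Programs with a bounded running time\<close>

text \<open>Total correctness with a time bound. Preservation of \<open>cur\<close> and
  \<open>out\<close> is built in, since all list and graph operations have it; pushing, popping,
  emitting and the recursive call are described by equations instead.\<close>

definition runs :: "('a, 'r) prog \<Rightarrow> 'a mem \<Rightarrow> nat \<Rightarrow> ('r \<Rightarrow> 'a mem \<Rightarrow> bool) \<Rightarrow> bool" where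
  "runs m s k Q \<longleftrightarrow> (\<exists>r s'. m s = Some (r, s') \<and> cur s' = cur s \<and> out s' = out s \<and>
     cost s' \<le> cost s + k \<and> Q r s')"

lemma runsE:
  assumes "runs m s k Q"
  obtains r s' where "m s = Some (r, s')" "cur s' = cur s" "out s' = out s"
    "cost s' \<le> cost s + k" "Q r s'"
  using assms by (auto simp: runs_def)

lemma runs_bind:
  assumes "runs m s k Q" and "\<And>r s'. Q r s' \<Longrightarrow> runs (f r) s' k' Q'" and "k + k' \<le> K"
  shows "runs (bind_prog m f) s K Q'"
proof -
  obtain r s1 where 1: "m s = Some (r, s1)" "cur s1 = cur s" "out s1 = out s"
    "cost s1 \<le> cost s + k" "Q r s1" using assms(1) by (rule runsE)
  obtain q s2 where 2: "f r s1 = Some (q, s2)" "cur s2 = cur s1" "out s2 = out s1"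
    "cost s2 \<le> cost s1 + k'" "Q' q s2" using assms(2)[OF 1(5)] by (rule runsE)
  show ?thesis unfolding runs_def bind_prog_def using 1 2 assms(3) by auto
qed

lemma runs_weaken:
  assumes "runs m s k Q" and "k \<le> K" and "\<And>r s'. Q r s' \<Longrightarrow> Q' r s'"
  shows "runs m s K Q'"
  using assms(1) by (rule runsE) (use assms(2,3) in \<open>force simp: runs_def\<close>)

lemma runs_ret: "Q r s \<Longrightarrow> runs (ret r) s k Q"
  by (simp add: runs_def ret_def)

lemma runs_tick: "runs tick s 1 (\<lambda>_ s'. s' = s\<lparr>cost := cost s + 1\<rparr>)"
  by (simp add: runs_def tick_def step_def)

lemma runs_get_deg: "runs (get_deg u) s 1 (\<lambda>d s'. d = deg s u \<and> s' = s\<lparr>cost := cost s + 1\<rparr>)"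
  by (simp add: runs_def get_deg_def step_def)

lemma runs_set_deg:
  "runs (set_deg u d) s 1 (\<lambda>_ s'. s' = s\<lparr>deg := (deg s)(u := d), cost := cost s + 1\<rparr>)"
  by (simp add: runs_def set_deg_def step_def)

lemma runs_get_prv: "runs (get_prv c) s 1 (\<lambda>r s'. r = prv s c \<and> s' = s\<lparr>cost := cost s + 1\<rparr>)"
  by (simp add: runs_def get_prv_def step_def)

lemma unlink_eq:
  "unlink c s = Some ((), s\<lparr>nxt := (nxt s)(prv s c := nxt s c), prv := (prv s)(nxt s c := prv s c),
     cost := cost s + 4\<rparr>)"
  by (simp add: unlink_def bind_prog_def get_nxt_def get_prv_def set_nxt_def set_prv_def step_def)

lemma insert_after_eq:
  "insert_after p c s = Some ((), s\<lparr>nxt := (nxt s)(p := c, c := nxt s p),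
     prv := (prv s)(c := p, nxt s p := c), cost := cost s + 5\<rparr>)"
  by (simp add: insert_after_def bind_prog_def get_nxt_def get_prv_def set_nxt_def set_prv_def step_def)

lemma make_empty_eq:
  "make_empty h s = Some ((), s\<lparr>nxt := (nxt s)(h := h), prv := (prv s)(h := h), cost := cost s + 2\<rparr>)"
  by (simp add: make_empty_def bind_prog_def set_nxt_def set_prv_def step_def)

section \<open>Doubly linked lists\<close>

definition link :: "'a mem \<Rightarrow> 'a cell \<Rightarrow> 'a cell \<Rightarrow> bool" where
  "link s c d \<longleftrightarrow> nxt s c = d \<and> prv s d = c"

lemma link_cost [simp]: "link (s\<lparr>cost := k\<rparr>) = link s"
  by (simp add: link_def fun_eq_iff)

text \<open>The header is repeated at the end, so that the link closing the circle is just one more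
  consecutive pair.\<close>

definition ring :: "'a mem \<Rightarrow> 'a cell \<Rightarrow> 'a cell list \<Rightarrow> bool" where
  "ring s h cs \<longleftrightarrow> distinct (h # cs) \<and> successively (link s) (h # cs @ [h])"

text \<open>The links of a segment read \<open>nxt\<close> at all cells but the last and
  \<open>prv\<close> at all but the first. This precision allows the two segments of a cut ring to
  be kept although the cells at the cut change.\<close>

lemma successively_link_cong:
  assumes "successively (link s) xs"
    and "\<And>c. c \<in> set (butlast xs) \<Longrightarrow> nxt s' c = nxt s c"
    and "\<And>c. c \<in> set (tl xs) \<Longrightarrow> prv s' c = prv s c"
  shows "successively (link s') xs"
  using assms
proof (induction xs)
  case (Cons x xs)
  show ?case
  proof (cases xs)
    case (Cons y ys)
    have "successively (link s') xs"
    proof (rule Cons.IH)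
      show "prv s' c = prv s c" if "c \<in> set (tl xs)" for c
        using Cons.prems(3)[of c] that Cons by simp
    qed (use Cons.prems Cons in auto)
    then show ?thesis using Cons.prems Cons by (auto simp: link_def)
  qed simp
qed simp

lemma ring_cong:
  assumes "ring s h cs" and "\<And>c. c \<in> set (h # cs) \<Longrightarrow> nxt s' c = nxt s c \<and> prv s' c = prv s c"
  shows "ring s' h cs"
  unfolding ring_def
proof
  show "successively (link s') (h # cs @ [h])"
    by (rule successively_link_cong[of s]) (use assms in \<open>auto simp: ring_def butlast_append\<close>)
qed (use assms in \<open>simp add: ring_def\<close>)

lemma ring_first: "ring s h cs \<Longrightarrow> nxt s h = hd (cs @ [h])"
  by (cases cs) (auto simp: ring_def link_def)

lemma ring_last:
  assumes "ring s h cs" shows "prv s h = last (h # cs)"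
proof -
  have "successively (link s) ((h # cs) @ [h])" using assms by (simp add: ring_def)
  from this[unfolded successively_append_iff] show ?thesis by (simp add: link_def)
qed

text \<open>The closed walk around the ring is cut at \<open>c\<close> into segments ending in
  \<open>p\<close> and starting with \<open>n\<close>; inside them nothing changes, and one new link
  joins them. Either of \<open>p\<close> and \<open>n\<close> may be the header. The last two
  conclusions locate the cells that are written.\<close>

lemma ring_unlink:
  assumes r: "ring s h (xs @ c # ys)"
    and s': "nxt s' = (nxt s)(prv s c := nxt s c)" "prv s' = (prv s)(nxt s c := prv s c)"
  shows "ring s' h (xs @ ys)" "prv s c \<in> set (h # xs)" "nxt s c \<in> set (h # ys)"
proof -
  obtain as p where p: "h # xs = as @ [p]" by (metis append_butlast_last_id list.distinct(1))
  obtain n bs where n: "ys @ [h] = n # bs" by (cases "ys @ [h]") auto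
  have d: "distinct (h # xs @ c # ys)" and "successively (link s) ((h # xs) @ c # ys @ [h])"
    using r by (simp_all add: ring_def)
  then have sc: "successively (link s) ((as @ [p]) @ c # n # bs)" by (simp only: p n)
  then have pc: "prv s c = p" "nxt s c = n" by (auto simp: successively_append_iff link_def)
  have pin: "p \<in> set (h # xs)" "n \<in> set (h # ys)"
    using arg_cong[OF p, of set] arg_cong[OF n, of set] by auto
  then show "prv s c \<in> set (h # xs)" "nxt s c \<in> set (h # ys)" using pc by auto
  have das: "distinct (as @ [p])" using d unfolding p[symmetric] by auto
  have dbs: "distinct (n # bs)" using d unfolding n[symmetric] by auto
  have tl: "set (tl (as @ [p])) \<subseteq> set xs" using arg_cong[OF p, of tl] by auto
  have bl: "set (butlast (n # bs)) \<subseteq> set ys" unfolding n[symmetric] by (simp add: butlast_append)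
  have "successively (link s') (as @ [p])"
  proof (rule successively_link_cong[of s])
    show "nxt s' x = nxt s x" if "x \<in> set (butlast (as @ [p]))" for x
      using that das by (auto simp: s' pc)
    show "prv s' x = prv s x" if "x \<in> set (tl (as @ [p]))" for x
      using that tl pin d by (auto simp: s' pc)
  qed (use sc in \<open>simp add: successively_append_iff\<close>)
  moreover have "successively (link s') (n # bs)"
  proof (rule successively_link_cong[of s])
    show "nxt s' x = nxt s x" if "x \<in> set (butlast (n # bs))" for x
      using that bl pin d by (auto simp: s' pc)
    show "prv s' x = prv s x" if "x \<in> set (tl (n # bs))" for x
      using that dbs by (auto simp: s' pc)
  qed (use sc in \<open>simp add: successively_append_iff\<close>)
  ultimately have "successively (link s') ((as @ [p]) @ n # bs)"
    unfolding successively_append_iff[of _ "as @ [p]"] by (simp add: link_def s' pc)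
  then have "successively (link s') (h # (xs @ ys) @ [h])"
    unfolding p[symmetric] n[symmetric] by simp
  then show "ring s' h (xs @ ys)" using d by (simp add: ring_def)
qed

text \<open>The position is given inside \<open>h # cs\<close> rather than \<open>cs\<close>, so
  that \<open>p\<close> may be the header itself.\<close>

lemma ring_insert:
  assumes r: "ring s h cs" and cs: "h # cs = xs @ p # ys" "h # cs' = xs @ p # c # ys"
    and c: "c \<notin> set (h # cs)"
    and s': "nxt s' = (nxt s)(p := c, c := nxt s p)" "prv s' = (prv s)(c := p, nxt s p := c)"
  shows "ring s' h cs'" "p \<in> set (h # cs)" "nxt s p \<in> set (h # cs)"
proof -
  obtain n bs where n: "ys @ [h] = n # bs" by (cases "ys @ [h]") auto
  have set: "set (h # cs) = set xs \<union> {p} \<union> set ys" by (simp only: cs(1)) auto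
  have "successively (link s) ((h # cs) @ [h])" using r by (simp add: ring_def)
  then have sc: "successively (link s) ((xs @ [p]) @ n # bs)" by (simp add: cs(1) n)
  then have np: "nxt s p = n" by (auto simp: successively_append_iff link_def)
  have n_in: "n \<in> set (h # ys)" using arg_cong[OF n, of set] by auto
  have h_in: "h \<in> set (xs @ [p])" using cs(1) by (cases xs) auto
  have d: "distinct (xs @ p # ys)" using r by (simp add: ring_def flip: cs(1))
  show "p \<in> set (h # cs)" "nxt s p \<in> set (h # cs)" using n_in set np by auto
  have tl: "set (tl (xs @ [p])) \<subseteq> set cs - set ys" "h \<notin> set (tl (xs @ [p]))"
    using cs(1) d by (cases xs; auto)+
  have dbs: "distinct (n # bs)" using d h_in unfolding n[symmetric] by auto
  have bl: "set (butlast (n # bs)) \<subseteq> set ys" unfolding n[symmetric] by (simp add: butlast_append)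
  have nbs: "set (n # bs) \<subseteq> set (h # ys)" unfolding n[symmetric] by auto
  have hys: "set (h # ys) \<subseteq> set (h # cs)" using set by auto
  have "successively (link s') (xs @ [p])"
  proof (rule successively_link_cong[of s])
    show "nxt s' x = nxt s x" if "x \<in> set (butlast (xs @ [p]))" for x
      using that d c set by (auto simp: s')
    show "prv s' x = prv s x" if "x \<in> set (tl (xs @ [p]))" for x
      using that tl n_in c by (auto simp: s' np)
  qed (use sc in \<open>simp add: successively_append_iff\<close>)
  moreover have "successively (link s') (n # bs)"
  proof (rule successively_link_cong[of s])
    show "nxt s' x = nxt s x" if "x \<in> set (butlast (n # bs))" for x
      using that bl d c set by (auto simp: s')
    show "prv s' x = prv s x" if "x \<in> set (tl (n # bs))" for x
      using that dbs nbs hys c by (auto simp: s' np)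
  qed (use sc in \<open>simp add: successively_append_iff\<close>)
  moreover have "c \<noteq> p" "c \<noteq> n" using c set nbs hys by auto
  ultimately have "successively (link s') ((xs @ [p]) @ c # n # bs)"
    unfolding successively_append_iff[of _ "xs @ [p]"] by (simp add: link_def s' np)
  then have "successively (link s') ((h # cs') @ [h])"
    unfolding cs(2) by (simp add: n)
  moreover have "distinct (h # cs')" unfolding cs(2) using d c set by auto
  ultimately show "ring s' h cs'" by (simp add: ring_def)
qed

text \<open>Separation: the rings, headers included, are pairwise disjoint, so an operation on one
  of them leaves the others intact. \<open>L\<close> is the abstract content of the memory.\<close>

definition rings :: "'a mem \<Rightarrow> 'a cell set \<Rightarrow> ('a cell \<Rightarrow> 'a cell list) \<Rightarrow> bool" where
  "rings s Hd L \<longleftrightarrow> (\<forall>h\<in>Hd. ring s h (L h)) \<and>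
     (\<forall>h\<in>Hd. \<forall>k\<in>Hd. h \<noteq> k \<longrightarrow> set (h # L h) \<inter> set (k # L k) = {})"

lemma rings_cong:
  assumes "nxt s' = nxt s" "prv s' = prv s"
  shows "rings s' Hd L = rings s Hd L"
proof -
  have "link s' = link s" using assms by (auto simp: link_def fun_eq_iff)
  then show ?thesis by (simp add: rings_def ring_def)
qed

lemma rings_cost [simp]: "rings (s\<lparr>cost := k\<rparr>) Hd L = rings s Hd L"
  by (rule rings_cong) simp_all

lemma rings_deg [simp]: "rings (s\<lparr>deg := d\<rparr>) Hd L = rings s Hd L"
  by (rule rings_cong) simp_all

text \<open>The frame rule: if all writes happen within the old or new cells of the ring of
  \<open>h\<close>, every other ring is unaffected by disjointness.\<close>

lemma rings_update:
  assumes "rings s Hd L" "h \<in> Hd" "ring s' h cs'"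
    and "\<And>c. c \<notin> set (h # L h) \<Longrightarrow> c \<notin> set (h # cs') \<Longrightarrow> nxt s' c = nxt s c \<and> prv s' c = prv s c"
    and "\<And>k. k \<in> Hd \<Longrightarrow> k \<noteq> h \<Longrightarrow> set (h # cs') \<inter> set (k # L k) = {}"
  shows "rings s' Hd (L(h := cs'))"
  unfolding rings_def
proof (intro conjI ballI impI)
  fix k assume k: "k \<in> Hd"
  show "ring s' k ((L(h := cs')) k)"
  proof (cases "k = h")
    case False
    then have "set (h # L h) \<inter> set (k # L k) = {}" "set (h # cs') \<inter> set (k # L k) = {}"
      using assms(1,2,5) k by (auto simp: rings_def)
    then have "nxt s' c = nxt s c \<and> prv s' c = prv s c" if "c \<in> set (k # L k)" for c
      using that by (intro assms(4)) blast+
    moreover have "ring s k (L k)" using assms(1) k by (simp add: rings_def)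
    ultimately show ?thesis using False ring_cong[of s k "L k" s'] by auto
  qed (simp add: assms(3))
next
  fix k j assume kj: "k \<in> Hd" "j \<in> Hd" "k \<noteq> j"
  show "set (k # (L(h := cs')) k) \<inter> set (j # (L(h := cs')) j) = {}"
  proof (cases "k = h \<or> j = h")
    case True
    then show ?thesis using assms(5)[of j] assms(5)[of k] kj by (auto split: if_splits)
  next
    case False
    then show ?thesis using assms(1) kj by (simp add: rings_def)
  qed
qed

section \<open>Pointer operations on a family of rings\<close>

lemma runs_unlink:
  assumes L: "rings s Hd L" and h: "h \<in> Hd" and c: "c \<in> set (L h)"
  shows "runs (unlink c) s 4 (\<lambda>_ s'. rings s' Hd (L(h := remove1 c (L h))) \<and> deg s' = deg s)"
proof -
  define s' where "s' = s\<lparr>nxt := (nxt s)(prv s c := nxt s c), prv := (prv s)(nxt s c := prv s c),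
     cost := cost s + 4\<rparr>"
  have r: "ring s h (L h)" using L h by (simp add: rings_def)
  obtain xs ys where xy: "L h = xs @ c # ys" using c by (meson split_list)
  then have "c \<notin> set xs" using r by (auto simp: ring_def)
  then have rm: "remove1 c (L h) = xs @ ys" by (simp add: xy remove1_append)
  have "nxt s' = (nxt s)(prv s c := nxt s c)" "prv s' = (prv s)(nxt s c := prv s c)"
    by (simp_all add: s'_def)
  note u = ring_unlink[OF r[unfolded xy] this]
  have "rings s' Hd (L(h := xs @ ys))"
  proof (rule rings_update[OF L h u(1)])
    show "nxt s' d = nxt s d \<and> prv s' d = prv s d"
      if "d \<notin> set (h # L h)" "d \<notin> set (h # xs @ ys)" for d
      using that u(2,3) by (auto simp: s'_def)
    show "set (h # xs @ ys) \<inter> set (k # L k) = {}" if "k \<in> Hd" "k \<noteq> h" for k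
    proof -
      have "set (h # L h) \<inter> set (k # L k) = {}" using L h that by (simp add: rings_def)
      then show ?thesis by (auto simp: xy)
    qed
  qed
  then show ?thesis unfolding runs_def unlink_eq s'_def[symmetric] by (simp add: rm) (simp add: s'_def)
qed

lemma runs_insert_after:
  assumes L: "rings s Hd L" and h: "h \<in> Hd"
    and cs: "h # L h = xs @ p # ys" "h # cs' = xs @ p # c # ys"
    and c: "\<And>k. k \<in> Hd \<Longrightarrow> c \<notin> set (k # L k)"
  shows "runs (insert_after p c) s 5 (\<lambda>_ s'. rings s' Hd (L(h := cs')) \<and> deg s' = deg s)"
proof -
  define s' where "s' = s\<lparr>nxt := (nxt s)(p := c, c := nxt s p),
     prv := (prv s)(c := p, nxt s p := c), cost := cost s + 5\<rparr>"
  have r: "ring s h (L h)" using L h by (simp add: rings_def)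
  have "nxt s' = (nxt s)(p := c, c := nxt s p)" "prv s' = (prv s)(c := p, nxt s p := c)"
    by (simp_all add: s'_def)
  note u = ring_insert[OF r cs c[OF h] this]
  have set: "set (h # cs') = insert c (set (h # L h))" by (simp only: cs) auto
  have "rings s' Hd (L(h := cs'))"
  proof (rule rings_update[OF L h u(1)])
    show "nxt s' d = nxt s d \<and> prv s' d = prv s d"
      if "d \<notin> set (h # L h)" "d \<notin> set (h # cs')" for d
      using that u(2,3) unfolding set by (auto simp: s'_def)
    show "set (h # cs') \<inter> set (k # L k) = {}" if "k \<in> Hd" "k \<noteq> h" for k
    proof -
      have "set (h # L h) \<inter> set (k # L k) = {}" using L h that by (simp add: rings_def)
      then show ?thesis unfolding set using c[OF that(1)] by blast
    qed
  qed
  then show ?thesis unfolding runs_def insert_after_eq s'_def[symmetric] by simp (simp add: s'_def)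
qed

lemma runs_make_empty:
  assumes L: "rings s Hd L" and h: "h \<notin> Hd" and c: "\<And>k. k \<in> Hd \<Longrightarrow> h \<notin> set (L k)"
  shows "runs (make_empty h) s 2 (\<lambda>_ s'. rings s' (insert h Hd) (L(h := [])) \<and> deg s' = deg s)"
proof -
  define s' where "s' = s\<lparr>nxt := (nxt s)(h := h), prv := (prv s)(h := h), cost := cost s + 2\<rparr>"
  have "ring s' h []" by (simp add: ring_def link_def s'_def)
  moreover have "ring s' k (L k)" if "k \<in> Hd" for k
  proof (rule ring_cong)
    show "ring s k (L k)" using L that by (simp add: rings_def)
    show "nxt s' d = nxt s d \<and> prv s' d = prv s d" if "d \<in> set (k # L k)" for d
      using that c[OF \<open>k \<in> Hd\<close>] h \<open>k \<in> Hd\<close> by (auto simp: s'_def)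
  qed
  ultimately have "rings s' (insert h Hd) (L(h := []))"
    using L h c unfolding rings_def by auto
  then show ?thesis unfolding runs_def make_empty_eq s'_def[symmetric] by simp (simp add: s'_def)
qed

lemma runs_is_empty:
  assumes "rings s Hd L" "h \<in> Hd"
  shows "runs (is_empty h) s 1 (\<lambda>b s'. b = (L h = []) \<and> s' = s\<lparr>cost := cost s + 1\<rparr>)"
proof -
  have "ring s h (L h)" using assms by (simp add: rings_def)
  then have "nxt s h = h \<longleftrightarrow> L h = []"
    using ring_first[of s h "L h"] by (cases "L h") (auto simp: ring_def)
  then show ?thesis
    by (simp add: runs_def is_empty_def bind_prog_def get_nxt_def step_def ret_def)
qed

text \<open>Formulated for a final segment of a ring, since this is what remains after each step of
  the traversal.\<close>

lemma collect_eq: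
  assumes "successively (link s) (cs @ [h])" "h \<notin> set cs"
  shows "collect h (hd (cs @ [h])) s = Some (map target cs, s\<lparr>cost := cost s + length cs\<rparr>)"
  using assms
proof (induction cs arbitrary: s)
  case Nil
  then show ?case by (simp add: collect.simps ret_def)
next
  case (Cons c cs)
  let ?s = "s\<lparr>cost := cost s + 1\<rparr>"
  have "nxt s c = hd (cs @ [h])" using Cons.prems by (cases cs) (auto simp: link_def)
  moreover have "successively (link s) (cs @ [h])" "c \<noteq> h" using Cons.prems by (cases cs; auto)+
  ultimately show ?case
    using Cons.IH[of ?s] Cons.prems
    by (subst collect.simps) (simp add: bind_prog_def get_nxt_def step_def ret_def)
qed

lemma runs_neighbours:
  assumes "rings s Hd L" "Adj u \<in> Hd"
  shows "runs (neighbours u) s (Suc (length (L (Adj u))))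
    (\<lambda>ws s'. ws = map target (L (Adj u)) \<and> s' = s\<lparr>cost := cost s + Suc (length (L (Adj u)))\<rparr>)"
proof -
  let ?h = "Adj u" and ?cs = "L (Adj u)" and ?s = "s\<lparr>cost := cost s + 1\<rparr>"
  have r: "ring s ?h ?cs" using assms by (simp add: rings_def)
  have "successively (link s) (?cs @ [?h])" "?h \<notin> set ?cs"
    using r by (cases ?cs; auto simp: ring_def)+
  then have "collect ?h (hd (?cs @ [?h])) ?s
    = Some (map target ?cs, ?s\<lparr>cost := cost ?s + length ?cs\<rparr>)"
    by (intro collect_eq) simp_all
  then show ?thesis
    using ring_first[OF r] by (simp add: runs_def neighbours_def bind_prog_def get_nxt_def step_def)
qed


section \<open>The data structure\<close>

definition headers :: "'a set \<Rightarrow> nat \<Rightarrow> 'a cell set" where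
  "headers V n = Adj ` V \<union> Bkt ` {..<n} \<union> {Top}"

text \<open>\<open>V\<close> is the original vertex set and \<open>X\<close> the current one:
  adjacency lists exist for deleted vertices too. Only the order of \<open>Top\<close> is recorded,
  because the maximum degree is read off from its first cell.\<close>

definition contents ::
    "'a set \<Rightarrow> nat \<Rightarrow> ('a \<Rightarrow> 'a set) \<Rightarrow> 'a set \<Rightarrow> ('a \<Rightarrow> nat) \<Rightarrow> nat set \<Rightarrow> ('a cell \<Rightarrow> 'a cell list) \<Rightarrow> bool"
  where "contents V n A X \<delta> S L \<longleftrightarrow>
    (\<forall>u\<in>V. set (L (Adj u)) = Arc u ` A u) \<and>
    (\<forall>d<n. set (L (Bkt d)) = Vtx ` {u \<in> X. \<delta> u = d}) \<and>
    set (L Top) = Deg ` S \<and> sorted_wrt (>) (map dg (L Top))"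

text \<open>In the middle of a change of a degree, the set \<open>S\<close> of the listed degrees differs from
  \<open>deg s ` X\<close>.\<close>

definition rep' ::
    "'a set \<Rightarrow> nat \<Rightarrow> ('a \<Rightarrow> 'a set) \<Rightarrow> 'a set \<Rightarrow> nat set \<Rightarrow> 'a mem \<Rightarrow> bool" where
  "rep' V n A X S s \<longleftrightarrow> (\<exists>L. rings s (headers V n) L \<and> contents V n A X (deg s) S L) \<and>
     X \<subseteq> V \<and> (\<forall>u\<in>X. deg s u < n)"

abbreviation rep :: "'a set \<Rightarrow> nat \<Rightarrow> ('a \<Rightarrow> 'a set) \<Rightarrow> 'a set \<Rightarrow> 'a mem \<Rightarrow> bool" where
  "rep V n A X s \<equiv> rep' V n A X (deg s ` X) s"

lemma rep'_cost [simp]: "rep' V n A X S (s\<lparr>cost := k\<rparr>) = rep' V n A X S s"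
  by (simp add: rep'_def)

lemma rep'E:
  assumes "rep' V n A X S s"
  obtains L where "rings s (headers V n) L" "contents V n A X (deg s) S L"
    "X \<subseteq> V" "\<And>u. u \<in> X \<Longrightarrow> deg s u < n"
  using assms by (auto simp: rep'_def)

lemma in_headers [simp]:
  "Top \<in> headers V n" "Adj u \<in> headers V n \<longleftrightarrow> u \<in> V" "Bkt d \<in> headers V n \<longleftrightarrow> d < n"
  "Arc u w \<notin> headers V n" "Vtx u \<notin> headers V n" "Deg d \<notin> headers V n"
  by (auto simp: headers_def)

lemma contents_fresh:
  assumes "contents V n A X \<delta> S L" and k: "k \<in> headers V n"
  shows "w \<notin> A u \<Longrightarrow> Arc u w \<notin> set (k # L k)"
    and "u \<notin> X \<Longrightarrow> Vtx u \<notin> set (k # L k)"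
    and "d \<notin> S \<Longrightarrow> Deg d \<notin> set (k # L k)"
  using assms by (auto simp: headers_def contents_def)

lemma ring_distinct: "rings s Hd L \<Longrightarrow> h \<in> Hd \<Longrightarrow> distinct (L h)"
  by (auto simp: rings_def ring_def)

lemma set_remove1_ring: "rings s Hd L \<Longrightarrow> h \<in> Hd \<Longrightarrow> set (remove1 c (L h)) = set (L h) - {c}"
  by (simp add: ring_distinct)

lemma sorted_wrt_remove1: "sorted_wrt P (map f xs) \<Longrightarrow> sorted_wrt P (map f (remove1 x xs))"
  by (induction xs) (auto dest: set_remove1_subset[THEN subsetD])

section \<open>Operations on adjacency lists and degree buckets\<close>

lemma runs_unlink_Arc:
  assumes "rep' V n A X S s" "u \<in> V" "w \<in> A u"
  shows "runs (unlink (Arc u w)) s 4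
    (\<lambda>_ s'. rep' V n (A(u := A u - {w})) X S s' \<and> deg s' = deg s)"
proof -
  obtain L where L: "rings s (headers V n) L" "contents V n A X (deg s) S L"
    "X \<subseteq> V" "\<And>u. u \<in> X \<Longrightarrow> deg s u < n" using assms(1) by (rule rep'E) blast
  have "runs (unlink (Arc u w)) s 4 (\<lambda>_ s'. rings s' (headers V n)
      (L(Adj u := remove1 (Arc u w) (L (Adj u)))) \<and> deg s' = deg s)"
    by (rule runs_unlink[OF L(1)]) (use L(2) assms in \<open>auto simp: contents_def\<close>)
  then show ?thesis
  proof (rule runs_weaken)
    fix r s' assume s': "rings s' (headers V n)
      (L(Adj u := remove1 (Arc u w) (L (Adj u)))) \<and> deg s' = deg s"
    have "contents V n (A(u := A u - {w})) X (deg s) S (L(Adj u := remove1 (Arc u w) (L (Adj u))))"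
      using L(2) set_remove1_ring[OF L(1), of "Adj u" "Arc u w"] assms(2)
      by (auto simp: contents_def)
    then show "rep' V n (A(u := A u - {w})) X S s' \<and> deg s' = deg s"
      using s' L(3,4) by (auto simp: rep'_def)
  qed simp
qed

lemma runs_insert_Arc:
  assumes "rep' V n A X S s" "u \<in> V" "w \<notin> A u"
  shows "runs (insert_after (Adj u) (Arc u w)) s 5
    (\<lambda>_ s'. rep' V n (A(u := insert w (A u))) X S s' \<and> deg s' = deg s)"
proof -
  obtain L where L: "rings s (headers V n) L" "contents V n A X (deg s) S L"
    "X \<subseteq> V" "\<And>u. u \<in> X \<Longrightarrow> deg s u < n" using assms(1) by (rule rep'E) blast
  have "runs (insert_after (Adj u) (Arc u w)) s 5 (\<lambda>_ s'. rings s' (headers V n)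
      (L(Adj u := Arc u w # L (Adj u))) \<and> deg s' = deg s)"
  proof (rule runs_insert_after[OF L(1), where xs = "[]"])
    show "Arc u w \<notin> set (k # L k)" if "k \<in> headers V n" for k
      using contents_fresh(1)[OF L(2) that assms(3)] .
  qed (use assms in auto)
  then show ?thesis
  proof (rule runs_weaken)
    fix r s' assume s': "rings s' (headers V n)
      (L(Adj u := Arc u w # L (Adj u))) \<and> deg s' = deg s"
    have "contents V n (A(u := insert w (A u))) X (deg s) S (L(Adj u := Arc u w # L (Adj u)))"
      using L(2) assms(2) by (auto simp: contents_def)
    then show "rep' V n (A(u := insert w (A u))) X S s' \<and> deg s' = deg s"
      using s' L(3,4) by (auto simp: rep'_def)
  qed simp
qed

lemma runs_is_empty_Bkt:
  assumes "rep' V n A X S s" "d < n"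
  shows "runs (is_empty (Bkt d)) s 1 (\<lambda>b s'. b = (d \<notin> deg s ` X) \<and> s' = s\<lparr>cost := cost s + 1\<rparr>)"
proof -
  obtain L where L: "rings s (headers V n) L" "contents V n A X (deg s) S L"
    using assms(1) by (rule rep'E) blast
  have "L (Bkt d) = [] \<longleftrightarrow> set (L (Bkt d)) = {}" by simp
  also have "\<dots> \<longleftrightarrow> d \<notin> deg s ` X" using L(2) assms(2) by (auto simp: contents_def)
  finally show ?thesis using runs_is_empty[OF L(1), of "Bkt d"] assms(2) by simp
qed

lemma runs_unlink_Deg:
  assumes "rep' V n A X S s" "d \<in> S"
  shows "runs (unlink (Deg d)) s 4 (\<lambda>_ s'. rep' V n A X (S - {d}) s' \<and> deg s' = deg s)"
proof -
  obtain L where L: "rings s (headers V n) L" "contents V n A X (deg s) S L"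
    "X \<subseteq> V" "\<And>u. u \<in> X \<Longrightarrow> deg s u < n" using assms(1) by (rule rep'E) blast
  have "runs (unlink (Deg d)) s 4 (\<lambda>_ s'. rings s' (headers V n)
      (L(Top := remove1 (Deg d) (L Top))) \<and> deg s' = deg s)"
    by (rule runs_unlink[OF L(1)]) (use L(2) assms in \<open>auto simp: contents_def\<close>)
  then show ?thesis
  proof (rule runs_weaken)
    fix r s' assume s': "rings s' (headers V n)
      (L(Top := remove1 (Deg d) (L Top))) \<and> deg s' = deg s"
    have "contents V n A X (deg s) (S - {d}) (L(Top := remove1 (Deg d) (L Top)))"
      using L(2) set_remove1_ring[OF L(1), of Top "Deg d"]
      by (auto simp: contents_def sorted_wrt_remove1)
    then show "rep' V n A X (S - {d}) s' \<and> deg s' = deg s"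
      using s' L(3,4) by (auto simp: rep'_def)
  qed simp
qed

text \<open>The comparisons concern \<open>Deg\<close> cells only, so that \<open>p\<close> may be
  the header \<open>Top\<close>, that is, the new degree may become the largest one.\<close>

lemma runs_insert_Deg:
  assumes R: "rep' V n A X S s" "d \<notin> S"
    and L: "rings s (headers V n) L" "contents V n A X (deg s) S L"
    and p: "Top # L Top = xs @ p # ys"
    and lt: "\<And>e. Deg e \<in> set ys \<Longrightarrow> e < d" and gt: "\<And>e. Deg e \<in> set (xs @ [p]) \<Longrightarrow> d < e"
  shows "runs (insert_after p (Deg d)) s 5 (\<lambda>_ s'. rep' V n A X (insert d S) s' \<and> deg s' = deg s)"
proof -
  define cs where "cs = tl (xs @ p # Deg d # ys)"
  have hd: "hd (xs @ [p]) = Top" using p by (cases xs) auto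
  have cs: "Top # cs = xs @ p # Deg d # ys" unfolding cs_def using hd by (cases xs) auto
  have runs: "runs (insert_after p (Deg d)) s 5 (\<lambda>_ s'. rings s' (headers V n) (L(Top := cs)) \<and> deg s' = deg s)"
  proof (rule runs_insert_after[OF L(1) _ p cs])
    show "Deg d \<notin> set (k # L k)" if "k \<in> headers V n" for k
      using contents_fresh(3)[OF L(2) that R(2)] .
  qed simp
  have LTop: "L Top = tl (xs @ [p]) @ ys" and csE: "cs = tl (xs @ [p]) @ Deg d # ys"
    using p cs by (cases xs; auto)+
  have tl: "set (tl (xs @ [p])) \<subseteq> set (xs @ [p])" by (cases xs) auto
  have SL: "set (L Top) = Deg ` S" "sorted_wrt (>) (map dg (L Top))"
    using L(2) by (simp_all add: contents_def)
  have all: "c = Deg (dg c)" if "c \<in> set (tl (xs @ [p])) \<or> c \<in> set ys" for c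
  proof -
    have "c \<in> Deg ` S" using that SL(1) LTop by auto
    then show ?thesis by auto
  qed
  have "sorted_wrt (>) (map dg cs)"
    using SL(2) unfolding LTop csE map_append list.map sorted_wrt_append sorted_wrt.simps cell.sel
  proof (intro conjI ballI; (elim conjE)?)
    fix x assume "x \<in> set (map dg ys)"
    then show "d > x" using lt all by force
  next
    fix x y assume ss: "\<forall>x\<in>set (map dg (tl (xs @ [p]))). \<forall>y\<in>set (map dg ys). y < x"
      and x: "x \<in> set (map dg (tl (xs @ [p])))" and y: "y \<in> set (d # map dg ys)"
    from x obtain c where c: "c \<in> set (tl (xs @ [p]))" "x = dg c" by auto
    then have "d < x" using gt[of x] all[of c] tl by auto
    then show "y < x" using ss x y by auto
  qed auto
  moreover have "set cs = Deg ` insert d S" using SL(1) LTop csE by auto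
  ultimately have "contents V n A X (deg s) (insert d S) (L(Top := cs))"
    using L(2) by (auto simp: contents_def)
  then show ?thesis
    by (intro runs_weaken[OF runs]) (use R in \<open>auto simp: rep'_def\<close>)
qed

lemma Top_split:
  assumes "contents V n A X \<delta> S L" "d \<in> S"
  obtains xs ys where "L Top = xs @ Deg d # ys"
    "\<And>e. Deg e \<in> set xs \<Longrightarrow> d < e" "\<And>e. Deg e \<in> set ys \<Longrightarrow> e < d"
proof -
  have "Deg d \<in> set (L Top)" using assms by (simp add: contents_def)
  then obtain xs ys where xy: "L Top = xs @ Deg d # ys" by (meson split_list)
  have sorted: "sorted_wrt (>) (map dg (L Top))" using assms by (simp add: contents_def)
  show thesis
  proof (rule that[OF xy])
    fix e assume "Deg e \<in> set xs"
    then show "d < e" using sorted unfolding xy by (force simp: sorted_wrt_append)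
  next
    fix e assume "Deg e \<in> set ys"
    then show "e < d" using sorted unfolding xy by (force simp: sorted_wrt_append)
  qed
qed

lemma runs_insert_Deg_below:
  assumes R: "rep' V n A X S s" and d: "Suc d \<in> S" "d \<notin> S"
  shows "runs (insert_after (Deg (Suc d)) (Deg d)) s 5
    (\<lambda>_ s'. rep' V n A X (insert d S) s' \<and> deg s' = deg s)"
proof -
  obtain L where L: "rings s (headers V n) L" "contents V n A X (deg s) S L"
    using R by (rule rep'E) blast
  obtain xs ys where xy: "L Top = xs @ Deg (Suc d) # ys"
    "\<And>e. Deg e \<in> set xs \<Longrightarrow> Suc d < e" "\<And>e. Deg e \<in> set ys \<Longrightarrow> e < Suc d"
    using Top_split[OF L(2) d(1)] by blast
  show ?thesis
  proof (rule runs_insert_Deg[OF R d(2) L, where xs = "Top # xs" and ys = ys])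
    fix e assume e: "Deg e \<in> set ys"
    then have "Deg e \<in> set (L Top)" using xy(1) by simp
    then have "e \<in> S" using L(2) by (auto simp: contents_def)
    then have "e \<noteq> d" using d by auto
    then show "e < d" using xy(3)[OF e] by simp
  next
    fix e assume "Deg e \<in> set ((Top # xs) @ [Deg (Suc d)])"
    then show "d < e" using xy(2)[of e] by auto
  qed (simp add: xy(1))
qed

text \<open>Dually, as \<open>Suc d\<close> is not listed, all degrees before \<open>Deg d\<close>
  exceed \<open>Suc d\<close>.\<close>

lemma runs_insert_Deg_above:
  assumes R: "rep' V n A X S s" and d: "d \<in> S" "Suc d \<notin> S"
  shows "runs (do { p \<leftarrow> get_prv (Deg d); insert_after p (Deg (Suc d)) }) s 6
    (\<lambda>_ s'. rep' V n A X (insert (Suc d) S) s' \<and> deg s' = deg s)"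
proof -
  obtain L where L: "rings s (headers V n) L" "contents V n A X (deg s) S L"
    using R by (rule rep'E) blast
  obtain xs ys where xy: "L Top = xs @ Deg d # ys"
    "\<And>e. Deg e \<in> set xs \<Longrightarrow> d < e" "\<And>e. Deg e \<in> set ys \<Longrightarrow> e < d"
    using Top_split[OF L(2) d(1)] by blast
  obtain zs p where zp: "Top # xs = zs @ [p]" by (metis append_butlast_last_id list.distinct(1))
  have "ring s Top (L Top)" using L(1) by (simp add: rings_def)
  then have "successively (link s) ((zs @ [p]) @ Deg d # ys @ [Top])"
    unfolding zp[symmetric] by (simp add: ring_def xy(1))
  then have prv: "prv s (Deg d) = p" by (auto simp: successively_append_iff link_def)
  let ?s = "s\<lparr>cost := cost s + 1\<rparr>"
  have "runs (insert_after p (Deg (Suc d))) ?s 5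
    (\<lambda>_ s'. rep' V n A X (insert (Suc d) S) s' \<and> deg s' = deg ?s)"
  proof (rule runs_insert_Deg[OF _ d(2), where xs = zs and ys = "Deg d # ys" and L = L])
    show "Top # L Top = zs @ p # Deg d # ys" using arg_cong[OF zp, of "\<lambda>l. l @ Deg d # ys"]
      by (simp add: xy(1))
  next
    fix e assume "Deg e \<in> set (Deg d # ys)"
    then show "e < Suc d" using xy(3)[of e] by auto
  next
    fix e assume "Deg e \<in> set (zs @ [p])"
    then have e: "Deg e \<in> set xs" unfolding zp[symmetric] by simp
    then have "Deg e \<in> set (L Top)" using xy(1) by simp
    then have "e \<in> S" using L(2) by (auto simp: contents_def)
    then have "e \<noteq> Suc d" using d by auto
    then show "Suc d < e" using xy(2)[OF e] by simp
  qed (use R L in simp_all)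
  then show ?thesis
    by (intro runs_bind[OF runs_get_prv, where k' = 5]) (auto simp: prv)
qed

lemma runs_insert_Deg_0:
  assumes R: "rep' V n A X S s" and d: "0 \<notin> S"
  shows "runs (do { p \<leftarrow> get_prv Top; insert_after p (Deg 0) }) s 6
    (\<lambda>_ s'. rep' V n A X (insert 0 S) s' \<and> deg s' = deg s)"
proof -
  obtain L where L: "rings s (headers V n) L" "contents V n A X (deg s) S L"
    using R by (rule rep'E) blast
  define zs p where "zs = butlast (Top # L Top)" and "p = last (Top # L Top)"
  have zp: "Top # L Top = zs @ [p]" unfolding zs_def p_def by (metis append_butlast_last_id list.distinct(1))
  have "ring s Top (L Top)" using L(1) by (simp add: rings_def)
  then have prv: "prv s Top = p" unfolding p_def by (rule ring_last)
  let ?s = "s\<lparr>cost := cost s + 1\<rparr>"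
  have "runs (insert_after p (Deg 0)) ?s 5
    (\<lambda>_ s'. rep' V n A X (insert 0 S) s' \<and> deg s' = deg ?s)"
  proof (rule runs_insert_Deg[OF _ d, where xs = zs and ys = "[]" and L = L])
    fix e assume "Deg e \<in> set (zs @ [p])"
    then have "e \<in> S" using L(2) unfolding zp[symmetric] by (auto simp: contents_def)
    then show "0 < e" using d by (cases "e = 0") auto
  qed (use R L zp in simp_all)
  then show ?thesis
    by (intro runs_bind[OF runs_get_prv, where k' = 5]) (auto simp: prv)
qed


text \<open>The common core of raising and lowering a degree: \<open>d'\<close> is already listed
  although its bucket may still be empty, and \<open>d\<close> is unlisted if its bucket becomes
  empty.\<close>

lemma runs_move_vertex:
  assumes R: "rep' V n A X (insert d' (deg s ` X)) s" and u: "u \<in> X" and d: "d = deg s u" "d \<noteq> d'" "d' < n"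
  shows "runs (do {
       unlink (Vtx u);
       insert_after (Bkt d') (Vtx u);
       b \<leftarrow> is_empty (Bkt d);
       (if b then unlink (Deg d) else ret ());
       set_deg u d' }) s 15 (\<lambda>_ s'. rep V n A X s' \<and> deg s' = (deg s)(u := d'))"
proof -
  obtain L where L: "rings s (headers V n) L" "contents V n A X (deg s) (insert d' (deg s ` X)) L"
    "X \<subseteq> V" "\<And>u. u \<in> X \<Longrightarrow> deg s u < n" using R by (rule rep'E) blast
  let ?\<delta> = "(deg s)(u := d')"
  define L1 where "L1 = L(Bkt d := remove1 (Vtx u) (L (Bkt d)))"
  define L2 where "L2 = L1(Bkt d' := Vtx u # L1 (Bkt d'))"
  have dn: "d < n" using L(4) u d by simp
  have 1: "runs (unlink (Vtx u)) s 4 (\<lambda>_ s'. rings s' (headers V n) L1 \<and> deg s' = deg s)"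
    unfolding L1_def
    by (rule runs_unlink[OF L(1)]) (use dn L(2) u d in \<open>auto simp: contents_def\<close>)
  have L1: "contents V n A (X - {u}) (deg s) (insert d' (deg s ` X)) L1"
    using L(2) set_remove1_ring[OF L(1), of "Bkt d" "Vtx u"] dn d(1)
    by (auto simp: contents_def L1_def)
  have 2: "runs (insert_after (Bkt d') (Vtx u)) s' 5
      (\<lambda>_ s'. rings s' (headers V n) L2 \<and> deg s' = deg s)"
    if "rings s' (headers V n) L1" "deg s' = deg s" for s'
    unfolding L2_def that(2)[symmetric]
  proof (rule runs_insert_after[OF that(1), where xs = "[]"])
    show "Vtx u \<notin> set (k # L1 k)" if "k \<in> headers V n" for k
      using contents_fresh(2)[OF L1 that] by blast
  qed (use d in auto)
  have L2: "contents V n A X ?\<delta> (insert d' (deg s ` X)) L2"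
    using L1 u d dn by (auto simp: contents_def L2_def)
  have S: "insert d' (deg s ` X) = insert d (?\<delta> ` X)" using u d by auto
  \<comment> \<open>At this point the lists already describe the new degrees
    \<open>?\<delta>\<close>, while the field \<open>deg\<close> still holds the old ones. The
    invariant is therefore stated for the memory with \<open>deg\<close> replaced.\<close>
  have rep2: "rep' V n A X (insert d (?\<delta> ` X)) (s'\<lparr>deg := ?\<delta>\<rparr>)"
    if "rings s' (headers V n) L2" for s' :: "'a mem"
    using that L2 L(3,4) d(3) unfolding S by (auto simp: rep'_def)
  have 3: "runs (do { b \<leftarrow> is_empty (Bkt d); (if b then unlink (Deg d) else ret ()); set_deg u d' }) s' 6
      (\<lambda>_ s'. rep V n A X s' \<and> deg s' = ?\<delta>)"
    if s': "rings s' (headers V n) L2" "deg s' = deg s" for s'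
  proof (rule runs_bind[OF runs_is_empty[OF s'(1)]])
    fix b s1 assume b: "b = (L2 (Bkt d) = []) \<and> s1 = s'\<lparr>cost := cost s' + 1\<rparr>"
    have "b \<longleftrightarrow> set (L2 (Bkt d)) = {}" using b by simp
    moreover have "set (L2 (Bkt d)) = Vtx ` {x \<in> X. ?\<delta> x = d}"
      using L2 dn by (simp add: contents_def del: fun_upd_apply)
    ultimately have "b \<longleftrightarrow> {x \<in> X. ?\<delta> x = d} = {}" by (simp del: fun_upd_apply)
    then have bd: "b \<longleftrightarrow> d \<notin> ?\<delta> ` X" by (auto simp del: fun_upd_apply)
    show "runs (do { (if b then unlink (Deg d) else ret ()); set_deg u d' }) s1 5
      (\<lambda>_ s'. rep V n A X s' \<and> deg s' = ?\<delta>)"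
    proof (rule runs_bind[where k = 4 and k' = 1 and Q = "\<lambda>_ s2. deg s2 = deg s \<and> rep' V n A X (?\<delta> ` X) (s2\<lparr>deg := ?\<delta>\<rparr>)"])
      show "runs (if b then unlink (Deg d) else ret ()) s1 4
        (\<lambda>_ s2. deg s2 = deg s \<and> rep' V n A X (?\<delta> ` X) (s2\<lparr>deg := ?\<delta>\<rparr>))"
      proof (cases b)
        case True
        have r1: "rings s1 (headers V n) L2" using b s' by simp
        have "runs (unlink (Deg d)) s1 4
          (\<lambda>_ s2. rings s2 (headers V n) (L2(Top := remove1 (Deg d) (L2 Top))) \<and> deg s2 = deg s1)"
          by (rule runs_unlink[OF r1]) (use L2 S in \<open>auto simp: contents_def\<close>)
        then have "runs (unlink (Deg d)) s1 4
          (\<lambda>_ s2. deg s2 = deg s \<and> rep' V n A X (?\<delta> ` X) (s2\<lparr>deg := ?\<delta>\<rparr>))"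
        proof (rule runs_weaken)
          fix r s2
          assume s2: "rings s2 (headers V n) (L2(Top := remove1 (Deg d) (L2 Top))) \<and> deg s2 = deg s1"
          have "insert d (?\<delta> ` X) - {d} = ?\<delta> ` X" using True bd by auto
          then have "contents V n A X ?\<delta> (?\<delta> ` X) (L2(Top := remove1 (Deg d) (L2 Top)))"
            using L2 set_remove1_ring[OF r1, of Top "Deg d"] unfolding S
            by (auto simp: contents_def sorted_wrt_remove1)
          then show "deg s2 = deg s \<and> rep' V n A X (?\<delta> ` X) (s2\<lparr>deg := ?\<delta>\<rparr>)"
            using s2 L(3,4) d(3) b s' by (auto simp: rep'_def)
        qed simp
        then show ?thesis using True by simp
      next
        case False
        then have "insert d (?\<delta> ` X) = ?\<delta> ` X" using bd by (simp add: insert_absorb)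
        then show ?thesis using rep2[of s1] False b s' by (auto intro!: runs_ret)
      qed
    next
      fix r s2 assume s2: "deg s2 = deg s \<and> rep' V n A X (?\<delta> ` X) (s2\<lparr>deg := ?\<delta>\<rparr>)"
      show "runs (set_deg u d') s2 1 (\<lambda>_ s'. rep V n A X s' \<and> deg s' = ?\<delta>)"
        by (rule runs_weaken[OF runs_set_deg]) (use s2 in auto)
    qed simp
  qed (use dn in simp_all)
  show ?thesis
    by (rule runs_bind[OF 1, where k' = 11])
       (auto intro!: runs_bind[OF 2, where k' = 6] 3)
qed

lemma runs_decr_degree:
  assumes R: "rep V n A X s" and u: "u \<in> X" "0 < deg s u"
  shows "runs (decr_degree u) s 22 (\<lambda>_ s'. rep V n A X s' \<and> deg s' = (deg s)(u := deg s u - 1))"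
proof -
  obtain d where d: "deg s u = Suc d" using u(2) by (cases "deg s u") auto
  have dn: "Suc d < n" using R u d by (auto simp: rep'_def)
  have dS: "Suc d \<in> deg s ` X" using d u by force
  have ins: "runs (if b then insert_after (Deg (Suc d)) (Deg d) else ret ()) s' 5
      (\<lambda>_ s2. rep' V n A X (insert d (deg s ` X)) s2 \<and> deg s2 = deg s)"
    if "rep V n A X s'" "deg s' = deg s" "b \<longleftrightarrow> d \<notin> deg s ` X" for b s'
  proof (cases b)
    case True
    then show ?thesis using runs_insert_Deg_below[OF that(1), of d] that(2,3) dS by simp
  next
    case False
    then have "insert d (deg s ` X) = deg s ` X" using that(3) by (simp add: insert_absorb)
    then show ?thesis using False that by (auto intro!: runs_ret)
  qed
  show ?thesis
    unfolding decr_degree_def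
    apply (rule runs_bind[OF runs_get_deg, where k' = 21])
     apply (elim conjE, simp only: d diff_Suc_1)
     apply (rule runs_bind[OF runs_is_empty_Bkt, where k' = 20])
        prefer 3
        apply (rule runs_bind[OF ins, where k' = 15])
           prefer 4
           apply (rule runs_weaken[OF runs_move_vertex])
    using R u d dn by auto
qed

lemma runs_incr_degree:
  assumes R: "rep V n A X s" and u: "u \<in> X" "Suc (deg s u) < n"
  shows "runs (incr_degree u) s 23 (\<lambda>_ s'. rep V n A X s' \<and> deg s' = (deg s)(u := deg s u + 1))"
proof -
  define d where d: "d = deg s u"
  have dS: "d \<in> deg s ` X" using d u by auto
  have ins: "runs (if b then do { p \<leftarrow> get_prv (Deg d); insert_after p (Deg (d + 1)) } else ret ()) s' 6
      (\<lambda>_ s2. rep' V n A X (insert (d + 1) (deg s ` X)) s2 \<and> deg s2 = deg s)"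
    if "rep V n A X s'" "deg s' = deg s" "b \<longleftrightarrow> d + 1 \<notin> deg s ` X" for b s'
  proof (cases b)
    case True
    then show ?thesis using runs_insert_Deg_above[OF that(1), of d] that(2,3) dS by simp
  next
    case False
    then have "insert (d + 1) (deg s ` X) = deg s ` X" using that(3) by (simp add: insert_absorb)
    then show ?thesis using False that by (auto intro!: runs_ret)
  qed
  show ?thesis
    unfolding incr_degree_def
    apply (rule runs_bind[OF runs_get_deg, where k' = 22])
     apply (elim conjE, simp only: d[symmetric])
     apply (rule runs_bind[OF runs_is_empty_Bkt, where k' = 21])
        prefer 3
        apply (rule runs_bind[OF ins, where k' = 15])
           prefer 4
           apply (rule runs_weaken[OF runs_move_vertex])
    using R u d by auto
qed

lemma runs_delete_isolated:
  assumes R: "rep V n A X s" and u: "u \<in> X" "deg s u = 0"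
  shows "runs (delete_isolated u) s 9 (\<lambda>_ s'. rep V n A (X - {u}) s' \<and> deg s' = deg s)"
proof -
  obtain L where L: "rings s (headers V n) L" "contents V n A X (deg s) (deg s ` X) L"
    "X \<subseteq> V" "\<And>u. u \<in> X \<Longrightarrow> deg s u < n" using R by (rule rep'E) blast
  define L1 where "L1 = L(Bkt 0 := remove1 (Vtx u) (L (Bkt 0)))"
  have n: "0 < n" using L(4)[OF u(1)] by simp
  have "runs (unlink (Vtx u)) s 4 (\<lambda>_ s'. rings s' (headers V n) L1 \<and> deg s' = deg s)"
    unfolding L1_def
    by (rule runs_unlink[OF L(1)]) (use n L(2) u in \<open>auto simp: contents_def\<close>)
  then have 1: "runs (unlink (Vtx u)) s 4
      (\<lambda>_ s'. rep' V n A (X - {u}) (insert 0 (deg s' ` (X - {u}))) s' \<and> deg s' = deg s)"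
  proof (rule runs_weaken)
    fix r s' assume s': "rings s' (headers V n) L1 \<and> deg s' = deg s"
    have "deg s ` X = insert 0 (deg s ` (X - {u}))" using u by force
    then have "contents V n A (X - {u}) (deg s) (insert 0 (deg s ` (X - {u}))) L1"
      using L(2) set_remove1_ring[OF L(1), of "Bkt 0" "Vtx u"] n u(2)
      by (auto simp: contents_def L1_def)
    then show "rep' V n A (X - {u}) (insert 0 (deg s' ` (X - {u}))) s' \<and> deg s' = deg s"
      using s' L(3,4) by (auto simp: rep'_def)
  qed simp
  show ?thesis
    unfolding delete_isolated_def
  proof (rule runs_bind[OF 1, where k' = 5]; (elim conjE)?)
    fix r s1 assume s1: "rep' V n A (X - {u}) (insert 0 (deg s1 ` (X - {u}))) s1" "deg s1 = deg s"
    show "runs (do { b \<leftarrow> is_empty (Bkt 0); (if b then unlink (Deg 0) else ret ()) }) s1 5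
      (\<lambda>_ s'. rep V n A (X - {u}) s' \<and> deg s' = deg s)"
    proof (rule runs_bind[OF runs_is_empty_Bkt[OF s1(1) n], where k' = 4]; (elim conjE)?)
      fix b s2 assume b: "b = (0 \<notin> deg s1 ` (X - {u}))" "s2 = s1\<lparr>cost := cost s1 + 1\<rparr>"
      have s2: "rep' V n A (X - {u}) (insert 0 (deg s ` (X - {u}))) s2" "deg s2 = deg s"
        using s1 b by auto
      show "runs (if b then unlink (Deg 0) else ret ()) s2 4
        (\<lambda>_ s'. rep V n A (X - {u}) s' \<and> deg s' = deg s)"
      proof (cases b)
        case True
        have "runs (unlink (Deg 0)) s2 4 (\<lambda>_ s'. rep' V n A (X - {u}) (insert 0 (deg s ` (X - {u})) - {0}) s' \<and> deg s' = deg s2)"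
          by (rule runs_unlink_Deg[OF s2(1)]) simp
        moreover have "insert 0 (deg s ` (X - {u})) - {0} = deg s ` (X - {u})"
          using True b(1) s1(2) by auto
        ultimately show ?thesis using True s2(2) by (auto intro: runs_weaken)
      next
        case False
        then have "insert 0 (deg s ` (X - {u})) = deg s ` (X - {u})"
          using b(1) s1(2) by (simp add: insert_absorb)
        then show ?thesis using False s2 by (auto intro!: runs_ret)
      qed
    qed simp
  qed simp
qed

lemma runs_insert_isolated:
  assumes R: "rep V n A X s" and u: "u \<in> V - X" "deg s u = 0" and n: "0 < n"
  shows "runs (insert_isolated u) s 12 (\<lambda>_ s'. rep V n A (insert u X) s' \<and> deg s' = deg s)"
proof -
  have ins: "runs (if b then do { p \<leftarrow> get_prv Top; insert_after p (Deg 0) } else ret ()) s' 6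
      (\<lambda>_ s2. rep' V n A X (insert 0 (deg s ` X)) s2 \<and> deg s2 = deg s)"
    if "rep V n A X s'" "deg s' = deg s" "b \<longleftrightarrow> 0 \<notin> deg s ` X" for b s'
  proof (cases b)
    case True
    then show ?thesis using runs_insert_Deg_0[OF that(1)] that(2,3) by simp
  next
    case False
    then have "insert 0 (deg s ` X) = deg s ` X" using that(3) by (simp add: insert_absorb)
    then show ?thesis using False that by (auto intro!: runs_ret)
  qed
  have vtx: "runs (insert_after (Bkt 0) (Vtx u)) s' 5
      (\<lambda>_ s2. rep V n A (insert u X) s2 \<and> deg s2 = deg s)"
    if s': "rep' V n A X (insert 0 (deg s ` X)) s'" "deg s' = deg s" for s'
  proof -
    obtain L where L: "rings s' (headers V n) L" "contents V n A X (deg s') (insert 0 (deg s ` X)) L"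
      "X \<subseteq> V" "\<And>u. u \<in> X \<Longrightarrow> deg s' u < n" using s'(1) by (rule rep'E) blast
    let ?L = "L(Bkt 0 := Vtx u # L (Bkt 0))"
    have "runs (insert_after (Bkt 0) (Vtx u)) s' 5
      (\<lambda>_ s2. rings s2 (headers V n) ?L \<and> deg s2 = deg s')"
    proof (rule runs_insert_after[OF L(1), where xs = "[]"])
      show "Vtx u \<notin> set (k # L k)" if "k \<in> headers V n" for k
        using contents_fresh(2)[OF L(2) that] u by blast
    qed (use n in auto)
    then show ?thesis
    proof (rule runs_weaken)
      fix r s2 assume s2: "rings s2 (headers V n) ?L \<and> deg s2 = deg s'"
      have "contents V n A (insert u X) (deg s) (deg s ` insert u X) ?L"
        using L(2) u n s'(2) by (auto simp: contents_def)
      then show "rep V n A (insert u X) s2 \<and> deg s2 = deg s"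
        using s2 s'(2) L(3,4) u n by (auto simp: rep'_def)
    qed simp
  qed
  show ?thesis
    unfolding insert_isolated_def
    apply (rule runs_bind[OF runs_is_empty_Bkt[OF R n], where k' = 11])
     apply (rule runs_bind[OF ins, where k' = 5])
        prefer 4
        apply (rule runs_weaken[OF vtx])
    using R by auto
qed

text \<open>The listed degrees are exactly those that occur, so the first cell of \<open>Top\<close>
  is the maximum and its bucket is nonempty. A maximum of 0 means that there are no edges.\<close>

lemma runs_max_vertex:
  assumes R: "rep V n A X s"
  shows "runs max_vertex s 2 (\<lambda>r s'. rep V n A X s' \<and> deg s' = deg s \<and>
    (case r of None \<Rightarrow> \<forall>u\<in>X. deg s u = 0
     | Some v \<Rightarrow> v \<in> X \<and> 0 < deg s v \<and> (\<forall>u\<in>X. deg s u \<le> deg s v)))"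
proof -
  obtain L where L: "rings s (headers V n) L" "contents V n A X (deg s) (deg s ` X) L"
    "X \<subseteq> V" "\<And>u. u \<in> X \<Longrightarrow> deg s u < n" using R by (rule rep'E) blast
  have rT: "nxt s Top = hd (L Top @ [Top])"
    by (rule ring_first) (use L(1) in \<open>simp add: rings_def\<close>)
  have T: "set (L Top) = Deg ` deg s ` X" "sorted_wrt (>) (map dg (L Top))"
    using L(2) by (simp_all add: contents_def)
  show ?thesis
  proof (cases "L Top")
    case Nil
    then have "X = {}" using T by auto
    then show ?thesis using R rT Nil
      by (simp add: runs_def max_vertex_def bind_prog_def get_nxt_def step_def ret_def)
  next
    case (Cons c cs)
    then have "c \<in> Deg ` deg s ` X" using T(1) by (metis list.set_intros(1))
    then obtain d where c: "c = Deg d" "d \<in> deg s ` X" by auto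
    have max: "deg s u \<le> d" if "u \<in> X" for u
    proof -
      have "Deg (deg s u) \<in> set (L Top)" using T that by auto
      then show ?thesis using T(2) Cons c by force
    qed
    have nx: "nxt s Top = Deg d" using rT Cons c by simp
    show ?thesis
    proof (cases "d = 0")
      case True
      then show ?thesis using R nx max
        by (simp add: runs_def max_vertex_def bind_prog_def get_nxt_def step_def ret_def)
    next
      case False
      have dn: "d < n" using c L(4) by auto
      have "set (L (Bkt d)) = Vtx ` {u \<in> X. deg s u = d}" using L(2) dn by (simp add: contents_def)
      moreover from this obtain w ws where w: "L (Bkt d) = w # ws" using c by (cases "L (Bkt d)") auto
      ultimately obtain v where v: "w = Vtx v" "v \<in> X" "deg s v = d"
        by (metis (mono_tags, lifting) imageE list.set_intros(1) mem_Collect_eq)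
      have "nxt s (Bkt d) = hd (L (Bkt d) @ [Bkt d])"
        by (rule ring_first) (use L(1) dn in \<open>simp add: rings_def\<close>)
      then have "nxt s (Bkt d) = Vtx v" using w v by simp
      then show ?thesis using R nx max v False
        by (simp add: runs_def max_vertex_def bind_prog_def get_nxt_def step_def ret_def)
    qed
  qed
qed

section \<open>Modifications of the graph\<close>

text \<open>Deleted vertices of \<open>V\<close> keep a correct degree field, namely 0, which their
  reinsertion relies on. The bound on \<open>card V\<close> ensures that a bucket exists for every
  possible degree.\<close>

definition stores :: "'a set \<Rightarrow> nat \<Rightarrow> 'a graph \<Rightarrow> 'a mem \<Rightarrow> bool" where
  "stores V n H s \<longleftrightarrow> rep V n (nbrs H) (verts H) s \<and> (\<forall>u\<in>V. deg s u = degree H u) \<and>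
     simple_graph H \<and> finite V \<and> card V \<le> n"

lemma stores_simple: "stores V n H s \<Longrightarrow> simple_graph H"
  by (simp add: stores_def)

lemma stores_verts: "stores V n H s \<Longrightarrow> verts H \<subseteq> V"
  by (simp add: stores_def rep'_def)

lemma rep'_cur [simp]: "rep' V n A X S (s\<lparr>cur := k\<rparr>) = rep' V n A X S s"
  using rings_cong[of "s\<lparr>cur := k\<rparr>" s] by (simp add: rep'_def)

lemma rep'_out [simp]: "rep' V n A X S (s\<lparr>out := k\<rparr>) = rep' V n A X S s"
  using rings_cong[of "s\<lparr>out := k\<rparr>" s] by (simp add: rep'_def)

lemma stores_simps [simp]:
  "stores V n H (s\<lparr>cost := k\<rparr>) = stores V n H s"
  "stores V n H (s\<lparr>cur := c\<rparr>) = stores V n H s"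
  "stores V n H (s\<lparr>out := os\<rparr>) = stores V n H s"
  by (simp_all add: stores_def)

lemma nbrs_del_edge:
  assumes "simple_graph H" "{u, w} \<in> edges H"
  shows "nbrs (del_edges H {{u, w}}) = (nbrs H)(u := nbrs H u - {w}, w := nbrs H w - {u})"
  using simple_edgeD(1)[OF assms] by (auto simp: fun_eq_iff nbrs_def del_edges_def doubleton_eq_iff)

lemma degree_del_edge:
  assumes "simple_graph H" "{u, w} \<in> edges H"
  shows "degree (del_edges H {{u, w}}) = (degree H)(u := degree H u - 1, w := degree H w - 1)"
proof
  fix x
  have "w \<in> nbrs H u" "u \<in> nbrs H w" using assms(2) by (auto simp: nbrs_def insert_commute)
  then show "degree (del_edges H {{u, w}}) x = ((degree H)(u := degree H u - 1, w := degree H w - 1)) x"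
    using assms by (simp add: degree_eq_card_nbrs simple_del_edges nbrs_del_edge finite_nbrs)
qed

lemma degree_pos: "simple_graph H \<Longrightarrow> {u, w} \<in> edges H \<Longrightarrow> 0 < degree H u"
  using finite_nbrs[of H u] by (auto simp: degree_eq_card_nbrs card_gt_0_iff nbrs_def)

text \<open>Between the single steps the adjacency is asymmetric or the degrees lag behind, so no
  graph is stored. The proof passes through \<open>rep'\<close> with arbitrary neighbour sets and
  returns to \<open>stores\<close> at the end.\<close>

lemma runs_delete_edge:
  assumes st: "stores V n H s" and e: "{u, w} \<in> edges H"
  shows "runs (delete_edge u w) s 52 (\<lambda>_ s'. stores V n (del_edges H {{u, w}}) s')"
proof -
  have H: "simple_graph H" using st by (rule stores_simple)
  note ed = simple_edgeD[OF H e]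
  have uw: "u \<in> V" "w \<in> V" using ed stores_verts[OF st] by auto
  have nb: "w \<in> nbrs H u" "u \<in> nbrs H w" using e by (auto simp: nbrs_def insert_commute)
  have R: "rep V n (nbrs H) (verts H) s" "\<And>x. x \<in> V \<Longrightarrow> deg s x = degree H x"
    using st by (auto simp: stores_def)
  have pos: "0 < degree H u" "0 < degree H w"
    using degree_pos[OF H e] degree_pos[of H w u] H e by (auto simp: insert_commute)
  show ?thesis
    unfolding delete_edge_def
  proof (rule runs_bind[OF runs_unlink_Arc[OF R(1) uw(1) nb(1)], where k' = 48]; (elim conjE)?)
    fix r1 s1
    assume s1: "rep' V n ((nbrs H)(u := nbrs H u - {w})) (verts H) (deg s ` verts H) s1" "deg s1 = deg s"
    show "runs (do { unlink (Arc w u); decr_degree u; decr_degree w }) s1 48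
      (\<lambda>_ s'. stores V n (del_edges H {{u, w}}) s')"
    proof (rule runs_bind[OF runs_unlink_Arc[OF s1(1) uw(2), of u], where k' = 44]; (elim conjE)?)
      fix r2 s2
      assume "rep' V n ((nbrs H)(u := nbrs H u - {w}, w := ((nbrs H)(u := nbrs H u - {w})) w - {u}))
        (verts H) (deg s ` verts H) s2" "deg s2 = deg s1"
      then have s2: "rep V n (nbrs (del_edges H {{u, w}})) (verts H) s2" "deg s2 = deg s"
        using s1 ed by (simp_all add: nbrs_del_edge[OF H e])
      show "runs (do { decr_degree u; decr_degree w }) s2 44 (\<lambda>_ s'. stores V n (del_edges H {{u, w}}) s')"
      proof (rule runs_bind[OF runs_decr_degree[OF s2(1) ed(2)], where k' = 22]; (elim conjE)?)
        show "0 < deg s2 u" using s2 R uw pos by simp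
        fix r3 s3
        assume s3: "rep V n (nbrs (del_edges H {{u, w}})) (verts H) s3" "deg s3 = (deg s2)(u := deg s2 u - 1)"
        show "runs (decr_degree w) s3 22 (\<lambda>_ s'. stores V n (del_edges H {{u, w}}) s')"
        proof (rule runs_weaken[OF runs_decr_degree[OF s3(1) ed(3)]]; (elim conjE)?)
          show "0 < deg s3 w" using s3 s2 R uw pos ed by simp
          fix r4 s4
          assume s4: "rep V n (nbrs (del_edges H {{u, w}})) (verts H) s4" "deg s4 = (deg s3)(w := deg s3 w - 1)"
          show "stores V n (del_edges H {{u, w}}) s4"
            using s4 s3 s2 R(2) uw ed(1) st H
            by (simp add: stores_def simple_del_edges degree_del_edge[OF H e])
               (simp add: del_edges_def)
        qed simp
      qed simp
    qed (use nb ed in auto)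
  qed simp
qed

lemma runs_insert_edge:
  assumes st: "stores V n (del_edges H {{u, w}}) s" and e: "{u, w} \<in> edges H" and H: "simple_graph H"
  shows "runs (insert_edge u w) s 56 (\<lambda>_ s'. stores V n H s')"
proof -
  let ?H = "del_edges H {{u, w}}"
  have vs: "verts ?H = verts H" by (simp add: del_edges_def)
  note ed = simple_edgeD[OF H e]
  have uw: "u \<in> V" "w \<in> V" using ed stores_verts[OF st] vs by auto
  have nb: "w \<in> nbrs H u" "u \<in> nbrs H w" using e by (auto simp: nbrs_def insert_commute)
  have R: "rep V n (nbrs ?H) (verts H) s" "\<And>x. x \<in> V \<Longrightarrow> deg s x = degree ?H x"
    using st vs by (auto simp: stores_def)
  have pos: "0 < degree H u" "0 < degree H w"
    using degree_pos[OF H e] degree_pos[of H w u] H e by (auto simp: insert_commute)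
  \<comment> \<open>A vertex is not its own neighbour, so its degree is less than the number of
    vertices and the target bucket exists.\<close>
  have dH: "degree H x < n" if "x \<in> verts H" for x
  proof -
    have "card (nbrs H x) < card (verts H)"
      using nbrs_subset[OF H, of x] that
      by (intro psubset_card_mono) (auto simp: simple_finite_verts[OF H])
    also have "\<dots> \<le> card V" using st stores_verts[OF st] vs by (simp add: stores_def card_mono)
    finally show ?thesis using st by (simp add: degree_eq_card_nbrs[OF H] stores_def)
  qed
  have nn: "w \<notin> nbrs ?H u" "u \<notin> ((nbrs ?H)(u := insert w (nbrs ?H u))) w"
    using ed by (simp_all add: nbrs_del_edge[OF H e])
  have restored: "(nbrs ?H)(u := insert w (nbrs ?H u), w := insert u (((nbrs ?H)(u := insert w (nbrs ?H u))) w)) = nbrs H"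
    using nb ed by (simp add: nbrs_del_edge[OF H e] insert_absorb)
  show ?thesis
    unfolding insert_edge_def
  proof (rule runs_bind[OF runs_insert_Arc[OF R(1) uw(1) nn(1)], where k' = 51]; (elim conjE)?)
    fix r1 s1
    assume s1: "rep' V n ((nbrs ?H)(u := insert w (nbrs ?H u))) (verts H) (deg s ` verts H) s1" "deg s1 = deg s"
    show "runs (do { insert_after (Adj w) (Arc w u); incr_degree u; incr_degree w }) s1 51
      (\<lambda>_ s'. stores V n H s')"
    proof (rule runs_bind[OF runs_insert_Arc[OF s1(1) uw(2) nn(2)], where k' = 46]; (elim conjE)?)
      fix r2 s2
      assume "rep' V n ((nbrs ?H)(u := insert w (nbrs ?H u), w := insert u (((nbrs ?H)(u := insert w (nbrs ?H u))) w)))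
        (verts H) (deg s ` verts H) s2" "deg s2 = deg s1"
      then have s2: "rep V n (nbrs H) (verts H) s2" "deg s2 = deg s"
        unfolding restored using s1 by simp_all
      show "runs (do { incr_degree u; incr_degree w }) s2 46 (\<lambda>_ s'. stores V n H s')"
      proof (rule runs_bind[OF runs_incr_degree[OF s2(1) ed(2)], where k' = 23]; (elim conjE)?)
        show "Suc (deg s2 u) < n" using s2 R uw pos ed dH[OF ed(2)] by (simp add: degree_del_edge[OF H e])
        fix r3 s3
        assume s3: "rep V n (nbrs H) (verts H) s3" "deg s3 = (deg s2)(u := deg s2 u + 1)"
        show "runs (incr_degree w) s3 23 (\<lambda>_ s'. stores V n H s')"
        proof (rule runs_weaken[OF runs_incr_degree[OF s3(1) ed(3)]]; (elim conjE)?)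
          show "Suc (deg s3 w) < n"
            using s3 s2 R uw pos ed dH[OF ed(3)] by (simp add: degree_del_edge[OF H e])
          fix r4 s4
          assume s4: "rep V n (nbrs H) (verts H) s4" "deg s4 = (deg s3)(w := deg s3 w + 1)"
          have "deg s4 x = degree H x" if "x \<in> V" for x
            using that s4 s3 s2 R(2) uw ed(1) pos by (simp add: degree_del_edge[OF H e])
          then show "stores V n H s4" using s4 st H by (simp add: stores_def)
        qed simp
      qed simp
    qed simp
  qed simp
qed

section \<open>Deleting and restoring all edges at a vertex\<close>

lemma del_edges_empty [simp]: "del_edges H {} = H"
  by (simp add: del_edges_def)

lemma del_edges_Un: "del_edges (del_edges H F) F' = del_edges H (F \<union> F')"
  by (auto simp: del_edges_def)

lemma runs_delete_edges:
  assumes "stores V n H s" "distinct ws" "set ws \<subseteq> nbrs H u"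
  shows "runs (for_each ws (\<lambda>w. delete_edge u w)) s (53 * length ws + 1)
    (\<lambda>_ s'. stores V n (del_edges H ((\<lambda>w. {u, w}) ` set ws)) s')"
  using assms
proof (induction ws arbitrary: H s)
  case Nil
  then show ?case by (simp add: runs_weaken[OF runs_tick])
next
  case (Cons w ws)
  have e: "{u, w} \<in> edges H" using Cons.prems by (simp add: nbrs_def)
  have sub: "set ws \<subseteq> nbrs (del_edges H {{u, w}}) u"
  proof
    fix x assume "x \<in> set ws"
    then have "x \<noteq> w" "{u, x} \<in> edges H" using Cons.prems by (auto simp: nbrs_def)
    then show "x \<in> nbrs (del_edges H {{u, w}}) u"
      by (simp add: nbrs_def del_edges_def doubleton_eq_iff)
  qed
  have eq: "del_edges (del_edges H {{u, w}}) ((\<lambda>w. {u, w}) ` set ws) = del_edges H ((\<lambda>w. {u, w}) ` set (w # ws))"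
    by (simp add: del_edges_Un)
  show ?case
    unfolding for_each.simps
  proof (rule runs_bind[OF runs_tick, where k' = "53 * length ws + 53"])
    fix r s1 assume "s1 = s\<lparr>cost := cost s + 1\<rparr>"
    then have "stores V n H s1" using Cons.prems by simp
    then show "runs (do { delete_edge u w; for_each ws (\<lambda>w. delete_edge u w) }) s1 (53 * length ws + 53)
      (\<lambda>_ s'. stores V n (del_edges H ((\<lambda>w. {u, w}) ` set (w # ws))) s')"
    proof (rule runs_bind[OF runs_delete_edge[OF _ e]])
      fix r s2 assume "stores V n (del_edges H {{u, w}}) s2"
      then show "runs (for_each ws (\<lambda>w. delete_edge u w)) s2 (53 * length ws + 1)
        (\<lambda>_ s'. stores V n (del_edges H ((\<lambda>w. {u, w}) ` set (w # ws))) s')"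
        unfolding eq[symmetric] using Cons.prems(2) sub by (intro Cons.IH) simp_all
    qed simp
  qed simp
qed

lemma runs_insert_edges:
  assumes "stores V n (del_edges H ((\<lambda>w. {u, w}) ` set ws)) s" "simple_graph H"
    "distinct ws" "set ws \<subseteq> nbrs H u"
  shows "runs (for_each ws (\<lambda>w. insert_edge u w)) s (57 * length ws + 1) (\<lambda>_ s'. stores V n H s')"
  using assms
proof (induction ws arbitrary: s)
  case Nil
  then show ?case by (simp add: runs_weaken[OF runs_tick])
next
  case (Cons w ws)
  let ?H = "del_edges H ((\<lambda>w. {u, w}) ` set ws)"
  have e: "{u, w} \<in> edges ?H"
  proof -
    have "{u, w} \<noteq> {u, x}" if "x \<in> set ws" for x
      using that Cons.prems(3) by (auto simp: doubleton_eq_iff)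
    then have "{u, w} \<notin> (\<lambda>w. {u, w}) ` set ws" by blast
    moreover have "{u, w} \<in> edges H" using Cons.prems(4) by (simp add: nbrs_def)
    ultimately show ?thesis by (simp add: del_edges_def)
  qed
  have H: "simple_graph ?H" using Cons.prems by (simp add: simple_del_edges)
  have eq: "del_edges H ((\<lambda>w. {u, w}) ` set (w # ws)) = del_edges ?H {{u, w}}"
    by (simp add: del_edges_Un)
  show ?case
    unfolding for_each.simps
  proof (rule runs_bind[OF runs_tick, where k' = "57 * length ws + 57"])
    fix r s1 assume "s1 = s\<lparr>cost := cost s + 1\<rparr>"
    then have "stores V n (del_edges ?H {{u, w}}) s1" using Cons.prems(1) unfolding eq by simp
    then show "runs (do { insert_edge u w; for_each ws (\<lambda>w. insert_edge u w) }) s1 (57 * length ws + 57)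
      (\<lambda>_ s'. stores V n H s')"
    proof (rule runs_bind[OF runs_insert_edge[OF _ e H]])
      fix r s2 assume "stores V n ?H s2"
      then show "runs (for_each ws (\<lambda>w. insert_edge u w)) s2 (57 * length ws + 1)
        (\<lambda>_ s'. stores V n H s')"
        using Cons.prems by (intro Cons.IH) simp_all
    qed simp
  qed simp
qed

text \<open>A log entry is specified by the graphs before and after the deletion; undoing it reads
  the same relation backwards. The order of the logged neighbours is left open.\<close>

definition isolates :: "'a graph \<Rightarrow> 'a \<times> 'a list \<Rightarrow> 'a graph \<Rightarrow> bool" where
  "isolates H l H' \<longleftrightarrow> simple_graph H \<and> distinct (snd l) \<and> set (snd l) = nbrs H (fst l) \<and>
     H' = del_edges H (incident_edges H (fst l))"

definition removes :: "'a graph \<Rightarrow> 'a \<times> 'a list \<Rightarrow> 'a graph \<Rightarrow> bool" where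
  "removes H l H' \<longleftrightarrow> simple_graph H \<and> distinct (snd l) \<and> set (snd l) = nbrs H (fst l) \<and>
     fst l \<in> verts H \<and> H' = del_verts H {fst l}"

lemma length_isolates: "isolates H l H' \<Longrightarrow> length (snd l) = degree H (fst l)"
  by (metis degree_eq_card_nbrs distinct_card isolates_def)

lemma runs_delete_incident:
  assumes st: "stores V n H s" and u: "u \<in> V"
  shows "runs (delete_incident u) s (54 * degree H u + 2)
    (\<lambda>l s'. fst l = u \<and> (\<exists>H'. isolates H l H' \<and> stores V n H' s'))"
proof -
  have H: "simple_graph H" using st by (rule stores_simple)
  have R: "rep V n (nbrs H) (verts H) s" using st by (simp add: stores_def)
  obtain L where L: "rings s (headers V n) L" "contents V n (nbrs H) (verts H) (deg s) (deg s ` verts H) L"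
    using R by (rule rep'E) blast
  let ?ws = "map target (L (Adj u))"
  have cs: "set (L (Adj u)) = Arc u ` nbrs H u" using L(2) u by (simp add: contents_def)
  have "distinct (L (Adj u))" using L(1) u by (simp add: ring_distinct)
  then have ws: "distinct ?ws" "set ?ws = nbrs H u"
    using cs by (auto simp: distinct_map inj_on_def image_image)
  have len: "length (L (Adj u)) = degree H u"
    using distinct_card[OF ws(1)] ws(2) by (simp add: degree_eq_card_nbrs[OF H])
  show ?thesis
    unfolding delete_incident_def
  proof (rule runs_bind[OF runs_neighbours[OF L(1)], where k' = "53 * degree H u + 1"]; (elim conjE)?)
    fix xs s1
    assume xs: "xs = ?ws" "s1 = s\<lparr>cost := cost s + Suc (length (L (Adj u)))\<rparr>"
    have "runs (for_each ?ws (\<lambda>w. delete_edge u w)) s1 (53 * length ?ws + 1)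
      (\<lambda>_ s'. stores V n (del_edges H ((\<lambda>w. {u, w}) ` set ?ws)) s')"
      by (rule runs_delete_edges) (use xs st ws in simp_all)
    then show "runs (do { for_each xs (\<lambda>w. delete_edge u w); ret (u, xs) }) s1 (53 * degree H u + 1)
      (\<lambda>l s'. fst l = u \<and> (\<exists>H'. isolates H l H' \<and> stores V n H' s'))"
      unfolding xs
      by (rule runs_bind[where k' = 0])
         (use ws H len in \<open>auto intro!: runs_ret simp: isolates_def incident_edges_eq\<close>)
  qed (use u len in simp_all)
qed

lemma runs_undo_delete_incident:
  assumes "isolates H l H'" "stores V n H' s"
  shows "runs (undo_delete_incident l) s (57 * length (snd l) + 1) (\<lambda>_ s'. stores V n H s')"
  unfolding undo_delete_incident_def
  by (rule runs_insert_edges) (use assms in \<open>simp_all add: isolates_def incident_edges_eq\<close>)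

lemma del_vert_eq:
  assumes "simple_graph H"
  shows "nbrs (del_verts H {u}) = nbrs (del_edges H (incident_edges H u))"
    "degree (del_verts H {u}) = degree (del_edges H (incident_edges H u))"
proof -
  have "edges (del_verts H {u}) = edges (del_edges H (incident_edges H u))"
    by (auto simp: del_verts_def del_edges_def incident_edges_def)
  then show "nbrs (del_verts H {u}) = nbrs (del_edges H (incident_edges H u))"
    "degree (del_verts H {u}) = degree (del_edges H (incident_edges H u))"
    by (simp_all add: fun_eq_iff nbrs_def degree_def incident_edges_def)
qed

lemma degree_isolated: "degree (del_edges H (incident_edges H u)) u = 0"
proof -
  have "incident_edges (del_edges H (incident_edges H u)) u = {}"
    by (auto simp: incident_edges_def del_edges_def)
  then show ?thesis by (simp add: degree_def)
qed

lemma runs_delete_vertex: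
  assumes st: "stores V n H s" and u: "u \<in> verts H"
  shows "runs (delete_vertex u) s (54 * degree H u + 11)
    (\<lambda>l s'. fst l = u \<and> (\<exists>H'. removes H l H' \<and> stores V n H' s'))"
proof -
  have H: "simple_graph H" using st by (rule stores_simple)
  have uV: "u \<in> V" using u stores_verts[OF st] by auto
  let ?H = "del_edges H (incident_edges H u)"
  show ?thesis
    unfolding delete_vertex_def
  proof (rule runs_bind[OF runs_delete_incident[OF st uV], where k' = 9]; (elim conjE exE)?)
    fix l s1 H' assume l: "fst l = u" "isolates H l H'" and s1: "stores V n H' s1"
    then have H': "H' = ?H" by (simp add: isolates_def)
    have vs: "verts ?H = verts H" by (simp add: del_edges_def)
    have "rep V n (nbrs ?H) (verts H) s1" "deg s1 u = 0"
      using s1 uV unfolding H' by (simp_all add: stores_def vs degree_isolated)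
    note del = runs_delete_isolated[OF this(1) u this(2)]
    show "runs (do { delete_isolated u; ret l }) s1 9
      (\<lambda>l s'. fst l = u \<and> (\<exists>H'. removes H l H' \<and> stores V n H' s'))"
    proof (rule runs_bind[OF del, where k' = 0]; (elim conjE)?)
      fix r s2 assume s2: "rep V n (nbrs ?H) (verts H - {u}) s2" "deg s2 = deg s1"
      have "stores V n (del_verts H {u}) s2"
        using s1 s2 simple_del_verts[OF H, of "{u}"] unfolding H' stores_def del_vert_eq[OF H]
        by (simp add: del_verts_def)
      moreover have "removes H l (del_verts H {u})" using l u by (simp add: removes_def isolates_def)
      ultimately show "runs (ret l) s2 0 (\<lambda>l s'. fst l = u \<and> (\<exists>H'. removes H l H' \<and> stores V n H' s'))"
        using l by (auto intro!: runs_ret)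
    qed simp
  qed simp
qed

lemma runs_undo_delete_vertex:
  assumes l: "removes H l H'" and st: "stores V n H' s" and V: "fst l \<in> V"
  shows "runs (undo_delete_vertex l) s (57 * length (snd l) + 13) (\<lambda>_ s'. stores V n H s')"
proof -
  let ?u = "fst l" let ?H = "del_edges H (incident_edges H ?u)"
  have H: "simple_graph H" and u: "?u \<in> verts H" and H': "H' = del_verts H {?u}"
    using l by (simp_all add: removes_def)
  have R: "rep V n (nbrs ?H) (verts H - {?u}) s" "\<And>x. x \<in> V \<Longrightarrow> deg s x = degree ?H x"
    using st unfolding H' stores_def del_vert_eq[OF H] by (simp_all add: del_verts_def)
  have n: "0 < n" using st V by (auto simp: stores_def card_gt_0_iff intro: gr_zeroI)
  have u': "?u \<in> V - (verts H - {?u})" "deg s ?u = 0" using V R(2)[OF V] by (simp_all add: degree_isolated)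
  have iso: "isolates H l ?H" using l by (simp add: removes_def isolates_def)
  show ?thesis
    unfolding undo_delete_vertex_def
  proof (rule runs_bind[OF runs_insert_isolated[OF R(1) u' n], where k' = "57 * length (snd l) + 1"]; (elim conjE)?)
    fix r s1 assume s1: "rep V n (nbrs ?H) (insert ?u (verts H - {?u})) s1" "deg s1 = deg s"
    have "insert ?u (verts H - {?u}) = verts ?H" using u by (auto simp: del_edges_def)
    then have "stores V n ?H s1"
      using s1 st R(2) by (simp add: stores_def simple_del_edges H)
    then show "runs (undo_delete_incident l) s1 (57 * length (snd l) + 1) (\<lambda>_ s'. stores V n H s')"
      by (rule runs_undo_delete_incident[OF iso])
  qed simp
qed

section \<open>Sequences of logged deletions\<close>

primrec path :: "('g \<Rightarrow> 'l \<Rightarrow> 'g \<Rightarrow> bool) \<Rightarrow> 'g \<Rightarrow> 'l list \<Rightarrow> 'g \<Rightarrow> bool" where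
  "path R H [] H' \<longleftrightarrow> H = H'"
| "path R H (l # ls) H' \<longleftrightarrow> (\<exists>H1. R H l H1 \<and> path R H1 ls H')"

lemma path_append: "path R H (ls @ ls') H' \<longleftrightarrow> (\<exists>H1. path R H ls H1 \<and> path R H1 ls' H')"
  by (induction ls arbitrary: H) auto

text \<open>Last in, first out: the undo loop starts with the last log entry, hence the induction
  from the right.\<close>

lemma runs_undo_path:
  assumes f: "\<And>H l H' s. R H l H' \<Longrightarrow> l \<in> set ls \<Longrightarrow> stores V n H' s \<Longrightarrow> runs (f l) s (k l) (\<lambda>_ s'. stores V n H s')"
    and "path R H ls H'" "stores V n H' s"
  shows "runs (for_each (rev ls) f) s ((\<Sum>l\<leftarrow>ls. k l + 1) + 1) (\<lambda>_ s'. stores V n H s')"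
  using assms
proof (induction ls arbitrary: H' s rule: rev_induct)
  case Nil
  then show ?case using runs_tick[of s] by (auto intro: runs_weaken)
next
  case (snoc l ls)
  let ?k = "(\<Sum>l\<leftarrow>ls. k l + 1) + 1"
  obtain H1 where H1: "path R H ls H1" "R H1 l H'" using snoc.prems(2) by (auto simp: path_append)
  have IH: "runs (for_each (rev ls) f) s2 ?k (\<lambda>_ s'. stores V n H s')" if "stores V n H1 s2" for s2
    using snoc.IH[OF _ H1(1) that] snoc.prems(1) by simp
  have "rev (ls @ [l]) = l # rev ls" by simp
  then show ?case
    unfolding for_each.simps
  proof (simp only: for_each.simps, intro runs_bind[OF runs_tick, where k' = "k l + ?k"])
    fix r s1 assume "s1 = s\<lparr>cost := cost s + 1\<rparr>"
    then have "stores V n H' s1" using snoc.prems by simp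
    then have "runs (f l) s1 (k l) (\<lambda>_ s'. stores V n H1 s')"
      by (intro snoc.prems(1)[OF H1(2)]) simp_all
    then show "runs (do { f l; for_each (rev ls) f }) s1 (k l + ?k) (\<lambda>_ s'. stores V n H s')"
      by (rule runs_bind[OF _ IH]) simp_all
  qed simp
qed

text \<open>Degrees only decrease along the sequence, so the cost of every deletion can be measured
  in the initial graph \<open>H\<close>.\<close>

lemma runs_map_each_delete_incident:
  assumes "stores V n H s" "set xs \<subseteq> V"
  shows "runs (map_each xs delete_incident) s ((\<Sum>x\<leftarrow>xs. 54 * degree H x + 3) + 1)
    (\<lambda>ls s'. map fst ls = xs \<and> (\<exists>H'. path isolates H ls H' \<and> stores V n H' s'))"
  using assms
proof (induction xs arbitrary: H s)
  case Nil
  then show ?case by (auto intro!: runs_bind[OF runs_tick, where k' = 0] runs_ret)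
next
  case (Cons x xs)
  let ?k = "(\<Sum>x\<leftarrow>xs. 54 * degree H x + 3) + 1"
  show ?case
    unfolding map_each.simps
  proof (rule runs_bind[OF runs_tick, where k' = "54 * degree H x + 2 + ?k"])
    fix r s1 assume "s1 = s\<lparr>cost := cost s + 1\<rparr>"
    then have s1: "stores V n H s1" using Cons.prems by simp
    show "runs (do { y \<leftarrow> delete_incident x; ys \<leftarrow> map_each xs delete_incident; ret (y # ys) }) s1
      (54 * degree H x + 2 + ?k)
      (\<lambda>ls s'. map fst ls = x # xs \<and> (\<exists>H'. path isolates H ls H' \<and> stores V n H' s'))"
    proof (rule runs_bind[OF runs_delete_incident[OF s1]]; (elim conjE exE)?)
      show "x \<in> V" using Cons.prems by simp
      fix l s2 H1 assume l: "fst l = x" "isolates H l H1" and s2: "stores V n H1 s2"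
      have "degree H1 y \<le> degree H y" for y
        using l(2) by (intro degree_mono) (auto simp: isolates_def del_edges_def)
      then have k: "(\<Sum>x\<leftarrow>xs. 54 * degree H1 x + 3) + 1 \<le> ?k" by (simp add: sum_list_mono)
      have "runs (map_each xs delete_incident) s2 ((\<Sum>x\<leftarrow>xs. 54 * degree H1 x + 3) + 1)
        (\<lambda>ls s'. map fst ls = xs \<and> (\<exists>H'. path isolates H1 ls H' \<and> stores V n H' s'))"
        using Cons.IH[OF s2] Cons.prems by simp
      then show "runs (do { ys \<leftarrow> map_each xs delete_incident; ret (l # ys) }) s2 ?k
        (\<lambda>ls s'. map fst ls = x # xs \<and> (\<exists>H'. path isolates H ls H' \<and> stores V n H' s'))"
      proof (rule runs_bind[where k' = 0]; (elim conjE exE)?)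
        fix ls s3 H' assume "map fst ls = xs" "path isolates H1 ls H'" "stores V n H' s3"
        then have "map fst (l # ls) = x # xs \<and> (\<exists>H'. path isolates H (l # ls) H' \<and> stores V n H' s3)"
          using l by auto
        then show "runs (ret (l # ls)) s3 0
          (\<lambda>ls s'. map fst ls = x # xs \<and> (\<exists>H'. path isolates H ls H' \<and> stores V n H' s'))"
          by (rule runs_ret)
      qed (use k in simp)
    qed simp
  qed simp
qed

lemma runs_map_each_delete_vertex:
  assumes "stores V n H s" "set xs \<subseteq> verts H" "distinct xs"
  shows "runs (map_each xs delete_vertex) s ((\<Sum>x\<leftarrow>xs. 54 * degree H x + 12) + 1)
    (\<lambda>ls s'. map fst ls = xs \<and> (\<exists>H'. path removes H ls H' \<and> stores V n H' s'))"
  using assms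
proof (induction xs arbitrary: H s)
  case Nil
  then show ?case by (auto intro!: runs_bind[OF runs_tick, where k' = 0] runs_ret)
next
  case (Cons x xs)
  let ?k = "(\<Sum>x\<leftarrow>xs. 54 * degree H x + 12) + 1"
  show ?case
    unfolding map_each.simps
  proof (rule runs_bind[OF runs_tick, where k' = "54 * degree H x + 11 + ?k"])
    fix r s1 assume "s1 = s\<lparr>cost := cost s + 1\<rparr>"
    then have s1: "stores V n H s1" using Cons.prems by simp
    show "runs (do { y \<leftarrow> delete_vertex x; ys \<leftarrow> map_each xs delete_vertex; ret (y # ys) }) s1
      (54 * degree H x + 11 + ?k)
      (\<lambda>ls s'. map fst ls = x # xs \<and> (\<exists>H'. path removes H ls H' \<and> stores V n H' s'))"
    proof (rule runs_bind[OF runs_delete_vertex[OF s1]]; (elim conjE exE)?)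
      show "x \<in> verts H" using Cons.prems by simp
      fix l s2 H1 assume l: "fst l = x" "removes H l H1" and s2: "stores V n H1 s2"
      have "degree H1 y \<le> degree H y" for y
        using l(2) by (intro degree_mono) (auto simp: removes_def del_verts_def)
      then have k: "(\<Sum>x\<leftarrow>xs. 54 * degree H1 x + 12) + 1 \<le> ?k" by (simp add: sum_list_mono)
      have "set xs \<subseteq> verts H1" using Cons.prems l by (auto simp: removes_def del_verts_def)
      then have "runs (map_each xs delete_vertex) s2 ((\<Sum>x\<leftarrow>xs. 54 * degree H1 x + 12) + 1)
        (\<lambda>ls s'. map fst ls = xs \<and> (\<exists>H'. path removes H1 ls H' \<and> stores V n H' s'))"
        using Cons.IH[OF s2] Cons.prems by simp
      then show "runs (do { ys \<leftarrow> map_each xs delete_vertex; ret (l # ys) }) s2 ?k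
        (\<lambda>ls s'. map fst ls = x # xs \<and> (\<exists>H'. path removes H ls H' \<and> stores V n H' s'))"
      proof (rule runs_bind[where k' = 0]; (elim conjE exE)?)
        fix ls s3 H' assume "map fst ls = xs" "path removes H1 ls H'" "stores V n H' s3"
        then have "map fst (l # ls) = x # xs \<and> (\<exists>H'. path removes H (l # ls) H' \<and> stores V n H' s3)"
          using l by auto
        then show "runs (ret (l # ls)) s3 0
          (\<lambda>ls s'. map fst ls = x # xs \<and> (\<exists>H'. path removes H ls H' \<and> stores V n H' s'))"
          by (rule runs_ret)
      qed (use k in simp)
    qed simp
  qed simp
qed

lemma path_isolates:
  assumes "path isolates H ls H'"
  shows "verts H' = verts H" "edges H' = {f \<in> edges H. f \<inter> fst ` set ls = {}}"
    "\<And>l. l \<in> set ls \<Longrightarrow> length (snd l) \<le> degree H (fst l)"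
proof -
  have "verts H' = verts H \<and> edges H' = {f \<in> edges H. f \<inter> fst ` set ls = {}} \<and>
    (\<forall>l\<in>set ls. length (snd l) \<le> degree H (fst l))"
    using assms
  proof (induction ls arbitrary: H)
    case (Cons l ls)
    then obtain H1 where H1: "isolates H l H1" "path isolates H1 ls H'" by auto
    have "verts H1 = verts H" "edges H1 = {f \<in> edges H. fst l \<notin> f}"
      using H1(1) by (auto simp: isolates_def del_edges_def incident_edges_def)
    moreover have "degree H1 x \<le> degree H x" for x
      using H1(1) by (intro degree_mono) (auto simp: isolates_def del_edges_def)
    ultimately show ?case using Cons.IH[OF H1(2)] length_isolates[OF H1(1)] by (force intro: order_trans)
  qed simp
  then show "verts H' = verts H" "edges H' = {f \<in> edges H. f \<inter> fst ` set ls = {}}"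
    "\<And>l. l \<in> set ls \<Longrightarrow> length (snd l) \<le> degree H (fst l)" by auto
qed

text \<open>Which neighbours inside the deleted set are logged depends on the order of deletion. The
  log is therefore only enclosed between all neighbours and those outside the deleted set.\<close>

lemma path_removes:
  assumes "path removes H ls H'" "distinct (map fst ls)"
  shows "H' = del_verts H (fst ` set ls)"
    "\<And>l. l \<in> set ls \<Longrightarrow> distinct (snd l) \<and> set (snd l) \<subseteq> nbrs H (fst l) \<and>
       nbrs H (fst l) - fst ` set ls \<subseteq> set (snd l)"
proof -
  have "H' = del_verts H (fst ` set ls) \<and> (\<forall>l\<in>set ls. distinct (snd l) \<and>
    set (snd l) \<subseteq> nbrs H (fst l) \<and> nbrs H (fst l) - fst ` set ls \<subseteq> set (snd l))"
    using assms
  proof (induction ls arbitrary: H)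
    case Nil
    then show ?case by (simp add: del_verts_def)
  next
    case (Cons l ls)
    then obtain H1 where H1: "removes H l H1" "path removes H1 ls H'" by auto
    have IH: "H' = del_verts H1 (fst ` set ls) \<and> (\<forall>l\<in>set ls. distinct (snd l) \<and>
      set (snd l) \<subseteq> nbrs H1 (fst l) \<and> nbrs H1 (fst l) - fst ` set ls \<subseteq> set (snd l))"
      using Cons.IH[OF H1(2)] Cons.prems(2) by simp
    have H1': "H1 = del_verts H {fst l}" using H1(1) by (simp add: removes_def)
    have nb: "nbrs H1 x \<subseteq> nbrs H x" "nbrs H x - {fst l} \<subseteq> nbrs H1 x \<or> x = fst l" for x
      by (auto simp: H1' nbrs_def del_verts_def)
    have "del_verts H1 (fst ` set ls) = del_verts H (fst ` set (l # ls))"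
      by (auto simp: H1' del_verts_def)
    moreover have "distinct (snd m) \<and> set (snd m) \<subseteq> nbrs H (fst m) \<and>
      nbrs H (fst m) - fst ` set (l # ls) \<subseteq> set (snd m)" if m: "m \<in> set (l # ls)" for m
    proof (cases "m = l")
      case True
      then show ?thesis using H1(1) by (auto simp: removes_def)
    next
      case False
      then have "m \<in> set ls" using m by simp
      moreover from this have "fst m \<noteq> fst l" using Cons.prems(2) by (metis distinct.simps(2) image_eqI list.map(2) list.set_map)
      ultimately show ?thesis using IH nb[of "fst m"] by fastforce
    qed
    ultimately show ?case using IH by blast
  qed
  then show "H' = del_verts H (fst ` set ls)"
    "\<And>l. l \<in> set ls \<Longrightarrow> distinct (snd l) \<and> set (snd l) \<subseteq> nbrs H (fst l) \<and>
       nbrs H (fst l) - fst ` set ls \<subseteq> set (snd l)" by auto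
qed

section \<open>The recursion\<close>

lemma bind_prog_eq: "m s = Some (r, s') \<Longrightarrow> bind_prog m f s = f r s'"
  by (simp add: bind_prog_def)

lemma push_edge_eq: "push_edge e s = Some ((), s\<lparr>cur := e # cur s, cost := cost s + 1\<rparr>)"
  by (simp add: push_edge_def step_def)

lemma pop_edge_eq: "pop_edge s = Some ((), s\<lparr>cur := tl (cur s), cost := cost s + 1\<rparr>)"
  by (simp add: pop_edge_def step_def)

lemma tick_eq: "tick s = Some ((), s\<lparr>cost := cost s + 1\<rparr>)"
  by (simp add: tick_def step_def)

text \<open>The numbers \<open>y\<close> are the amounts by which the calls overfulfil the bound given by \<open>k\<close>.\<close>

lemma for_each_outputs:
  assumes body: "\<And>l s. l \<in> set ls \<Longrightarrow> stores V n H s \<Longrightarrow> cur s = cs \<Longrightarrow>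
      \<exists>s' os. f l s = Some ((), s') \<and> stores V n H s' \<and> cur s' = cs \<and> out s' = out s @ os \<and>
        P (fst l) os \<and> cost s' + y (fst l) \<le> cost s + k (fst l)"
    and "distinct (map fst ls)" "stores V n H s" "cur s = cs"
  shows "\<exists>s' outs. for_each ls f s = Some ((), s') \<and> stores V n H s' \<and> cur s' = cs \<and>
    out s' = out s @ concat (map outs (map fst ls)) \<and> (\<forall>u\<in>fst ` set ls. P u (outs u)) \<and>
    cost s' + (\<Sum>u\<leftarrow>map fst ls. y u) \<le> cost s + (\<Sum>u\<leftarrow>map fst ls. k u + 1) + 1"
  using assms
proof (induction ls arbitrary: s)
  case Nil
  then show ?case by (simp add: tick_eq)
next
  case (Cons l ls)
  let ?s = "s\<lparr>cost := cost s + 1\<rparr>"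
  have "stores V n H ?s" "cur ?s = cs" using Cons.prems by simp_all
  then obtain s1 os where 1: "f l ?s = Some ((), s1)" "stores V n H s1" "cur s1 = cs"
    "out s1 = out s @ os" "P (fst l) os" "cost s1 + y (fst l) \<le> cost s + 1 + k (fst l)"
    using Cons.prems(1)[of l ?s] by auto
  have "\<exists>s' outs. for_each ls f s1 = Some ((), s') \<and> stores V n H s' \<and> cur s' = cs \<and>
    out s' = out s1 @ concat (map outs (map fst ls)) \<and> (\<forall>u\<in>fst ` set ls. P u (outs u)) \<and>
    cost s' + (\<Sum>u\<leftarrow>map fst ls. y u) \<le> cost s1 + (\<Sum>u\<leftarrow>map fst ls. k u + 1) + 1"
    using Cons.prems 1 by (intro Cons.IH) auto
  then obtain s2 outs where 2: "for_each ls f s1 = Some ((), s2)" "stores V n H s2" "cur s2 = cs"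
    "out s2 = out s1 @ concat (map outs (map fst ls))" "\<forall>u\<in>fst ` set ls. P u (outs u)"
    "cost s2 + (\<Sum>u\<leftarrow>map fst ls. y u) \<le> cost s1 + (\<Sum>u\<leftarrow>map fst ls. k u + 1) + 1"
    by blast
  let ?outs = "outs(fst l := os)"
  have ni: "fst l \<notin> fst ` set ls" using Cons.prems(2) by simp
  have "?outs u = outs u" if "u \<in> set (map fst ls)" for u
    using ni that by (metis fun_upd_other list.set_map)
  then have "map ?outs (map fst ls) = map outs (map fst ls)" by (rule map_cong[OF refl])
  then have "out s2 = out s @ concat (map ?outs (map fst (l # ls)))"
    unfolding 2(4) 1(4) by (simp only: list.map concat.simps fun_upd_same append_assoc)
  moreover have "for_each (l # ls) f s = Some ((), s2)"
    using 1 2 by (simp add: bind_prog_eq[OF tick_eq] bind_prog_eq)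
  moreover have "\<forall>u\<in>fst ` set (l # ls). P u (?outs u)" using 1 2 ni by auto
  moreover have "cost s2 + (\<Sum>u\<leftarrow>map fst (l # ls). y u) \<le> cost s + (\<Sum>u\<leftarrow>map fst (l # ls). k u + 1) + 1"
    using 1 2 by simp
  ultimately show ?case using 2 by blast
qed

text \<open>One step of the recursion costs at most \<open>29 + 142 d + 116 S1 + 111 S2\<close> outside the recursive
  calls, where \<open>1 \<le> d\<close>; see the end of the proof of \<open>explores_branch\<close>.\<close>

definition unit_cost :: nat where "unit_cost = 171"

text \<open>Determined by a call on a graph without edges: the credit is 3, so
  \<open>27 * unit_cost\<close> offsets \<open>9 * unit_cost * 3\<close>, and finding no vertex and
  emitting take 2 + 1 steps.\<close>

definition solution_cost :: nat where "solution_cost = 27 * unit_cost + 3"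

text \<open>The induction statement. It joins termination, restored graph and stack, agreement of
  the new output with some execution of \<open>Rec\<close>, and the potential bound.\<close>

definition explores :: "'a set \<Rightarrow> nat \<Rightarrow> 'a graph \<Rightarrow> 'a mem \<Rightarrow> bool" where
  "explores V n H s \<longleftrightarrow> (\<exists>s' outs. rec_impl s = Some ((), s') \<and> stores V n H s' \<and> cur s' = cur s \<and>
     out s' = out s @ outs \<and> Rec (set (cur s)) H outs \<and>
     cost s' + 9 * unit_cost * credit H \<le> cost s + budget solution_cost unit_cost H)"

text \<open>The coefficient 111 is 54 + 57 for deleting and restoring an edge at distance 2; 5 is 3
  + 2 per entry of \<open>xs\<close>; 4 counts push, pop and the final tests of the two
  loops.\<close>

lemma explores_child:
  assumes st: "stores V n (far H v) s" and H: "simple_graph H" and e: "{v, u} \<in> edges H"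
    and IH: "\<And>s. stores V n (child H v {v, u}) s \<Longrightarrow> explores V n (child H v {v, u}) s"
    and xs: "distinct xs" "set xs \<subseteq> nbrs H u" "nbrs H u - closed_nbhd H v \<subseteq> set xs" "set xs \<subseteq> V"
  shows "\<exists>s' os. (do { push_edge {v, u};
            sect \<leftarrow> map_each xs delete_incident;
            rec_impl;
            for_each (rev sect) undo_delete_incident;
            pop_edge }) s = Some ((), s') \<and> stores V n (far H v) s' \<and> cur s' = cur s \<and>
      out s' = out s @ os \<and> Rec (insert {v, u} (set (cur s))) (child H v {v, u}) os \<and>
      cost s' + 9 * unit_cost * credit (child H v {v, u}) \<le>
        cost s + (budget solution_cost unit_cost (child H v {v, u}) +
          (111 * (\<Sum>x\<in>nbrs H u. degree (far H v) x) + 5 * degree H u + 4))"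
proof -
  define s0 where "s0 = s\<lparr>cur := {v, u} # cur s, cost := cost s + 1\<rparr>"
  let ?F = "far H v"
  have st0: "stores V n ?F s0" using st by (simp add: s0_def)
  obtain sect s1 where 1: "map_each xs delete_incident s0 = Some (sect, s1)" "cur s1 = cur s0"
    "out s1 = out s0" "cost s1 \<le> cost s0 + ((\<Sum>x\<leftarrow>xs. 54 * degree ?F x + 3) + 1)"
    "map fst sect = xs \<and> (\<exists>H'. path isolates ?F sect H' \<and> stores V n H' s1)"
    using runs_map_each_delete_incident[OF st0 xs(4)] by (rule runsE)
  then obtain H' where H': "path isolates ?F sect H'" "stores V n H' s1" by auto
  have fx: "fst ` set sect = set xs" using 1(5) by (metis list.set_map)
  \<comment> \<open>The log of \<open>u\<close> may contain vertices of \<open>N[v]\<close>, but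
    these carry no edges of \<open>far H v\<close>. Isolating the vertices of \<open>xs\<close> thus
    removes precisely the edges of \<open>Sect\<close>.\<close>
  have "f \<inter> set xs = {} \<longleftrightarrow> f \<inter> nbrs H u = {}" if "f \<inter> closed_nbhd H v = {}" for f
    using xs that by blast
  then have "edges H' = edges (child H v {v, u})"
    unfolding path_isolates(2)[OF H'(1)] edges_child[OF H e] fx edges_far by auto
  moreover have "verts H' = verts (child H v {v, u})"
    by (simp add: path_isolates(1)[OF H'(1)] child_def del_edges_def)
  ultimately have child: "H' = child H v {v, u}" by (intro graph.equality) simp_all
  obtain s2 os where 2: "rec_impl s1 = Some ((), s2)" "stores V n H' s2" "cur s2 = cur s1"
    "out s2 = out s1 @ os" "Rec (set (cur s1)) H' os"
    "cost s2 + 9 * unit_cost * credit H' \<le> cost s1 + budget solution_cost unit_cost H'"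
    using IH[of s1] H'(2) unfolding child explores_def by blast
  have "runs (for_each (rev sect) undo_delete_incident) s2
    ((\<Sum>l\<leftarrow>sect. (57 * length (snd l) + 1) + 1) + 1) (\<lambda>_ s'. stores V n ?F s')"
    by (rule runs_undo_path[OF runs_undo_delete_incident H'(1) 2(2)])
  then obtain s3 where 3: "for_each (rev sect) undo_delete_incident s2 = Some ((), s3)"
    "cur s3 = cur s2" "out s3 = out s2"
    "cost s3 \<le> cost s2 + ((\<Sum>l\<leftarrow>sect. (57 * length (snd l) + 1) + 1) + 1)" "stores V n ?F s3"
    by (auto elim: runsE)
  define s4 where "s4 = s3\<lparr>cur := tl (cur s3), cost := cost s3 + 1\<rparr>"
  have S: "(\<Sum>x\<in>set xs. degree ?F x) \<le> (\<Sum>x\<in>nbrs H u. degree ?F x)"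
    by (rule sum_mono2) (use xs H in \<open>auto simp: finite_nbrs\<close>)
  have len: "length xs \<le> degree H u"
    using card_mono[OF finite_nbrs[OF H] xs(2)] distinct_card[OF xs(1)]
    by (simp add: degree_eq_card_nbrs[OF H])
  have sumxs: "(\<Sum>x\<leftarrow>xs. degree ?F x) = (\<Sum>x\<in>set xs. degree ?F x)"
    using xs(1) by (rule sum_list_distinct_conv_sum_set)
  have "(\<Sum>x\<leftarrow>xs. 54 * degree ?F x + 3) = 54 * (\<Sum>x\<leftarrow>xs. degree ?F x) + 3 * length xs"
    by (induction xs) auto
  moreover have "(\<Sum>l\<leftarrow>sect. (57 * length (snd l) + 1) + 1) \<le> (\<Sum>l\<leftarrow>sect. (57 * degree ?F (fst l) + 1) + 1)"
    using path_isolates(3)[OF H'(1)] by (intro sum_list_mono) auto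
  moreover have "(\<Sum>l\<leftarrow>sect. (57 * degree ?F (fst l) + 1) + 1)
      = 57 * (\<Sum>x\<leftarrow>map fst sect. degree ?F x) + 2 * length (map fst sect)"
    by (induction sect) auto
  ultimately have "cost s4 + 9 * unit_cost * credit H' \<le> cost s + (budget solution_cost unit_cost H' +
      (111 * (\<Sum>x\<in>nbrs H u. degree ?F x) + 5 * degree H u + 4))"
    using 1(4,5) 2(6) 3(4) S len unfolding sumxs[symmetric] by (simp add: s0_def s4_def)
  moreover have "(do { push_edge {v, u};
            sect \<leftarrow> map_each xs delete_incident;
            rec_impl;
            for_each (rev sect) undo_delete_incident;
            pop_edge }) s = Some ((), s4)"
    unfolding bind_prog_eq[OF push_edge_eq] s0_def[symmetric] bind_prog_eq[where m = "map_each xs delete_incident", OF 1(1)]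
      bind_prog_eq[where m = rec_impl, OF 2(1)] bind_prog_eq[where m = "for_each (rev sect) undo_delete_incident", OF 3(1)] pop_edge_eq s4_def ..
  moreover have "stores V n ?F s4" "cur s4 = cur s" "out s4 = out s @ os"
    using 1 2 3 by (simp_all add: s4_def s0_def)
  moreover have "Rec (insert {v, u} (set (cur s))) (child H v {v, u}) os"
    using 2(5) 1(2) child by (simp add: s0_def)
  ultimately show ?thesis unfolding child by blast
qed

text \<open>\<open>IH\<close> applies to every recursive call: deleting \<open>v\<close> loses its
  \<open>d \<ge> 1\<close> edges, and the child of \<open>{v, u}\<close> loses at least this
  edge.\<close>

lemma explores_branch:
  assumes st: "stores V n H s1" and C: "C4_free H" and ne: "edges H \<noteq> {}"
    and v: "max_degree_vertex H v"
    and IH: "\<And>H' s. card (edges H') < card (edges H) \<Longrightarrow> stores V n H' s \<Longrightarrow> C4_free H' \<Longrightarrow> explores V n H' s"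
    and mv: "max_vertex s = Some (Some v, s1)"
    and s1: "cur s1 = cur s" "out s1 = out s" "cost s1 \<le> cost s + 2"
  shows "explores V n H s"
proof -
  let ?K = unit_cost and ?a = solution_cost and ?N = "nbrs H v"
  have H: "simple_graph H" using st by (rule stores_simple)
  have fin: "finite (edges H)" using H by (rule simple_finite_edges)
  have vH: "v \<in> verts H" using v by (simp add: max_degree_vertex_def)
  have d1: "1 \<le> degree H v"
  proof -
    obtain e where "e \<in> edges H" using ne by blast
    then obtain x y where "{x, y} \<in> edges H" by (rule simple_edgeE[OF H])
    then show ?thesis using degree_pos[OF H, of x y] degree_le_max[OF H v, of x] by simp
  qed
  have "card ?N = degree H v" by (simp add: degree_eq_card_nbrs[OF H])
  then have smaller: "card (edges (del_verts H {v})) < card (edges H)"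
    using card_edges_del_vert[OF H, of v] d1 by simp
  obtain l s2 where 2: "delete_vertex v s1 = Some (l, s2)" "cur s2 = cur s1" "out s2 = out s1"
    "cost s2 \<le> cost s1 + (54 * degree H v + 11)"
    "fst l = v \<and> (\<exists>H'. removes H l H' \<and> stores V n H' s2)"
    using runs_delete_vertex[OF st vH] by (rule runsE)
  then have l: "fst l = v" "removes H l (del_verts H {v})" "distinct (snd l)" "set (snd l) = ?N"
    and st2: "stores V n (del_verts H {v}) s2" by (auto simp: removes_def)
  let ?H0 = "del_verts H {v}" and ?ws = "snd l"
  have "explores V n ?H0 s2"
    using IH[OF smaller st2] C4_free_mono[OF C, of ?H0] by (auto simp: del_verts_def)
  then obtain s3 out0 where 3: "rec_impl s2 = Some ((), s3)" "stores V n ?H0 s3" "cur s3 = cur s2"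
    "out s3 = out s2 @ out0" "Rec (set (cur s2)) ?H0 out0"
    "cost s3 + 9 * ?K * credit ?H0 \<le> cost s2 + budget ?a ?K ?H0"
    unfolding explores_def by blast
  have wsV: "set ?ws \<subseteq> verts ?H0" using l nbrs_subset[OF H, of v] by (auto simp: del_verts_def)
  obtain logs s4 where 4: "map_each ?ws delete_vertex s3 = Some (logs, s4)" "cur s4 = cur s3" "out s4 = out s3"
    "cost s4 \<le> cost s3 + ((\<Sum>x\<leftarrow>?ws. 54 * degree ?H0 x + 12) + 1)"
    "map fst logs = ?ws \<and> (\<exists>H'. path removes ?H0 logs H' \<and> stores V n H' s4)"
    using runs_map_each_delete_vertex[OF 3(2) wsV l(3)] by (rule runsE)
  then obtain H' where H': "path removes ?H0 logs H'" "stores V n H' s4" by auto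
  have logs: "map fst logs = ?ws" using 4 by simp
  then have flogs: "fst ` set logs = ?N" using l(4) by (metis list.set_map)
  have dl: "distinct (map fst logs)" using logs l(3) by simp
  have far: "H' = far H v"
    unfolding path_removes(1)[OF H'(1) dl] flogs
    by (auto simp: del_verts_def closed_nbhd_eq[OF H])
  \<comment> \<open>The logs refer to the graph without \<open>v\<close>. As \<open>v\<close> itself
    belongs to \<open>N[v]\<close>, the enclosure of each log carries over to
    \<open>H\<close>.\<close>
  have mem: "{v, fst m} \<in> edges H \<and> distinct (snd m) \<and> set (snd m) \<subseteq> nbrs H (fst m) \<and>
      nbrs H (fst m) - closed_nbhd H v \<subseteq> set (snd m)" if m: "m \<in> set logs" for m
  proof -
    have "fst m \<in> ?N" using flogs m by auto
    moreover have "nbrs ?H0 x \<subseteq> nbrs H x" "nbrs H x - {v} \<subseteq> nbrs ?H0 x" if "x \<noteq> v" for x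
      using that by (auto simp: nbrs_def del_verts_def)
    moreover have "fst m \<noteq> v" using \<open>fst m \<in> ?N\<close> nbrs_subset[OF H, of v] by auto
    ultimately show ?thesis
      using path_removes(2)[OF H'(1) dl m] flogs
      unfolding closed_nbhd_eq[OF H] by (fastforce simp: nbrs_def)
  qed
  define body where "body = (\<lambda>(u, xs). do {
            push_edge {v, u};
            sect \<leftarrow> map_each xs delete_incident;
            rec_impl;
            for_each (rev sect) undo_delete_incident;
            pop_edge })"
  let ?k = "\<lambda>u. budget ?a ?K (child H v {v, u}) +
    (111 * (\<Sum>x\<in>nbrs H u. degree (far H v) x) + 5 * degree H u + 4)"
  have "\<exists>s5 outs. for_each logs body s4 = Some ((), s5) \<and> stores V n (far H v) s5 \<and> cur s5 = cur s \<and>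
    out s5 = out s4 @ concat (map outs (map fst logs)) \<and>
    (\<forall>u\<in>fst ` set logs. Rec (insert {v, u} (set (cur s))) (child H v {v, u}) (outs u)) \<and>
    cost s5 + (\<Sum>u\<leftarrow>map fst logs. 9 * ?K * credit (child H v {v, u})) \<le>
      cost s4 + (\<Sum>u\<leftarrow>map fst logs. ?k u + 1) + 1"
  proof (rule for_each_outputs)
    fix m t assume m: "m \<in> set logs" and t: "stores V n (far H v) t" "cur t = cur s"
    have m': "{v, fst m} \<in> edges H" "distinct (snd m)" "set (snd m) \<subseteq> nbrs H (fst m)"
      "nbrs H (fst m) - closed_nbhd H v \<subseteq> set (snd m)" using mem[OF m] by simp_all
    have sV: "set (snd m) \<subseteq> V" using m'(3) nbrs_subset[OF H] stores_verts[OF st] by blast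
    have "{v, fst m} \<notin> edges (child H v {v, fst m})"
      by (auto simp: child_def del_edges_def del_verts_def closed_nbhd_def)
    then have "card (edges (child H v {v, fst m})) < card (edges H)"
      using m'(1) edges_child_subset[of H v] by (intro psubset_card_mono fin) auto
    then have "explores V n (child H v {v, fst m}) s'" if "stores V n (child H v {v, fst m}) s'" for s'
      using IH that C4_free_mono[OF C edges_child_subset] by blast
    from explores_child[OF t(1) H m'(1) this m'(2-4) sV]
    show "\<exists>s' os. body m t = Some ((), s') \<and> stores V n (far H v) s' \<and> cur s' = cur s \<and>
      out s' = out t @ os \<and> Rec (insert {v, fst m} (set (cur s))) (child H v {v, fst m}) os \<and>
      cost s' + 9 * ?K * credit (child H v {v, fst m}) \<le> cost t + ?k (fst m)"
      unfolding t(2) body_def case_prod_beta .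
  qed (use dl H'(2) far 4 3 2 s1 in simp_all)
  then obtain s5 outs where 5: "for_each logs body s4 = Some ((), s5)" "stores V n (far H v) s5"
    "cur s5 = cur s" "out s5 = out s4 @ concat (map outs (map fst logs))"
    "\<And>u. u \<in> ?N \<Longrightarrow> Rec (insert {v, u} (set (cur s))) (child H v {v, u}) (outs u)"
    "cost s5 + (\<Sum>u\<leftarrow>map fst logs. 9 * ?K * credit (child H v {v, u})) \<le>
      cost s4 + (\<Sum>u\<leftarrow>map fst logs. ?k u + 1) + 1"
    unfolding flogs by blast
  have lV: "fst m \<in> V" if "m \<in> set logs" for m
  proof -
    have "fst m \<in> verts H" using flogs that nbrs_subset[OF H, of v] by blast
    then show ?thesis using stores_verts[OF st] by blast
  qed
  have "runs (for_each (rev logs) undo_delete_vertex) s5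
    ((\<Sum>m\<leftarrow>logs. (57 * length (snd m) + 13) + 1) + 1) (\<lambda>_ s'. stores V n ?H0 s')"
    by (rule runs_undo_path[OF runs_undo_delete_vertex H'(1)]) (use lV 5 far in simp_all)
  then obtain s6 where 6: "for_each (rev logs) undo_delete_vertex s5 = Some ((), s6)"
    "cur s6 = cur s5" "out s6 = out s5"
    "cost s6 \<le> cost s5 + ((\<Sum>m\<leftarrow>logs. (57 * length (snd m) + 13) + 1) + 1)" "stores V n ?H0 s6"
    by (auto elim: runsE)
  have "runs (undo_delete_vertex l) s6 (57 * length (snd l) + 13) (\<lambda>_ s'. stores V n H s')"
    by (rule runs_undo_delete_vertex[OF l(2) 6(5)]) (use l vH stores_verts[OF st] in auto)
  then obtain s7 where 7: "undo_delete_vertex l s6 = Some ((), s7)" "cur s7 = cur s6" "out s7 = out s6"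
    "cost s7 \<le> cost s6 + (57 * length (snd l) + 13)" "stores V n H s7"
    by (auto elim: runsE)
  have "rec_impl s = Some ((), s7)"
    unfolding rec_impl.simps[of s] bind_prog_eq[where m = max_vertex, OF mv] option.case bind_prog_eq[where m = "delete_vertex v", OF 2(1)]
      bind_prog_eq[where m = rec_impl, OF 3(1)] bind_prog_eq[where m = "map_each ?ws delete_vertex", OF 4(1)] body_def[symmetric] bind_prog_eq[where m = "for_each logs body", OF 5(1)]
      bind_prog_eq[where m = "for_each (rev logs) undo_delete_vertex", OF 6(1)] 7(1) ..
  moreover have "cur s7 = cur s" using 5 6 7 by simp
  moreover have "out s7 = out s @ (out0 @ concat (map outs ?ws))"
    using 2 3 4 5 6 7 s1 logs by simp
  moreover have "Rec (set (cur s)) H (out0 @ concat (map outs ?ws))"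
  proof -
    \<comment> \<open>The loop indexes the outputs by neighbours, \<open>Rec\<close> by edges;
      \<open>g\<close> recovers \<open>u\<close> from \<open>{v, u}\<close>.\<close>
    define g where "g e = (THE u. e = {v, u})" for e
    have g: "g {v, u} = u" for u unfolding g_def by (rule the_equality) (auto simp: doubleton_eq_iff)
    have "Rec (set (cur s)) H (out0 @ concat (map (outs \<circ> g) (map (\<lambda>u. {v, u}) ?ws)))"
    proof (rule Rec.branch[OF ne v _ refl])
      show "Rec (set (cur s)) ?H0 out0" using 3(5) 2(2) s1 by simp
      show "distinct (map (\<lambda>u. {v, u}) ?ws)" using l(3) by (simp add: distinct_map inj_on_edge)
      show "set (map (\<lambda>u. {v, u}) ?ws) = incident_edges H v" by (simp add: incident_edges_eq[OF H] l(4))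
      fix e assume "e \<in> set (map (\<lambda>u. {v, u}) ?ws)"
      then obtain u where u: "u \<in> ?N" "e = {v, u}" using l(4) by auto
      show "Rec (insert e (set (cur s))) (del_edges (far H v) (Sect H v e)) ((outs \<circ> g) e)"
        using 5(5)[OF u(1)] by (simp add: u(2) g child_def)
    qed
    then show ?thesis by (simp add: comp_def g)
  qed
  moreover have "cost s7 + 9 * ?K * credit H \<le> cost s + budget ?a ?K H"
  proof -
    have conv: "(\<Sum>u\<leftarrow>?ws. f u) = (\<Sum>u\<in>?N. f u)" for f :: "'a \<Rightarrow> nat"
      using sum_list_distinct_conv_sum_set[OF l(3), of f] l(4) by simp
    define S1 S2 where "S1 = (\<Sum>u\<in>?N. degree H u)"
      and "S2 = (\<Sum>u\<in>?N. \<Sum>x\<in>nbrs H u. degree (far H v) x)"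
    define B Y where "B = (\<Sum>u\<in>?N. budget ?a ?K (child H v {v, u}))"
      and "Y = (\<Sum>u\<in>?N. 9 * ?K * credit (child H v {v, u}))"
    have cN: "card ?N = degree H v" by (simp add: degree_eq_card_nbrs[OF H])
    have lenl: "length ?ws = degree H v" using distinct_card[OF l(3)] l(4) cN by simp
    have dle: "degree ?H0 x \<le> degree H x" for x
      by (rule degree_mono[OF H]) (auto simp: del_verts_def)
    have "(\<Sum>x\<leftarrow>?ws. 54 * degree ?H0 x + 12) \<le> (\<Sum>x\<leftarrow>?ws. 54 * degree H x + 12)"
      using dle by (intro sum_list_mono) simp
    also have "\<dots> = 54 * S1 + 12 * degree H v"
      by (simp add: conv sum.distrib sum_distrib_left[symmetric] S1_def cN)
    finally have c4: "(\<Sum>x\<leftarrow>?ws. 54 * degree ?H0 x + 12) \<le> 54 * S1 + 12 * degree H v" .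
    have "length (snd m) \<le> degree H (fst m)" if "m \<in> set logs" for m
      using card_mono[OF finite_nbrs[OF H], of "set (snd m)" "fst m"] mem[OF that] distinct_card[of "snd m"]
      by (simp add: degree_eq_card_nbrs[OF H])
    then have "(\<Sum>m\<leftarrow>logs. (57 * length (snd m) + 13) + 1) \<le> (\<Sum>m\<leftarrow>logs. (57 * degree H (fst m) + 13) + 1)"
      by (intro sum_list_mono) simp
    also have "\<dots> = (\<Sum>u\<leftarrow>map fst logs. 57 * degree H u + 14)" by (induction logs) simp_all
    also have "\<dots> = 57 * S1 + 14 * degree H v"
      unfolding logs by (simp add: conv sum.distrib sum_distrib_left[symmetric] S1_def cN)
    finally have c6: "(\<Sum>m\<leftarrow>logs. (57 * length (snd m) + 13) + 1) \<le> 57 * S1 + 14 * degree H v" .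
    have c5: "(\<Sum>u\<leftarrow>map fst logs. ?k u + 1) = B + 111 * S2 + 5 * S1 + 5 * degree H v"
      unfolding logs conv
      by (simp add: conv sum.distrib sum_distrib_left[symmetric] S1_def S2_def B_def cN)
    have y5: "(\<Sum>u\<leftarrow>map fst logs. 9 * ?K * credit (child H v {v, u})) = Y"
      unfolding logs conv Y_def ..
    have "?K * (degree H v + S1 + S2) + budget ?a ?K ?H0 + B + 9 * ?K * credit H
      \<le> budget ?a ?K H + 9 * ?K * credit ?H0 + Y"
      unfolding S1_def S2_def B_def Y_def by (rule budget_branch[OF H C v])
    \<comment> \<open>The constant is 2 + 11 + 1 + 1 + 1 + 13, the coefficient of
      \<open>degree H v\<close> is 54 + 12 + 5 + 14 + 57, that of \<open>S1\<close> is 54 + 5 + 57.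
      As \<open>degree H v \<ge> 1\<close>, the constant 29 is absorbed by 171 = 29 + 142.\<close>
    moreover have "?K * (degree H v + S1 + S2) \<ge> 29 + 142 * degree H v + 116 * S1 + 111 * S2"
      using d1 by (simp add: unit_cost_def)
    ultimately show ?thesis
      using 7(4) 6(4) 5(6) 4(4) 3(6) 2(4) s1(3) c4 c6 lenl unfolding c5 y5 by linarith
  qed
  ultimately show ?thesis unfolding explores_def using 7(5) by blast
qed

text \<open>Induction on the number of edges, which also proves that the partial function
  \<open>rec_impl\<close> terminates.\<close>

lemma explores:
  assumes "stores V n H s" "C4_free H"
  shows "explores V n H s"
  using assms
proof (induction "card (edges H)" arbitrary: H s rule: less_induct)
  case less
  have H: "simple_graph H" using less.prems(1) by (rule stores_simple)
  have R: "rep V n (nbrs H) (verts H) s" "\<And>u. u \<in> V \<Longrightarrow> deg s u = degree H u"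
    using less.prems(1) by (auto simp: stores_def)
  obtain r s1 where 1: "max_vertex s = Some (r, s1)" "cur s1 = cur s" "out s1 = out s"
    "cost s1 \<le> cost s + 2" "rep V n (nbrs H) (verts H) s1 \<and> deg s1 = deg s \<and>
    (case r of None \<Rightarrow> \<forall>u\<in>verts H. deg s u = 0
     | Some v \<Rightarrow> v \<in> verts H \<and> 0 < deg s v \<and> (\<forall>u\<in>verts H. deg s u \<le> deg s v))"
    using runs_max_vertex[OF R(1)] by (rule runsE)
  have "rep V n (nbrs H) (verts H) s1" "deg s1 = deg s" using 1(5) by blast+
  then have st1: "stores V n H s1" using less.prems(1) by (simp add: stores_def)
  have VH: "verts H \<subseteq> V" using less.prems(1) by (rule stores_verts)
  show ?case
  proof (cases r)
    case None
    have E: "edges H = {}"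
    proof (rule ccontr)
      assume "edges H \<noteq> {}"
      then obtain e where "e \<in> edges H" by blast
      then obtain x y where xy: "x \<in> verts H" "{x, y} \<in> edges H" by (rule simple_edgeE[OF H])
      then have "deg s x = 0" using 1(5) None by simp
      then show False using degree_pos[OF H xy(2)] R(2)[of x] xy VH by auto
    qed
    define s2 where "s2 = s1\<lparr>out := out s1 @ [set (cur s1)], cost := cost s1 + 1\<rparr>"
    have "rec_impl s = Some ((), s2)"
      unfolding rec_impl.simps[of s] bind_prog_eq[where m = max_vertex, OF 1(1)] None option.case
      by (simp add: emit_def step_def s2_def)
    moreover have "stores V n H s2" "cur s2 = cur s" "out s2 = out s @ [set (cur s)]"
      using st1 1 by (simp_all add: s2_def)
    moreover have "Rec (set (cur s)) H [set (cur s)]" by (rule Rec.no_edges[OF E])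
    moreover have "cost s2 + 9 * unit_cost * credit H \<le> cost s + budget solution_cost unit_cost H"
      using 1(4) credit_empty[OF H E] by (simp add: s2_def budget_def solution_cost_def)
    ultimately show ?thesis unfolding explores_def by blast
  next
    case (Some v)
    have v: "v \<in> verts H" "0 < degree H v" "\<And>u. u \<in> verts H \<Longrightarrow> degree H u \<le> degree H v"
    proof -
      have "deg s u = degree H u" if "u \<in> verts H" for u using that VH R(2) by blast
      then show "v \<in> verts H" "0 < degree H v" "\<And>u. u \<in> verts H \<Longrightarrow> degree H u \<le> degree H v"
        using 1(5) Some by auto
    qed
    then have "max_degree_vertex H v" by (simp add: max_degree_vertex_def)
    moreover have "edges H \<noteq> {}" using v(2) by (auto simp: degree_def incident_edges_def)
    ultimately show ?thesis
      using explores_branch[OF st1 less.prems(2) _ _ less.hyps] 1 Some by simp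
  qed
qed

section \<open>Preprocessing\<close>

lemma stores_empty_graph:
  assumes "rings s (headers {} n) L" "\<And>h. L h = []"
  shows "stores {} n \<lparr>verts = {}, edges = {}\<rparr> s"
  using assms by (auto simp: stores_def rep'_def contents_def simple_graph_def)

lemma runs_make_buckets:
  fixes s :: "'a mem"
  assumes "rings s (headers {} m) (\<lambda>_. [])" "m \<le> n"
  shows "runs (for_each [m..<n] (\<lambda>d. make_empty (Bkt d))) s (3 * (n - m) + 1)
    (\<lambda>_ s'. rings s' (headers {} n) (\<lambda>_. []))"
  using assms
proof (induction "n - m" arbitrary: m s)
  case 0
  then show ?case by (simp add: runs_weaken[OF runs_tick])
next
  case (Suc k)
  then have m: "[m..<n] = m # [Suc m..<n]" "n - m = Suc (n - Suc m)" by (simp_all add: upt_conv_Cons)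
  have hd: "insert (Bkt m) (headers {} m) = headers {} (Suc m)" by (auto simp: headers_def lessThan_Suc)
  show ?case
    unfolding m for_each.simps
  proof (rule runs_bind[OF runs_tick, where k' = "2 + (3 * (n - Suc m) + 1)"])
    fix r and s1 :: "'a mem" assume "s1 = s\<lparr>cost := cost s + 1\<rparr>"
    then have s1: "rings s1 (headers {} m) (\<lambda>_. [])" using Suc.prems by simp
    show "runs (do { make_empty (Bkt m); for_each [Suc m..<n] (\<lambda>d. make_empty (Bkt d)) }) s1
      (2 + (3 * (n - Suc m) + 1)) (\<lambda>_ s'. rings s' (headers {} n) (\<lambda>_. []))"
    proof (rule runs_bind[OF runs_make_empty[OF s1]]; (elim conjE)?)
      fix r and s2 :: "'a mem" assume "rings s2 (insert (Bkt m) (headers {} m)) ((\<lambda>_. [])(Bkt m := []))"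
      then have "rings s2 (headers {} (Suc m)) (\<lambda>_. [])" unfolding hd by (simp add: fun_upd_idem)
      then show "runs (for_each [Suc m..<n] (\<lambda>d. make_empty (Bkt d))) s2 (3 * (n - Suc m) + 1)
        (\<lambda>_ s'. rings s' (headers {} n) (\<lambda>_. []))"
        using Suc.hyps(1)[of "Suc m" s2] Suc.hyps(2) Suc.prems by simp
    qed simp_all
  qed simp
qed

lemma runs_add_vertex:
  assumes st: "stores V n \<lparr>verts = V, edges = {}\<rparr> s" and u: "u \<notin> V" and n: "card V < n"
  shows "runs (do { make_empty (Adj u); set_deg u 0; insert_isolated u }) s 15
    (\<lambda>_ s'. stores (insert u V) n \<lparr>verts = insert u V, edges = {}\<rparr> s')"
proof -
  have nb: "nbrs \<lparr>verts = W, edges = {}\<rparr> = (\<lambda>_. {})" "degree \<lparr>verts = W, edges = {}\<rparr> = (\<lambda>_. 0)" for W :: "'a set"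
    by (simp_all add: fun_eq_iff nbrs_def degree_def incident_edges_def)
  have "rep V n (nbrs \<lparr>verts = V, edges = {}\<rparr>) (verts \<lparr>verts = V, edges = {}\<rparr>) s"
    using st unfolding stores_def by blast
  then have R: "rep V n (\<lambda>_. {}) V s" by (simp only: nb graph.select_convs)
  have R': "\<And>x. x \<in> V \<Longrightarrow> deg s x = 0" "finite V"
    using st by (simp_all add: stores_def nb)
  obtain L where L: "rings s (headers V n) L" "contents V n (\<lambda>_. {}) V (deg s) (deg s ` V) L"
    using R by (rule rep'E) blast
  have hd: "insert (Adj u) (headers V n) = headers (insert u V) n" by (auto simp: headers_def)
  have fresh: "Adj u \<notin> set (L k)" if "k \<in> headers V n" for k
    using that L(2) by (auto simp: headers_def contents_def)
  show ?thesis
  proof (rule runs_bind[OF runs_make_empty[OF L(1) _ fresh], where k' = 13]; (elim conjE)?)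
    fix r s1 assume s1: "rings s1 (insert (Adj u) (headers V n)) (L(Adj u := []))" "deg s1 = deg s"
    show "runs (do { set_deg u 0; insert_isolated u }) s1 13
      (\<lambda>_ s'. stores (insert u V) n \<lparr>verts = insert u V, edges = {}\<rparr> s')"
    proof (rule runs_bind[OF runs_set_deg, where k' = 12])
      fix r s2 assume s2: "s2 = s1\<lparr>deg := (deg s1)(u := 0), cost := cost s1 + 1\<rparr>"
      have d0: "deg s2 x = 0" if "x \<in> insert u V" for x using that R'(1) s1(2) s2 by auto
      have dV: "deg s2 ` V = deg s ` V" using R'(1) d0 by auto
      have ex: "{x \<in> V. deg s2 x = d} = {x \<in> V. deg s x = d}" for d using R'(1) d0 by auto
      have "contents (insert u V) n (\<lambda>_. {}) V (deg s2) (deg s2 ` V) (L(Adj u := []))"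
        using L(2) unfolding contents_def dV ex by auto
      moreover have "rings s2 (headers (insert u V) n) (L(Adj u := []))"
        using s1(1) unfolding hd s2 by simp
      ultimately have "rep (insert u V) n (\<lambda>_. {}) V s2"
        using d0 n by (auto simp: rep'_def)
      then show "runs (insert_isolated u) s2 12
        (\<lambda>_ s'. stores (insert u V) n \<lparr>verts = insert u V, edges = {}\<rparr> s')"
      proof (rule runs_weaken[OF runs_insert_isolated]; (elim conjE)?)
        fix r s3 assume "rep (insert u V) n (\<lambda>_. {}) (insert u V) s3" "deg s3 = deg s2"
        then show "stores (insert u V) n \<lparr>verts = insert u V, edges = {}\<rparr> s3"
          using d0 R'(2) u n by (simp add: stores_def nb simple_graph_def)
      qed (use u d0 n in simp_all)
    qed simp
  qed (use u in simp_all)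
qed

lemma runs_add_vertices:
  assumes "stores V n \<lparr>verts = V, edges = {}\<rparr> s" "distinct us" "set us \<inter> V = {}" "card V + length us \<le> n"
  shows "runs (for_each us (\<lambda>u. do { make_empty (Adj u); set_deg u 0; insert_isolated u })) s (16 * length us + 1)
    (\<lambda>_ s'. stores (V \<union> set us) n \<lparr>verts = V \<union> set us, edges = {}\<rparr> s')"
  using assms
proof (induction us arbitrary: V s)
  case Nil
  then show ?case by (simp add: runs_weaken[OF runs_tick])
next
  case (Cons u us)
  have fin: "finite V" using Cons.prems(1) by (simp add: stores_def)
  show ?case
    unfolding for_each.simps
  proof (rule runs_bind[OF runs_tick, where k' = "15 + (16 * length us + 1)"])
    fix r s1 assume "s1 = s\<lparr>cost := cost s + 1\<rparr>"
    then have s1: "stores V n \<lparr>verts = V, edges = {}\<rparr> s1" using Cons.prems by simp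
    show "runs (do { do { make_empty (Adj u); set_deg u 0; insert_isolated u };
        for_each us (\<lambda>u. do { make_empty (Adj u); set_deg u 0; insert_isolated u }) }) s1
      (15 + (16 * length us + 1))
      (\<lambda>_ s'. stores (V \<union> set (u # us)) n \<lparr>verts = V \<union> set (u # us), edges = {}\<rparr> s')"
    proof (rule runs_bind[OF runs_add_vertex[OF s1]])
      fix r s2 assume "stores (insert u V) n \<lparr>verts = insert u V, edges = {}\<rparr> s2"
      moreover have "insert u V \<union> set us = V \<union> set (u # us)" by auto
      ultimately show "runs (for_each us (\<lambda>u. do { make_empty (Adj u); set_deg u 0; insert_isolated u })) s2
        (16 * length us + 1)
        (\<lambda>_ s'. stores (V \<union> set (u # us)) n \<lparr>verts = V \<union> set (u # us), edges = {}\<rparr> s')"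
        using Cons.IH[of "insert u V" s2] Cons.prems fin by auto
    qed (use Cons.prems in auto)
  qed simp
qed

text \<open>Building the graph is viewed as undoing the deletion of its edges, so that
  \<open>runs_insert_edge\<close> applies unchanged.\<close>

lemma runs_add_edges:
  fixes es :: "('a \<times> 'a) list"
  defines "E \<equiv> \<lambda>es :: ('a \<times> 'a) list. set (map (\<lambda>(u, w). {u, w}) es)"
  assumes "stores V n (del_edges H (E es)) s" "simple_graph H"
    "distinct (map (\<lambda>(u, w). {u, w}) es)" "E es \<subseteq> edges H"
  shows "runs (for_each es (\<lambda>(u, w). insert_edge u w)) s (57 * length es + 1) (\<lambda>_ s'. stores V n H s')"
  using assms(2-)
proof (induction es arbitrary: s)
  case Nil
  then show ?case by (simp add: E_def runs_weaken[OF runs_tick])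
next
  case (Cons p es)
  obtain u w where p: "p = (u, w)" by (cases p)
  let ?H = "del_edges H (E es)"
  have e: "{u, w} \<in> edges ?H" using Cons.prems by (auto simp: p E_def del_edges_def)
  have H: "simple_graph ?H" using Cons.prems by (simp add: simple_del_edges)
  have eq: "del_edges H (E (p # es)) = del_edges ?H {{u, w}}"
    by (simp add: del_edges_Un E_def p)
  show ?case
    unfolding for_each.simps
  proof (rule runs_bind[OF runs_tick, where k' = "56 + (57 * length es + 1)"])
    fix r s1 assume "s1 = s\<lparr>cost := cost s + 1\<rparr>"
    then have "stores V n (del_edges ?H {{u, w}}) s1" using Cons.prems(1) unfolding eq by simp
    then show "runs (do { (case p of (u, w) \<Rightarrow> insert_edge u w); for_each es (\<lambda>(u, w). insert_edge u w) }) s1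
      (56 + (57 * length es + 1)) (\<lambda>_ s'. stores V n H s')"
      unfolding p case_prod_conv
    proof (rule runs_bind[OF runs_insert_edge[OF _ e H]])
      fix r s2 assume "stores V n ?H s2"
      then show "runs (for_each es (\<lambda>(u, w). insert_edge u w)) s2 (57 * length es + 1)
        (\<lambda>_ s'. stores V n H s')"
        using Cons.prems by (intro Cons.IH) (simp_all add: E_def)
    qed simp
  qed simp
qed

text \<open>With \<open>n\<close> vertices and \<open>m\<close> edges the actual count is
  \<open>19 * n + 57 * m + 5\<close>, of which 60 is a convenient common multiple bound.\<close>

lemma runs_preprocess:
  fixes G :: "'a graph" and s :: "'a mem"
  assumes G: "simple_graph G" and rep: "represents vs es G"
  shows "runs (preprocess vs es) s (60 * (card (verts G) + card (edges G) + 1))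
    (\<lambda>_ s'. stores (verts G) (card (verts G)) G s')"
proof -
  have vs: "distinct vs" "set vs = verts G" and es: "distinct (map (\<lambda>(u, w). {u, w}) es)"
    "set (map (\<lambda>(u, w). {u, w}) es) = edges G"
    using rep by (simp_all add: represents_def)
  have n: "length vs = card (verts G)" using distinct_card[OF vs(1)] vs(2) by simp
  have m: "length es = card (edges G)" using distinct_card[OF es(1)] es(2) by simp
  let ?n = "card (verts G)" and ?m = "card (edges G)"
  have "rings s {} (\<lambda>_ :: 'a cell. [])" by (simp add: rings_def)
  note top = runs_make_empty[OF this, of Top]
  have hd: "insert Top {} = headers {} 0" by (simp add: headers_def)
  have E: "del_edges G (edges G) = \<lparr>verts = verts G, edges = {}\<rparr>" by (simp add: del_edges_def)
  show ?thesis
    unfolding preprocess_def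
  proof (rule runs_bind[OF top, where k' = "(3 * ?n + 1) + ((16 * ?n + 1) + (57 * ?m + 1))"]; (elim conjE)?)
    fix r and s1 :: "'a mem" assume "rings s1 (insert Top {}) ((\<lambda>_. [])(Top := []))"
    then have s1: "rings s1 (headers {} 0) (\<lambda>_. [])" unfolding hd by (simp add: fun_upd_idem)
    show "runs (do { for_each [0..<length vs] (\<lambda>d. make_empty (Bkt d));
      for_each vs (\<lambda>u. do { make_empty (Adj u); set_deg u 0; insert_isolated u });
      for_each es (\<lambda>(u, w). insert_edge u w) }) s1 ((3 * ?n + 1) + ((16 * ?n + 1) + (57 * ?m + 1)))
      (\<lambda>_ s'. stores (verts G) ?n G s')"
    proof (rule runs_bind[OF runs_make_buckets[OF s1], where k' = "(16 * ?n + 1) + (57 * ?m + 1)"])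
      fix r and s2 :: "'a mem" assume "rings s2 (headers {} (length vs)) (\<lambda>_. [])"
      then have "stores {} ?n \<lparr>verts = {}, edges = {}\<rparr> s2" unfolding n by (rule stores_empty_graph) simp
      note add = runs_add_vertices[OF this vs(1)]
      show "runs (do { for_each vs (\<lambda>u. do { make_empty (Adj u); set_deg u 0; insert_isolated u });
        for_each es (\<lambda>(u, w). insert_edge u w) }) s2 ((16 * ?n + 1) + (57 * ?m + 1))
        (\<lambda>_ s'. stores (verts G) ?n G s')"
      proof (rule runs_bind[OF add, where k' = "57 * ?m + 1"])
        fix r s3 assume "stores ({} \<union> set vs) ?n \<lparr>verts = {} \<union> set vs, edges = {}\<rparr> s3"
        then have "stores (verts G) ?n (del_edges G (set (map (\<lambda>(u, w). {u, w}) es))) s3"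
          unfolding es(2) E vs(2) by simp
        then show "runs (for_each es (\<lambda>(u, w). insert_edge u w)) s3 (57 * ?m + 1)
          (\<lambda>_ s'. stores (verts G) ?n G s')"
          unfolding m[symmetric] by (rule runs_add_edges) (use G es in simp_all)
      qed (use n in simp_all)
    qed (use n in simp_all)
  qed simp_all
qed

theorem theorem2:
  "\<exists>c::nat. \<forall>(G :: 'a graph) vs es nx pv dgr.
     simple_graph G \<longrightarrow> C4_free G \<longrightarrow> represents vs es G \<longrightarrow>
     (\<forall>outs. Rec {} G outs \<longrightarrow>
        distinct outs \<and> set outs = {M. induced_matching G M}) \<and>
     (\<exists>s1 s2.
        preprocess vs es (start_mem nx pv dgr) = Some ((), s1) \<and>
        EnumIM vs es (start_mem nx pv dgr) = Some ((), s2) \<and>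
        Rec {} G (out s2) \<and>
        distinct (out s2) \<and> set (out s2) = {M. induced_matching G M} \<and>
        cost s1 \<le> c * (card (verts G) + card (edges G) + 1) \<and>
        cost s2 \<le> cost s1 + c * card {M. induced_matching G M} \<and>
        cost s2 \<le> c * (card (verts G) + card (edges G) + card {M. induced_matching G M}))"
proof (intro exI allI impI)
  fix G :: "'a graph" and vs es and nx pv :: "'a cell \<Rightarrow> 'a cell" and dgr :: "'a \<Rightarrow> nat"
  assume G: "simple_graph G" and C: "C4_free G" and rep: "represents vs es G"
  let ?s = "start_mem nx pv dgr" and ?N = "card {M. induced_matching G M}"
  let ?c = "solution_cost + 60" and ?vm = "card (verts G) + card (edges G)"
  have N: "card (IM G) = ?N" by (simp add: IM_def)
  have Rec: "distinct outs \<and> set outs = {M. induced_matching G M}" if "Rec {} G outs" for outs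
    using Rec_correct[OF that G] by (simp add: IM_def)
  \<comment> \<open>The empty matching is always counted, so \<open>?N\<close> absorbs the additive
    constant of the preprocessing in the last bound.\<close>
  have N1: "1 \<le> ?N"
  proof -
    have "0 < card (IM G)" using finite_IM[OF G] empty_IM[of G] by (auto simp: card_gt_0_iff)
    then show ?thesis using N by simp
  qed
  obtain s1 where 1: "preprocess vs es ?s = Some ((), s1)" "cur s1 = cur ?s" "out s1 = out ?s"
    "cost s1 \<le> cost ?s + 60 * (?vm + 1)" "stores (verts G) (card (verts G)) G s1"
    using runs_preprocess[OF G rep, of ?s] by (auto elim: runsE)
  obtain s2 outs where 2: "rec_impl s1 = Some ((), s2)" "out s2 = out s1 @ outs" "Rec (set (cur s1)) G outs"
    "cost s2 + 9 * unit_cost * credit G \<le> cost s1 + budget solution_cost unit_cost G"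
    using explores[OF 1(5) C] unfolding explores_def by blast
  have init: "cur ?s = []" "out ?s = []" "cost ?s = 0" by (simp_all add: start_mem_def)
  \<comment> \<open>The credit subtracted in \<open>explores\<close> outweighs the remaining term
    with \<open>min_degree_sum\<close>, which leaves a bound linear in the number of
    solutions.\<close>
  have "unit_cost * min_degree_sum G \<le> unit_cost * (4 * small_IM 2 G)"
    by (intro mult_le_mono2 min_degree_sum_le G C)
  also have "\<dots> \<le> 9 * unit_cost * credit G"
    by (simp add: credit_def algebra_simps)
  finally have c2: "cost s2 \<le> cost s1 + solution_cost * ?N"
    using 2(4) unfolding budget_def N by linarith
  have "EnumIM vs es ?s = Some ((), s2)"
    unfolding EnumIM_def bind_prog_eq[where m = "preprocess vs es", OF 1(1)] by (rule 2(1))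
  moreover have "Rec {} G (out s2)" using 1 2 init by simp
  moreover from Rec[OF this] have "distinct (out s2)" "set (out s2) = {M. induced_matching G M}" by auto
  moreover have "cost s1 \<le> ?c * (?vm + 1)" using 1(4) init by (simp add: algebra_simps)
  moreover have "cost s2 \<le> cost s1 + ?c * ?N" using c2 by (simp add: algebra_simps)
  moreover have "cost s2 \<le> ?c * (?vm + ?N)"
    using c2 1(4) init N1 by (simp add: algebra_simps)
  ultimately show "(\<forall>outs. Rec {} G outs \<longrightarrow>
        distinct outs \<and> set outs = {M. induced_matching G M}) \<and>
     (\<exists>s1 s2.
        preprocess vs es ?s = Some ((), s1) \<and>
        EnumIM vs es ?s = Some ((), s2) \<and>
        Rec {} G (out s2) \<and>
        distinct (out s2) \<and> set (out s2) = {M. induced_matching G M} \<and>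
        cost s1 \<le> ?c * (card (verts G) + card (edges G) + 1) \<and>
        cost s2 \<le> cost s1 + ?c * ?N \<and>
        cost s2 \<le> ?c * (card (verts G) + card (edges G) + ?N))"
    using Rec 1(1) by blast
qed

end
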